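(* Assume that the density $g$ of the shifts satisfies the polynomial decay assumption: there are $\beta\ge 0$ and $C_{max}\ge C_{min}>0$ with $C_{min}|k|^{-\beta}\le|\gamma_k|\le C_{max}|k|^{-\beta}$ for all $k\in\mathbb{Z}\setminus\{0\}$. Let $\tilde\theta$ be the spectral cut-off estimator with data-driven cut-off $\tilde N$ defined in the context. Then there exist $\gamma_2\in(0,1)$, a function $h_2$ with $h_2(\gamma)\to 0$ as $\gamma\to 0$, and a positive constant $C_2$, all independent of $\epsilon$ and $n$, such that for all $\epsilon>0$, all $n\ge 2$ and all $0<\gamma<\gamma_2$, $$\mathbb{E}_\theta\|\tilde\theta-\theta\|^2\le (1+h_2(\gamma))\inf_{N\le m_0}R(\theta,N)+\frac{C_2\epsilon^2}{n}\left(\frac{\|\theta\|^2\log^2(n)}{\gamma^2}\right)^{2\beta}+\frac{C_2\epsilon^2}{n}\frac{1}{\gamma^{4\beta+1}}+\frac{C_2}{n},$$ where $$R(\theta,N)=\sum_{|k|>N}|\theta_k|^2+\frac{\epsilon^2}{n}\sum_{|k|\le N}|\gamma_k|^{-2}+\frac1n\sum_{|k|\le N}|\theta_k|^2\left(\frac{1}{|\gamma_k|^2}-1\right).$$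
   Context: Model: $f:\mathbb{R}\to\mathbb{R}$ is an unknown 1-periodic function, square integrable on $[0,1]$, with Fourier coefficients $\theta_k=\int_0^1 e^{-2ik\pi x}f(x)\,dx$, $\theta=(\theta_k)_{k\in\mathbb{Z}}$. One observes $dY_j(x)=f(x-\tau_j)\,dx+\epsilon\,dW_j(x)$, $x\in[0,1]$, $j=1,\dots,n$, where $\epsilon>0$, the $W_j$ are independent standard Brownian motions on $[0,1]$, and the $\tau_j$ are i.i.d. real random variables, independent of the $W_j$, with known density $g$ with respect to Lebesgue measure on $\mathbb{R}$. Put $\gamma_k=\mathbb{E}(e^{-2i\pi k\tau_1})=\int_{\mathbb{R}}e^{-2i\pi kx}g(x)\,dx$, assumed nonzero for all $k$, and $$\tilde c_k=\frac1n\sum_{j=1}^n\int_0^1e^{-2ik\pi x}dY_j(x)=\theta_k\tilde\gamma_k+\frac{\epsilon}{\sqrt n}\xi_k,\qquad \tilde\gamma_k=\frac1n\sum_{j=1}^ne^{-2i\pi k\tau_j},\qquad \xi_k=\frac1{\sqrt n}\sum_{j=1}^n\int_0^1e^{-2ik\pi x}dW_j(x).$$ Here $\|\cdot\|$ is the $\ell^2(\mathbb{Z})$ norm and $\mathbb{E}_\theta$ is expectation under the model. The function $f$ and density $g$ are fixed; constants may depend on them. Estimator: $m_0=\inf\{k\in\mathbb{N}: |\gamma_k|^2\le \log^2(n)/n\}-1$. For $N\in\mathbb{N}=\{0,1,2,\dots\}$, $$\tilde U(Y,N)=-\sum_{|k|\le N}|\gamma_k|^{-2}\Big\{|\tilde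 c_k|^2-\frac{\epsilon^2}{n}\Big\}+\frac{\epsilon^2}{n}\sum_{|k|\le N}|\gamma_k|^{-2},$$ $\tilde N$ is a minimizer of $N\mapsto\tilde U(Y,N)$ over $N\le m_0$, and $\tilde\theta_k=\frac{\tilde c_k}{\gamma_k}\mathbf 1_{\{|k|\le\tilde N\}}$, $k\in\mathbb{Z}$. *)

theory Defs
  imports "HOL-Probability.Probability"
begin

section \<open>Fourier coefficients\<close>

definition fourier_char :: "int \<Rightarrow> real \<Rightarrow> complex" where
  "fourier_char k x = exp (- 2 * \<i> * of_int k * of_real pi * of_real x)"

definition fourier_coeff :: "(real \<Rightarrow> real) \<Rightarrow> int \<Rightarrow> complex" where
  "fourier_coeff f k = (LBINT x:{0..1}. fourier_char k x * of_real (f x))"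

definition periodic_L2 :: "(real \<Rightarrow> real) \<Rightarrow> bool" where
  "periodic_L2 f \<longleftrightarrow> f \<in> borel_measurable borel \<and> (\<forall>x. f (x + 1) = f x) \<and>
     set_integrable lborel {0..1} (\<lambda>x. (f x)\<^sup>2)"

definition l2_norm :: "(int \<Rightarrow> complex) \<Rightarrow> real" where
  "l2_norm u = sqrt (\<Sum>\<^sub>\<infinity>k. (cmod (u k))\<^sup>2)"

definition prob_density :: "(real \<Rightarrow> real) \<Rightarrow> bool" where
  "prob_density g \<longleftrightarrow> g \<in> borel_measurable borel \<and> (\<forall>x. 0 \<le> g x) \<and>
     (\<integral>\<^sup>+ x. ennreal (g x) \<partial>lborel) = 1"

text \<open>The eigenvalues gamma(k) = E exp(-2 i pi k tau) of a shift tau with density g.\<close>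

definition shift_coeff :: "(real \<Rightarrow> real) \<Rightarrow> int \<Rightarrow> complex" where
  "shift_coeff g k = (LBINT x. fourier_char k x * of_real (g x))"

section \<open>Brownian motion on the unit interval and the Wiener integral\<close>

definition brownian_motion01 :: "'a measure \<Rightarrow> (real \<Rightarrow> 'a \<Rightarrow> real) \<Rightarrow> bool" where
  "brownian_motion01 M W \<longleftrightarrow>
     (\<forall>t\<in>{0..1}. W t \<in> borel_measurable M) \<and>
     (AE \<omega> in M. W 0 \<omega> = 0) \<and>
     (AE \<omega> in M. continuous_on {0..1} (\<lambda>t. W t \<omega>)) \<and>
     (\<forall>s t. 0 \<le> s \<and> s < t \<and> t \<le> 1 \<longrightarrow>
        distributed M lborel (\<lambda>\<omega>. W t \<omega> - W s \<omega>) (normal_density 0 (sqrt (t - s)))) \<and>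
     (\<forall>(m::nat) t. 0 \<le> t 0 \<and> t m \<le> 1 \<and> (\<forall>i<m. t i \<le> t (Suc i)) \<longrightarrow>
        prob_space.indep_vars M (\<lambda>_. borel) (\<lambda>i \<omega>. W (t (Suc i)) \<omega> - W (t i) \<omega>) {..<m})"

text \<open>A list of triples (c, a, b) encodes the step function that is the sum of the
  functions c times the indicator of the interval from a (excluded) to b (included).\<close>

type_synonym steps = "(complex \<times> real \<times> real) list"

definition steps01 :: "steps \<Rightarrow> bool" where
  "steps01 s \<longleftrightarrow> (\<forall>(c, a, b)\<in>set s. 0 \<le> a \<and> a \<le> b \<and> b \<le> 1)"

definition step_fun :: "steps \<Rightarrow> real \<Rightarrow> complex" where
  "step_fun s x = (\<Sum>(c, a, b)\<leftarrow>s. c * indicator {a<..b} x)"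

definition step_integral :: "steps \<Rightarrow> (real \<Rightarrow> real) \<Rightarrow> complex" where
  "step_integral s w = (\<Sum>(c, a, b)\<leftarrow>s. c * of_real (w b - w a))"

text \<open>I is a version of the Wiener integral of phi over the unit interval: it is the limit in
  mean square of the integrals of step functions that converge to phi in mean square. By the
  Ito isometry this determines I up to a null set.\<close>

definition has_wiener_integral ::
    "'a measure \<Rightarrow> (real \<Rightarrow> 'a \<Rightarrow> real) \<Rightarrow> (real \<Rightarrow> complex) \<Rightarrow> ('a \<Rightarrow> complex) \<Rightarrow> bool" where
  "has_wiener_integral M W \<phi> I \<longleftrightarrow> I \<in> borel_measurable M \<and>
     (\<exists>s :: nat \<Rightarrow> steps. (\<forall>m. steps01 (s m)) \<and>
        (\<lambda>m. \<integral>\<^sup>+ x\<in>{0..1}. ennreal ((cmod (step_fun (s m) x - \<phi> x))\<^sup>2) \<partial>lborel) \<longlonglongrightarrow> 0 \<and>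
        (\<lambda>m. \<integral>\<^sup>+ \<omega>. ennreal ((cmod (step_integral (s m) (\<lambda>t. W t \<omega>) - I \<omega>))\<^sup>2) \<partial>M) \<longlonglongrightarrow> 0)"

section \<open>The shifted curves model\<close>

text \<open>The integral over the unit interval of phi against dY, where
  dY(x) = f(x - tau) dx + eps dW(x).\<close>

definition has_obs_integral ::
    "'a measure \<Rightarrow> (real \<Rightarrow> real) \<Rightarrow> real \<Rightarrow> ('a \<Rightarrow> real) \<Rightarrow> (real \<Rightarrow> 'a \<Rightarrow> real) \<Rightarrow>
     (real \<Rightarrow> complex) \<Rightarrow> ('a \<Rightarrow> complex) \<Rightarrow> bool" where
  "has_obs_integral M f \<epsilon> \<tau> W \<phi> Z \<longleftrightarrow>
     (\<exists>I. has_wiener_integral M W \<phi> I \<and>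
        (\<forall>\<omega>\<in>space M. Z \<omega> = (LBINT x:{0..1}. \<phi> x * of_real (f (x - \<tau> \<omega>))) + of_real \<epsilon> * I \<omega>))"

text \<open>Randomness of the model: shifts \<open>\<tau> j\<close> and Brownian motions \<open>W j\<close> for j in {1..n}. Z j k is
  the integral of \<open>fourier_char k\<close> against the observed process dY(j). Independence of the shifts from
  the noise is stated for the generated sigma-algebras, because \<open>indep_var\<close> needs both random
  variables to have the same type.\<close>

definition shifted_curves_model ::
    "'a measure \<Rightarrow> (real \<Rightarrow> real) \<Rightarrow> (real \<Rightarrow> real) \<Rightarrow> real \<Rightarrow> nat \<Rightarrow> (nat \<Rightarrow> 'a \<Rightarrow> real) \<Rightarrow>
     (nat \<Rightarrow> real \<Rightarrow> 'a \<Rightarrow> real) \<Rightarrow> (nat \<Rightarrow> int \<Rightarrow> 'a \<Rightarrow> complex) \<Rightarrow> bool" where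
  "shifted_curves_model M f g \<epsilon> n \<tau> W Z \<longleftrightarrow>
     prob_space M \<and>
     (\<forall>j\<in>{1..n}. distributed M lborel (\<tau> j) (\<lambda>x. ennreal (g x))) \<and>
     prob_space.indep_vars M (\<lambda>_. borel) \<tau> {1..n} \<and>
     (\<forall>j\<in>{1..n}. brownian_motion01 M (W j)) \<and>
     prob_space.indep_vars M (\<lambda>_. Pi\<^sub>M {0..1} (\<lambda>_. borel))
       (\<lambda>j \<omega>. \<lambda>t\<in>{0..1}. W j t \<omega>) {1..n} \<and>
     prob_space.indep_set M
       (sets (vimage_algebra (space M) (\<lambda>\<omega>. \<lambda>j\<in>{1..n}. \<tau> j \<omega>) (Pi\<^sub>M {1..n} (\<lambda>_. borel))))
       (sets (vimage_algebra (space M) (\<lambda>\<omega>. \<lambda>(j, t)\<in>{1..n} \<times> {0..1}. W j t \<omega>)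
          (Pi\<^sub>M ({1..n} \<times> {0..1}) (\<lambda>_. borel)))) \<and>
     (\<forall>j\<in>{1..n}. \<forall>k. has_obs_integral M f \<epsilon> (\<tau> j) (W j) (fourier_char k) (Z j k))"

definition mean_coeff :: "nat \<Rightarrow> (nat \<Rightarrow> int \<Rightarrow> 'a \<Rightarrow> complex) \<Rightarrow> 'a \<Rightarrow> int \<Rightarrow> complex" where
  "mean_coeff n Z \<omega> k = (1 / of_nat n) * (\<Sum>j\<in>{1..n}. Z j k \<omega>)"

section \<open>The spectral cut-off estimator\<close>

text \<open>In the following definitions \<open>\<gamma>\<close> is the sequence of eigenvalues and c the sequence of averaged
  observed coefficients. The infimum in \<open>cutoff_max\<close> is at least 1, since gamma(0) = 1 and
  ln(n)^2 < n, so the subtraction on nat does not truncate; and the set is not empty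
  when gamma vanishes at infinity and n is at least 2.\<close>

definition cutoff_max :: "(int \<Rightarrow> complex) \<Rightarrow> nat \<Rightarrow> nat" where
  "cutoff_max \<gamma> n = Inf {k::nat. (cmod (\<gamma> (int k)))\<^sup>2 \<le> (ln (real n))\<^sup>2 / real n} - 1"

definition U_crit :: "(int \<Rightarrow> complex) \<Rightarrow> real \<Rightarrow> nat \<Rightarrow> (int \<Rightarrow> complex) \<Rightarrow> nat \<Rightarrow> real" where
  "U_crit \<gamma> \<epsilon> n c N =
     - (\<Sum>k\<in>{- int N..int N}. 1 / (cmod (\<gamma> k))\<^sup>2 * ((cmod (c k))\<^sup>2 - \<epsilon>\<^sup>2 / real n))
     + \<epsilon>\<^sup>2 / real n * (\<Sum>k\<in>{- int N..int N}. 1 / (cmod (\<gamma> k))\<^sup>2)"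

definition is_adaptive_cutoff ::
    "(int \<Rightarrow> complex) \<Rightarrow> real \<Rightarrow> nat \<Rightarrow> (int \<Rightarrow> complex) \<Rightarrow> nat \<Rightarrow> bool" where
  "is_adaptive_cutoff \<gamma> \<epsilon> n c N \<longleftrightarrow> N \<le> cutoff_max \<gamma> n \<and>
     (\<forall>N'\<le>cutoff_max \<gamma> n. U_crit \<gamma> \<epsilon> n c N \<le> U_crit \<gamma> \<epsilon> n c N')"

definition cutoff_estimator :: "(int \<Rightarrow> complex) \<Rightarrow> (int \<Rightarrow> complex) \<Rightarrow> nat \<Rightarrow> int \<Rightarrow> complex" where
  "cutoff_estimator \<gamma> c N k = (if \<bar>k\<bar> \<le> int N then c k / \<gamma> k else 0)"

definition cutoff_risk ::
    "(int \<Rightarrow> complex) \<Rightarrow> (int \<Rightarrow> complex) \<Rightarrow> real \<Rightarrow> nat \<Rightarrow> nat \<Rightarrow> real" where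
  "cutoff_risk \<gamma> \<theta> \<epsilon> n N =
     (\<Sum>\<^sub>\<infinity>k\<in>{k. \<bar>k\<bar> > int N}. (cmod (\<theta> k))\<^sup>2)
     + \<epsilon>\<^sup>2 / real n * (\<Sum>k\<in>{- int N..int N}. 1 / (cmod (\<gamma> k))\<^sup>2)
     + 1 / real n * (\<Sum>k\<in>{- int N..int N}. (cmod (\<theta> k))\<^sup>2 * (1 / (cmod (\<gamma> k))\<^sup>2 - 1))"

end

(* The shifts and the noise turn the problem into observing X(k) = theta(k) (1 + delta(k)) + sigma xi(k) / gamma(k)
   with sigma = eps / sqrt n. Minimality of U at the random cut-off Nt bounds the loss at Nt by the loss at a
   fixed cut-off N plus increments of centred sums between N and Nt. On the event that all |delta(k)|, |k| <= m0,
   are below eta, the increments that involve delta are at most eta times bias and variance; the increments of the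
   linear and quadratic noise sums exceed eta times bias and variance by O(sigma^2 eta^(-s)) in expectation,
   uniformly in Nt, by exponential moments. By Hoeffding's inequality and the definition of m0 the exceptional
   event has probability at most m0 exp(- eta^2 ln(n)^2 / 8) up to a constant. Since h2 may tend to 0 slowly, take
   eta^2 of order 1 / ln(1/gamma): either this probability is O(n^(-r)) with r large, or n is at most a small
   power of 1/gamma, and then the total variance up to m0 is O(eps^2 / (n gamma)). *)

theory Submission
  imports Defs "HOL-Real_Asymp.Real_Asymp"
begin

section \<open>Wiener integrals of step functions\<close>

text \<open>One obstacle is the noise. A Wiener integral is known only as a mean-square limit, and
  the integrals at \<open>k\<close> and \<open>- k\<close> are conjugate almost surely, so the
  complex noise is not an independent family. The probabilistic input is therefore the
  characteristic function of real linear forms, which survives the limit. The sums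
  \<open>Re + Im\<close> form an orthonormal real system indexed by all integers, and exponential
  moments of their squares follow from those of linear forms by mixing over an auxiliary Gaussian
  variable. The other obstacle is the factor in front of the risk, which must tend to 1. Adding the
  minimality of \<open>U\<close> to the loss makes the bias and variance increments cancel exactly.
  What remains is small relative to bias plus variance at both cut-offs; the share of the random
  cut-off is absorbed by using minimality once more, which asks for
  \<open>\<eta> \<le> 1 / 12\<close> and thereby fixes the range of \<open>\<gamma>\<close>. The
  quadratic noise at the fixed cut-off is not estimated at all, since its mean is zero.\<close>

definition unit_lborel :: "real measure" where
  "unit_lborel = restrict_space lborel {0..1}"

text \<open>Restricting the measure instead of writing set integrals makes the unit interval a
  probability space. Bounded functions are then integrable by the same rules as bounded random
  variables, and the mean-square limit lemmas serve both integrands and random variables.\<close>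

lemma prob_space_unit_lborel: "prob_space unit_lborel"
  by (rule prob_spaceI) (simp add: unit_lborel_def emeasure_restrict_space space_restrict_space)

lemma set_integral_unit_lborel:
  fixes f :: "real \<Rightarrow> 'b::{banach, second_countable_topology}"
  shows "(LBINT x:{0..1}. f x) = (\<integral>x. f x \<partial>unit_lborel)"
  unfolding unit_lborel_def set_lebesgue_integral_def by (subst integral_restrict_space) auto

lemma set_integrable_unit_lborel:
  fixes f :: "real \<Rightarrow> 'b::{banach, second_countable_topology}"
  shows "set_integrable lborel {0..1} f \<longleftrightarrow> integrable unit_lborel f"
  unfolding unit_lborel_def set_integrable_def by (subst integrable_restrict_space) auto

lemma measurable_unit_lborel: "f \<in> measurable borel N \<Longrightarrow> f \<in> measurable unit_lborel N"
  unfolding unit_lborel_def by (intro measurable_restrict_space1) auto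

text \<open>The argument \<open>F\<close> stays abstract because it is used twice: a Brownian path
  yields the discrete Wiener integral, a threshold function yields the step function itself. An
  identity that holds for all \<open>F\<close> transfers to both sides of the Ito isometry.\<close>

definition real_step :: "(real \<times> real \<times> real) list \<Rightarrow> (real \<Rightarrow> real) \<Rightarrow> real" where
  "real_step s F = (\<Sum>(c, a, b)\<leftarrow>s. c * (F b - F a))"

definition steps_in01 :: "(real \<times> real \<times> real) list \<Rightarrow> bool" where
  "steps_in01 s \<longleftrightarrow> (\<forall>(c, a, b)\<in>set s. 0 \<le> a \<and> a \<le> b \<and> b \<le> 1)"

text \<open>The intervals of a step list may overlap, while Brownian increments are independent over
  consecutive intervals. Sorting all end points gives a grid on which every interval is a union of
  cells; \<open>0\<close> is added so that the grid is not empty.\<close>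

lemma real_step_refine:
  assumes "steps_in01 s"
  obtains m :: nat and t d :: "nat \<Rightarrow> real"
  where "0 \<le> t 0" "t m \<le> 1" "\<And>i. i < m \<Longrightarrow> t i < t (Suc i)"
    "\<And>F. real_step s F = (\<Sum>i<m. d i * (F (t (Suc i)) - F (t i)))"
proof -
  define P where "P = insert 0 ((\<lambda>(c, a, b). a) ` set s \<union> (\<lambda>(c, a, b). b) ` set s)"
  have fin: "finite P" by (simp add: P_def)
  have P01: "P \<subseteq> {0..1}" using assms by (auto simp: P_def steps_in01_def split_beta)
  define pts where "pts = sorted_list_of_set P"
  have set_pts: "set pts = P" and srt: "sorted_wrt (<) pts"
    using fin by (auto simp: pts_def)
  define m where "m = length pts - 1"
  define t where "t i = pts ! i" for i
  have ne: "pts \<noteq> []" using set_pts by (auto simp: P_def)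
  hence len: "length pts = Suc m" by (cases pts) (auto simp: m_def)
  have tP: "t i \<in> P" if "i \<le> m" for i
    using that len set_pts by (auto simp: t_def intro!: nth_mem)
  have tmono: "t i < t j" if "i < j" "j \<le> m" for i j
    using srt that len by (auto simp: t_def sorted_wrt_iff_nth_less)
  have tmono_iff: "t i \<le> t j \<longleftrightarrow> i \<le> j" if "i \<le> m" "j \<le> m" for i j
    using tmono[of i j] tmono[of j i] that by (cases i j rule: linorder_cases) auto
  have tless_iff: "t i < t j \<longleftrightarrow> i < j" if "i \<le> m" "j \<le> m" for i j
    using tmono_iff[of j i] that by auto
  have ex: "\<exists>p\<le>m. x = t p" if "x \<in> P" for x
    using that set_pts[symmetric] len by (auto simp: in_set_conv_nth t_def less_Suc_eq_le)
  \<comment> \<open>An increment telescopes over the cells whose left end point lies in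
    \<open>{a..<b}\<close>.\<close>
  have split: "F b - F a = (\<Sum>i<m. (if a \<le> t i \<and> t i < b then 1 else 0) * (F (t (Suc i)) - F (t i)))"
    if "a \<in> P" "b \<in> P" "a \<le> b" for a b and F :: "real \<Rightarrow> real"
  proof -
    obtain p q where pq: "p \<le> m" "q \<le> m" "a = t p" "b = t q"
      using ex[OF \<open>a \<in> P\<close>] ex[OF \<open>b \<in> P\<close>] by blast
    have "p \<le> q" using tmono_iff[of p q] pq that by simp
    have "(\<Sum>i<m. (if a \<le> t i \<and> t i < b then 1 else 0) * (F (t (Suc i)) - F (t i)))
        = (\<Sum>i\<in>{p..<q}. F (t (Suc i)) - F (t i))"
    proof (intro sum.mono_neutral_cong_right ballI)
      show "{p..<q} \<subseteq> {..<m}" using pq by auto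
      fix i
      { assume "i \<in> {..<m} - {p..<q}"
        hence "\<not> (a \<le> t i \<and> t i < b)" using pq tmono_iff[of p i] tless_iff[of i q] by auto
        thus "(if a \<le> t i \<and> t i < b then 1 else 0) * (F (t (Suc i)) - F (t i)) = 0" by auto }
      { assume "i \<in> {p..<q}"
        hence "a \<le> t i \<and> t i < b" using pq tmono_iff[of p i] tless_iff[of i q] by auto
        thus "(if a \<le> t i \<and> t i < b then 1 else 0) * (F (t (Suc i)) - F (t i)) = F (t (Suc i)) - F (t i)"
          by simp }
    qed simp
    also have "\<dots> = F (t q) - F (t p)" using \<open>p \<le> q\<close> by (rule sum_Suc_diff')
    finally show ?thesis using pq by simp
  qed
  define d where "d i = (\<Sum>(c, a, b)\<leftarrow>s. c * (if a \<le> t i \<and> t i < b then 1 else 0))" for i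
  have main: "real_step s F = (\<Sum>i<m. d i * (F (t (Suc i)) - F (t i)))" for F
  proof -
    have "set s' \<subseteq> set s \<Longrightarrow> (\<Sum>(c, a, b)\<leftarrow>s'. c * (F b - F a)) =
      (\<Sum>i<m. (\<Sum>(c, a, b)\<leftarrow>s'. c * (if a \<le> t i \<and> t i < b then 1 else 0)) * (F (t (Suc i)) - F (t i)))" for s'
    proof (induction s')
      case Nil then show ?case by simp
    next
      case (Cons x s')
      obtain c a b where x: "x = (c, a, b)" by (metis prod_cases3)
      have "(c, a, b) \<in> set s" using Cons.prems x by auto
      hence ab: "a \<in> P" "b \<in> P" "a \<le> b" using assms
        unfolding P_def steps_in01_def by (auto simp: image_iff Bex_def split_beta)
      have "(\<Sum>(c, a, b)\<leftarrow>x # s'. c * (F b - F a)) = c * (F b - F a) + (\<Sum>(c, a, b)\<leftarrow>s'. c * (F b - F a))"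
        by (simp add: x)
      also have "\<dots> = (\<Sum>i<m. c * (if a \<le> t i \<and> t i < b then 1 else 0) * (F (t (Suc i)) - F (t i)))
        + (\<Sum>(c, a, b)\<leftarrow>s'. c * (F b - F a))"
        by (subst split[OF ab]) (simp add: sum_distrib_left mult.assoc)
      also have "\<dots> = (\<Sum>i<m. (\<Sum>(c, a, b)\<leftarrow>x # s'. c * (if a \<le> t i \<and> t i < b then 1 else 0)) * (F (t (Suc i)) - F (t i)))"
        using Cons.IH Cons.prems by (simp add: x distrib_right sum.distrib)
      finally show ?case .
    qed
    thus ?thesis by (simp add: real_step_def d_def)
  qed
  show ?thesis
    by (rule that[of t m d]) (use P01 tP[of 0] tP[of m] tmono main in \<open>auto simp only: subset_iff atLeastAtMost_iff le_refl le0 lessI Suc_le_eq\<close>)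
qed

text \<open>For a <= b the threshold function at b minus its value at a is the indicator of
  \<open>{a<..b}\<close>, so this is the real counterpart of \<open>step_fun\<close>.\<close>

definition real_step_fun :: "(real \<times> real \<times> real) list \<Rightarrow> real \<Rightarrow> real" where
  "real_step_fun s x = real_step s (\<lambda>y. if x \<le> y then 1 else 0)"

text \<open>The cells of the grid are disjoint, so all mixed products vanish. The resulting sum is
  also the variance of the discrete Wiener integral, because the increments over the cells are
  independent.\<close>

lemma real_step_fun_square_integral:
  assumes t: "0 \<le> t 0" "t m \<le> (1::real)" "\<And>i. i < m \<Longrightarrow> t i < t (Suc i)"
    and s: "\<And>F. real_step s F = (\<Sum>i<m. d i * (F (t (Suc i)) - F (t i)))"
  shows "set_integrable lborel {0..1} (\<lambda>x. (real_step_fun s x)\<^sup>2)"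
    and "(LBINT x:{0..1}. (real_step_fun s x)\<^sup>2) = (\<Sum>i<m. (d i)\<^sup>2 * (t (Suc i) - t i))"
proof -
  have tmono: "t i \<le> t j" if "i \<le> j" "j \<le> m" for i j
    using that
  proof (induction j)
    case (Suc j) then show ?case using t(3)[of j] by (cases "i = Suc j") auto
  qed auto
  have f: "real_step_fun s x = (\<Sum>i<m. d i * indicator {t i<..t (Suc i)} x)" for x
    unfolding real_step_fun_def s
  proof (intro sum.cong refl)
    fix i assume "i \<in> {..<m}"
    thus "d i * ((if x \<le> t (Suc i) then 1 else 0) - (if x \<le> t i then 1 else 0)) =
      d i * indicator {t i<..t (Suc i)} x" using t(3)[of i] by (auto simp: indicator_def)
  qed
  have f2: "(real_step_fun s x)\<^sup>2 = (\<Sum>i<m. (d i)\<^sup>2 * indicator {t i<..t (Suc i)} x)" for x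
  proof -
    have "(real_step_fun s x)\<^sup>2 = (\<Sum>i<m. \<Sum>j<m. (d i * indicator {t i<..t (Suc i)} x) * (d j * indicator {t j<..t (Suc j)} x))"
      by (simp only: f power2_eq_square sum_product)
    also have "\<dots> = (\<Sum>i<m. \<Sum>j<m. if j = i then (d i)\<^sup>2 * indicator {t i<..t (Suc i)} x else 0)"
    proof (intro sum.cong refl)
      fix i j assume ij: "i \<in> {..<m}" "j \<in> {..<m}"
      show "(d i * indicator {t i<..t (Suc i)} x) * (d j * indicator {t j<..t (Suc j)} x) =
        (if j = i then (d i)\<^sup>2 * indicator {t i<..t (Suc i)} x else 0)"
        using tmono[of "Suc i" j] tmono[of "Suc j" i] ij
        by (cases i j rule: linorder_cases) (auto simp: indicator_def power2_eq_square)
    qed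
    also have "\<dots> = (\<Sum>i<m. (d i)\<^sup>2 * indicator {t i<..t (Suc i)} x)" by simp
    finally show ?thesis .
  qed
  have sub: "indicator {0..1} x * (real_step_fun s x)\<^sup>2 = (\<Sum>i<m. (d i)\<^sup>2 * indicator {t i<..t (Suc i)} x)" for x
  proof (cases "x \<in> {0..1}")
    case False
    have "indicator {t i<..t (Suc i)} x = (0::real)" if "i < m" for i
      using tmono[of 0 i] tmono[of "Suc i" m] that t False by (auto simp: indicator_def)
    thus ?thesis using False by simp
  qed (simp add: f2)
  have int: "integrable lborel (\<lambda>x. (d i)\<^sup>2 * indicator {t i<..t (Suc i)} x :: real)" if "i < m" for i
    using t(3)[OF that] by (intro integrable_mult_right integrable_real_indicator) auto
  show "set_integrable lborel {0..1} (\<lambda>x. (real_step_fun s x)\<^sup>2)"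
    unfolding set_integrable_def real_scaleR_def sub
    by (intro Bochner_Integration.integrable_sum int) auto
  show "(LBINT x:{0..1}. (real_step_fun s x)\<^sup>2) = (\<Sum>i<m. (d i)\<^sup>2 * (t (Suc i) - t i))"
    unfolding set_lebesgue_integral_def using t(3) less_imp_le
    unfolding real_scaleR_def sub
  proof (subst Bochner_Integration.integral_sum)
    have "(\<integral>x. (d i)\<^sup>2 * indicator {t i<..t (Suc i)} x \<partial>lborel) = (d i)\<^sup>2 * (t (Suc i) - t i)"
      if "i < m" for i using t(3)[OF that] by simp
    thus "(\<Sum>i<m. \<integral>x. (d i)\<^sup>2 * indicator {t i<..t (Suc i)} x \<partial>lborel) = (\<Sum>i<m. (d i)\<^sup>2 * (t (Suc i) - t i))"
      by (intro sum.cong) auto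
  qed (auto simp del: integrable_mult_left_iff integrable_mult_right_iff intro!: int)
qed

lemma (in prob_space) char_normal_scaled:
  assumes X: "distributed M lborel X (normal_density 0 \<sigma>)" and "\<sigma> > 0"
  shows "char (distr M borel (\<lambda>\<omega>. d * X \<omega>)) u = of_real (exp (- (u\<^sup>2 * (d\<^sup>2 * \<sigma>\<^sup>2) / 2)))"
proof -
  have [measurable]: "X \<in> borel_measurable M" using distributed_measurable[OF X] by simp
  have Y: "distributed M lborel (\<lambda>\<omega>. X \<omega> / \<sigma>) std_normal_density"
    using normal_standard_normal_convert[of \<sigma> X 0] X \<open>\<sigma> > 0\<close> by simp
  have "char (distr M borel (\<lambda>\<omega>. d * X \<omega>)) u = (\<integral>\<omega>. iexp (u * (d * X \<omega>)) \<partial>M)"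
    by (simp add: char_def integral_distr del: of_real_mult)
  also have "\<dots> = (\<integral>\<omega>. iexp ((u * d * \<sigma>) * (X \<omega> / \<sigma>)) \<partial>M)"
  proof -
    have "u * (d * X \<omega>) = (u * d * \<sigma>) * (X \<omega> / \<sigma>)" for \<omega>
      using \<open>\<sigma> > 0\<close> by simp
    thus ?thesis by presburger
  qed
  also have "\<dots> = char (distr M lborel (\<lambda>\<omega>. X \<omega> / \<sigma>)) (u * d * \<sigma>)"
    by (simp add: char_def integral_distr del: of_real_mult of_real_divide)
  also have "distr M lborel (\<lambda>\<omega>. X \<omega> / \<sigma>) = std_normal_distribution"
    using distributed_distr_eq_density[OF Y] by simp
  finally show ?thesis by (simp add: char_std_normal_distribution power_mult_distrib mult.assoc)
qed

text \<open>Laws are tracked through characteristic functions: they multiply over the independent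
  cell increments, pass to mean-square limits, and make sense when the variance is zero.\<close>

lemma char_real_step:
  assumes "prob_space M" and W: "brownian_motion01 M W" and s: "steps_in01 s"
  shows "(\<lambda>\<omega>. real_step s (\<lambda>t. W t \<omega>)) \<in> borel_measurable M"
    and "set_integrable lborel {0..1} (\<lambda>x. (real_step_fun s x)\<^sup>2)"
    and "char (distr M borel (\<lambda>\<omega>. real_step s (\<lambda>t. W t \<omega>))) u =
      of_real (exp (- (u\<^sup>2 * (LBINT x:{0..1}. (real_step_fun s x)\<^sup>2) / 2)))"
proof -
  interpret prob_space M by fact
  obtain m t d where t: "0 \<le> t 0" "t m \<le> 1" "\<And>i. i < m \<Longrightarrow> t i < t (Suc i)"
    and eq: "\<And>F. real_step s F = (\<Sum>i<(m::nat). d i * (F (t (Suc i)) - F (t i)))"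
    using real_step_refine[OF s] by metis
  note int = real_step_fun_square_integral[OF t eq]
  show "set_integrable lborel {0..1} (\<lambda>x. (real_step_fun s x)\<^sup>2)" using int(1) .
  have tmono: "t i \<le> t j" if "i \<le> j" "j \<le> m" for i j
    using that
  proof (induction j)
    case (Suc j) then show ?case using t(3)[of j] by (cases "i = Suc j") auto
  qed auto
  have t01: "0 \<le> t i" "t i \<le> 1" if "i \<le> m" for i
    using tmono[of 0 i] tmono[of i m] t that by auto
  have [measurable]: "W x \<in> borel_measurable M" if "x \<in> {0..1}" for x
    using W that by (auto simp: brownian_motion01_def)
  have ind: "indep_vars (\<lambda>_. borel) (\<lambda>i \<omega>. W (t (Suc i)) \<omega> - W (t i) \<omega>) {..<m}"
  proof -
    have "\<forall>i<m. t i \<le> t (Suc i)" using t(3) less_imp_le by auto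
    with W t(1,2) show ?thesis unfolding brownian_motion01_def by meson
  qed
  have ind': "indep_vars (\<lambda>_. borel) (\<lambda>i \<omega>. d i * (W (t (Suc i)) \<omega> - W (t i) \<omega>)) {..<m}"
    by (rule indep_vars_compose2[OF ind]) auto
  have dist: "distributed M lborel (\<lambda>\<omega>. W (t (Suc i)) \<omega> - W (t i) \<omega>) (normal_density 0 (sqrt (t (Suc i) - t i)))"
    if "i < m" for i
  proof -
    have "0 \<le> t i \<and> t i < t (Suc i) \<and> t (Suc i) \<le> 1" using t01[of i] t01[of "Suc i"] t(3)[of i] that by auto
    with W show ?thesis unfolding brownian_motion01_def by meson
  qed
  show "(\<lambda>\<omega>. real_step s (\<lambda>t. W t \<omega>)) \<in> borel_measurable M"
    unfolding eq using t01 by (auto intro!: borel_measurable_sum borel_measurable_times borel_measurable_diff)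
  have "char (distr M borel (\<lambda>\<omega>. real_step s (\<lambda>t. W t \<omega>))) u =
    (\<Prod>i<m. char (distr M borel (\<lambda>\<omega>. d i * (W (t (Suc i)) \<omega> - W (t i) \<omega>))) u)"
    unfolding eq by (rule char_distr_sum[OF ind'])
  also have "\<dots> = (\<Prod>i<m. of_real (exp (- (u\<^sup>2 * ((d i)\<^sup>2 * (t (Suc i) - t i)) / 2))))"
    
  proof (intro prod.cong refl)
    fix i assume "i \<in> {..<m}"
    thus "char (distr M borel (\<lambda>\<omega>. d i * (W (t (Suc i)) \<omega> - W (t i) \<omega>))) u =
      of_real (exp (- (u\<^sup>2 * ((d i)\<^sup>2 * (t (Suc i) - t i)) / 2)))"
      using char_normal_scaled[OF dist, of i "d i" u] t(3)[of i] by simp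
  qed
  also have "\<dots> = of_real (exp (\<Sum>i<m. - (u\<^sup>2 * ((d i)\<^sup>2 * (t (Suc i) - t i)) / 2)))"
    by (simp add: exp_sum flip: of_real_prod)
  also have "(\<Sum>i<m. - (u\<^sup>2 * ((d i)\<^sup>2 * (t (Suc i) - t i)) / 2)) = - (u\<^sup>2 * (\<Sum>i<m. (d i)\<^sup>2 * (t (Suc i) - t i)) / 2)"
    by (simp only: sum_negf sum_distrib_left sum_divide_distrib)
  finally show "char (distr M borel (\<lambda>\<omega>. real_step s (\<lambda>t. W t \<omega>))) u =
      of_real (exp (- (u\<^sup>2 * (LBINT x:{0..1}. (real_step_fun s x)\<^sup>2) / 2)))"
    by (simp add: int(2))
qed

section \<open>Mean-square limits\<close>

lemma L2_sum_tendsto_0: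
  fixes f :: "nat \<Rightarrow> 'i \<Rightarrow> 'x \<Rightarrow> complex"
  assumes fin: "finite A" and meas: "\<And>m i. i \<in> A \<Longrightarrow> f m i \<in> borel_measurable N"
    and lim: "\<And>i. i \<in> A \<Longrightarrow> (\<lambda>m. \<integral>\<^sup>+ x. ennreal ((cmod (f m i x))\<^sup>2) \<partial>N) \<longlonglongrightarrow> 0"
  shows "(\<lambda>m. \<integral>\<^sup>+ x. ennreal ((\<Sum>i\<in>A. Re (a i * f m i x))\<^sup>2) \<partial>N) \<longlonglongrightarrow> 0"
proof -
  have le: "(\<Sum>i\<in>A. Re (a i * f m i x))\<^sup>2 \<le> (\<Sum>i\<in>A. real (card A) * (cmod (a i))\<^sup>2 * (cmod (f m i x))\<^sup>2)" for m x
  proof -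
    have "(\<Sum>i\<in>A. Re (a i * f m i x))\<^sup>2 \<le> (\<Sum>i\<in>A. (Re (a i * f m i x))\<^sup>2) * real (card A)"
      by (rule sum_squared_le_sum_of_squares)
    also have "\<dots> \<le> (\<Sum>i\<in>A. (cmod (a i * f m i x))\<^sup>2) * real (card A)"
      by (intro mult_right_mono sum_mono) (auto simp: cmod_def)
    finally show ?thesis by (simp add: norm_mult power_mult_distrib sum_distrib_left mult_ac)
  qed
  have "(\<integral>\<^sup>+ x. ennreal ((\<Sum>i\<in>A. Re (a i * f m i x))\<^sup>2) \<partial>N)
    \<le> (\<Sum>i\<in>A. ennreal (real (card A) * (cmod (a i))\<^sup>2) * (\<integral>\<^sup>+ x. ennreal ((cmod (f m i x))\<^sup>2) \<partial>N))" for m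
  proof -
    have "(\<integral>\<^sup>+ x. ennreal ((\<Sum>i\<in>A. Re (a i * f m i x))\<^sup>2) \<partial>N) \<le>
      (\<integral>\<^sup>+ x. (\<Sum>i\<in>A. ennreal (real (card A) * (cmod (a i))\<^sup>2) * ennreal ((cmod (f m i x))\<^sup>2)) \<partial>N)"
      by (intro nn_integral_mono) (use le in \<open>auto simp flip: ennreal_mult simp: ennreal_leI\<close>)
    also have "\<dots> = (\<Sum>i\<in>A. ennreal (real (card A) * (cmod (a i))\<^sup>2) * (\<integral>\<^sup>+ x. ennreal ((cmod (f m i x))\<^sup>2) \<partial>N))"
      using meas by (subst nn_integral_sum) (auto intro!: sum.cong nn_integral_cmult)
    finally show ?thesis .
  qed
  note bound = this
  have "(\<lambda>m. \<Sum>i\<in>A. ennreal (real (card A) * (cmod (a i))\<^sup>2) * (\<integral>\<^sup>+ x. ennreal ((cmod (f m i x))\<^sup>2) \<partial>N))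
    \<longlonglongrightarrow> (\<Sum>i\<in>A. ennreal (real (card A) * (cmod (a i))\<^sup>2) * 0)"
    by (intro tendsto_sum ennreal_tendsto_cmult lim) auto
  hence "(\<lambda>m. \<Sum>i\<in>A. ennreal (real (card A) * (cmod (a i))\<^sup>2) * (\<integral>\<^sup>+ x. ennreal ((cmod (f m i x))\<^sup>2) \<partial>N)) \<longlonglongrightarrow> 0"
    by simp
  from tendsto_sandwich[OF always_eventually always_eventually tendsto_const this] bound
  show ?thesis by simp
qed

lemma L2_tendsto_0_integral:
  fixes D :: "nat \<Rightarrow> 'x \<Rightarrow> real"
  assumes "\<And>m. D m \<in> borel_measurable N" and lim: "(\<lambda>m. \<integral>\<^sup>+ x. ennreal ((D m x)\<^sup>2) \<partial>N) \<longlonglongrightarrow> 0"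
  shows "eventually (\<lambda>m. integrable N (\<lambda>x. (D m x)\<^sup>2)) sequentially"
    and "(\<lambda>m. \<integral>x. (D m x)\<^sup>2 \<partial>N) \<longlonglongrightarrow> 0"
proof -
  have "eventually (\<lambda>m. (\<integral>\<^sup>+ x. ennreal ((D m x)\<^sup>2) \<partial>N) < 1) sequentially"
    using order_tendstoD(2)[OF lim, of 1] by simp
  thus "eventually (\<lambda>m. integrable N (\<lambda>x. (D m x)\<^sup>2)) sequentially"
  proof eventually_elim
    case (elim m)
    have "(\<integral>\<^sup>+ x. ennreal ((D m x)\<^sup>2) \<partial>N) < \<infinity>" using elim ennreal_one_less_top by (metis infinity_ennreal_def order.strict_trans)
    thus ?case using assms(1) by (intro integrableI_nonneg) auto
  qed
  have "(\<lambda>m. enn2real (\<integral>\<^sup>+ x. ennreal ((D m x)\<^sup>2) \<partial>N)) \<longlonglongrightarrow> enn2real 0"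
    using lim by (intro tendsto_enn2real) auto
  thus "(\<lambda>m. \<integral>x. (D m x)\<^sup>2 \<partial>N) \<longlonglongrightarrow> 0"
    using assms(1) by (simp add: integral_eq_nn_integral)
qed

text \<open>Rests on the pointwise bound |h^2 - g^2| <= (1 + 1/d) (h - g)^2 + d g^2, valid for every
  d > 0, in place of the triangle inequality for the norm.\<close>

lemma L2_norm_tendsto:
  fixes h :: "nat \<Rightarrow> 'x \<Rightarrow> real"
  assumes meas: "\<And>m. h m \<in> borel_measurable N" "g \<in> borel_measurable N"
    and int: "\<And>m. integrable N (\<lambda>x. (h m x)\<^sup>2)" "integrable N (\<lambda>x. (g x)\<^sup>2)"
    and lim: "(\<lambda>m. \<integral>\<^sup>+ x. ennreal ((h m x - g x)\<^sup>2) \<partial>N) \<longlonglongrightarrow> 0"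
  shows "(\<lambda>m. \<integral>x. (h m x)\<^sup>2 \<partial>N) \<longlonglongrightarrow> (\<integral>x. (g x)\<^sup>2 \<partial>N)"
proof -
  define D where "D m = (\<integral>x. (h m x - g x)\<^sup>2 \<partial>N)" for m
  define S where "S = (\<integral>x. (g x)\<^sup>2 \<partial>N)"
  have S: "S \<ge> 0" by (simp add: S_def)
  have ev: "eventually (\<lambda>m. integrable N (\<lambda>x. (h m x - g x)\<^sup>2)) sequentially" and D: "D \<longlonglongrightarrow> 0"
    using L2_tendsto_0_integral[of "\<lambda>m x. h m x - g x" N] meas lim unfolding D_def[abs_def] by auto
  show ?thesis
  proof (rule tendstoI)
    fix e :: real assume "e > 0"
    \<comment> \<open>Using \<open>S + 1\<close> instead of \<open>S\<close> covers
      \<open>S = 0\<close>; the two error terms then receive \<open>e / 2\<close> each.\<close>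
    define \<delta> where "\<delta> = e / (2 * (S + 1))"
    have \<delta>: "\<delta> > 0" "\<delta> * S \<le> e / 2" using \<open>e > 0\<close> S by (auto simp: \<delta>_def field_simps)
    have ev2: "eventually (\<lambda>m. D m < e / (2 * (1 + 1 / \<delta>))) sequentially"
      using order_tendstoD(2)[OF D] \<delta>(1) \<open>e > 0\<close> by (simp add: add_pos_pos)
    show "eventually (\<lambda>m. dist (\<integral>x. (h m x)\<^sup>2 \<partial>N) (\<integral>x. (g x)\<^sup>2 \<partial>N) < e) sequentially"
      using ev ev2
    proof eventually_elim
      case (elim m)
      have pt: "\<bar>(h m x)\<^sup>2 - (g x)\<^sup>2\<bar> \<le> (1 + 1 / \<delta>) * (h m x - g x)\<^sup>2 + \<delta> * (g x)\<^sup>2" for x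
      proof -
        have am: "2 * (\<bar>p\<bar> * \<bar>q\<bar>) \<le> (1 / \<delta>) * p\<^sup>2 + \<delta> * q\<^sup>2" for p q :: real
        proof -
          have "0 \<le> (\<bar>p\<bar> - \<delta> * \<bar>q\<bar>)\<^sup>2 / \<delta>" using \<delta> by simp
          also have "\<dots> = (1 / \<delta>) * p\<^sup>2 + \<delta> * q\<^sup>2 - 2 * (\<bar>p\<bar> * \<bar>q\<bar>)"
            using \<delta> by (simp add: power2_diff field_simps power2_eq_square)
          finally show ?thesis by simp
        qed
        have "(h m x)\<^sup>2 - (g x)\<^sup>2 = (h m x - g x)\<^sup>2 + 2 * ((h m x - g x) * g x)"
          by (simp add: power2_eq_square algebra_simps)
        also have "\<bar>\<dots>\<bar> \<le> (h m x - g x)\<^sup>2 + 2 * (\<bar>h m x - g x\<bar> * \<bar>g x\<bar>)"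
          by (simp add: abs_mult[symmetric] order_trans[OF abs_triangle_ineq])
        also have "\<dots> \<le> (h m x - g x)\<^sup>2 + ((1 / \<delta>) * (h m x - g x)\<^sup>2 + \<delta> * (g x)\<^sup>2)"
          using am by (intro add_left_mono)
        finally show ?thesis by (simp add: distrib_right)
      qed
      have "\<bar>(\<integral>x. (h m x)\<^sup>2 \<partial>N) - (\<integral>x. (g x)\<^sup>2 \<partial>N)\<bar> = \<bar>\<integral>x. (h m x)\<^sup>2 - (g x)\<^sup>2 \<partial>N\<bar>"
        using int by simp
      also have "\<dots> \<le> (\<integral>x. \<bar>(h m x)\<^sup>2 - (g x)\<^sup>2\<bar> \<partial>N)" by (rule integral_abs_bound)
      also have "\<dots> \<le> (\<integral>x. (1 + 1 / \<delta>) * (h m x - g x)\<^sup>2 + \<delta> * (g x)\<^sup>2 \<partial>N)"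
        using int elim(1) pt by (intro integral_mono) auto
      also have "\<dots> = (1 + 1 / \<delta>) * D m + \<delta> * S"
        using int elim(1) by (simp add: D_def S_def)
      also have "\<dots> < (1 + 1 / \<delta>) * (e / (2 * (1 + 1 / \<delta>))) + e / 2"
        using elim(2) \<delta> by (intro add_less_le_mono mult_strict_left_mono) (auto simp: add_pos_pos)
      also have "\<dots> = e"
      proof -
        have "q * (e / (2 * q)) + e / 2 = e" if "q > 0" for q :: real using that by simp
        moreover have "1 + 1 / \<delta> > 0" using \<delta> by (simp add: add_pos_pos)
        ultimately show ?thesis by blast
      qed
      finally show ?case by (simp add: dist_real_def)
    qed
  qed
qed

text \<open>A pointwise substitute for Cauchy-Schwarz. Since \<open>\<delta>\<close> may be chosen
  after the second moment, a small second moment makes the first absolute moment small.\<close>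

lemma (in prob_space) expectation_abs_le:
  assumes "X \<in> borel_measurable M" "integrable M (\<lambda>\<omega>. (X \<omega> :: real)\<^sup>2)" "\<delta> > 0"
  shows "integrable M X" "expectation (\<lambda>\<omega>. \<bar>X \<omega>\<bar>) \<le> \<delta> + expectation (\<lambda>\<omega>. (X \<omega>)\<^sup>2) / \<delta>"
proof -
  show int: "integrable M X" using assms(1,2) by (rule square_integrable_imp_integrable)
  have "\<bar>X \<omega>\<bar> \<le> \<delta> + (X \<omega>)\<^sup>2 / \<delta>" for \<omega>
  proof -
    have "0 \<le> (\<bar>X \<omega>\<bar> - \<delta>)\<^sup>2 + \<delta> * \<bar>X \<omega>\<bar>" using assms(3) by simp
    also have "\<dots> = \<delta> * \<delta> + (X \<omega>)\<^sup>2 - \<delta> * \<bar>X \<omega>\<bar>"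
      by (simp add: power2_diff) (simp add: power2_eq_square)
    finally have "\<delta> * \<bar>X \<omega>\<bar> \<le> \<delta> * \<delta> + (X \<omega>)\<^sup>2" by simp
    thus ?thesis using assms(3) by (simp add: field_simps power2_eq_square)
  qed
  hence "expectation (\<lambda>\<omega>. \<bar>X \<omega>\<bar>) \<le> expectation (\<lambda>\<omega>. \<delta> + (X \<omega>)\<^sup>2 / \<delta>)"
    using int assms(2) by (intro integral_mono) auto
  also have "\<dots> = \<delta> + expectation (\<lambda>\<omega>. (X \<omega>)\<^sup>2) / \<delta>"
    using assms(2) by (simp add: prob_space)
  finally show "expectation (\<lambda>\<omega>. \<bar>X \<omega>\<bar>) \<le> \<delta> + expectation (\<lambda>\<omega>. (X \<omega>)\<^sup>2) / \<delta>" .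
qed

lemma (in prob_space) L2_imp_L1_tendsto_0:
  fixes D :: "nat \<Rightarrow> 'a \<Rightarrow> real"
  assumes meas: "\<And>m. D m \<in> borel_measurable M" and lim: "(\<lambda>m. \<integral>\<^sup>+ x. ennreal ((D m x)\<^sup>2) \<partial>M) \<longlonglongrightarrow> 0"
  shows "eventually (\<lambda>m. integrable M (D m)) sequentially"
    and "(\<lambda>m. expectation (\<lambda>\<omega>. \<bar>D m \<omega>\<bar>)) \<longlonglongrightarrow> 0"
proof -
  note L = L2_tendsto_0_integral[OF meas lim]
  show ev: "eventually (\<lambda>m. integrable M (D m)) sequentially"
    using L(1)
  proof eventually_elim
    case (elim m)
    show ?case using expectation_abs_le(1)[OF meas elim, of 1] by simp
  qed
  show "(\<lambda>m. expectation (\<lambda>\<omega>. \<bar>D m \<omega>\<bar>)) \<longlonglongrightarrow> 0"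
  proof (rule tendstoI)
    fix e :: real assume e: "e > 0"
    have "eventually (\<lambda>m. expectation (\<lambda>\<omega>. (D m \<omega>)\<^sup>2) < (e / 2) * (e / 2)) sequentially"
      using order_tendstoD(2)[OF L(2), of "(e / 2) * (e / 2)"] e by auto
    with L(1) show "eventually (\<lambda>m. dist (expectation (\<lambda>\<omega>. \<bar>D m \<omega>\<bar>)) 0 < e) sequentially"
    proof eventually_elim
      case (elim m)
      have "expectation (\<lambda>\<omega>. \<bar>D m \<omega>\<bar>) \<le> e / 2 + expectation (\<lambda>\<omega>. (D m \<omega>)\<^sup>2) / (e / 2)"
        using expectation_abs_le(2)[OF meas elim(1), of "e / 2"] e by simp
      also have "expectation (\<lambda>\<omega>. (D m \<omega>)\<^sup>2) / (e / 2) < e / 2"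
        using elim(2) e by (simp add: divide_less_eq)
      finally show ?case by (simp add: dist_real_def abs_of_nonneg)
    qed
  qed
qed

text \<open>The function \<open>iexp\<close> is 1-Lipschitz on the reals, so two characteristic
  functions at \<open>u\<close> differ by at most \<open>\<bar>u\<bar>\<close> times the L1 distance
  of the variables, and mean-square convergence controls the latter.\<close>

lemma (in prob_space) char_L2_limit:
  fixes X :: "'a \<Rightarrow> real"
  assumes meas: "\<And>m. S m \<in> borel_measurable M" "X \<in> borel_measurable M"
    and lim: "(\<lambda>m. \<integral>\<^sup>+ x. ennreal ((S m x - X x)\<^sup>2) \<partial>M) \<longlonglongrightarrow> 0"
  shows "(\<lambda>m. char (distr M borel (S m)) u) \<longlonglongrightarrow> char (distr M borel X) u"
proof -
  have L: "eventually (\<lambda>m. integrable M (\<lambda>\<omega>. S m \<omega> - X \<omega>)) sequentially"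
      "(\<lambda>m. expectation (\<lambda>\<omega>. \<bar>S m \<omega> - X \<omega>\<bar>)) \<longlonglongrightarrow> 0"
    using L2_imp_L1_tendsto_0[of "\<lambda>m \<omega>. S m \<omega> - X \<omega>"] meas lim by auto
  have ie: "integrable M (\<lambda>\<omega>. iexp (u * Y \<omega>))" if "Y \<in> borel_measurable M" for Y :: "'a \<Rightarrow> real"
    by (rule integrable_const_bound[where B = 1]) (use that in auto)
  have lip: "cmod (iexp x - iexp y) \<le> \<bar>x - y\<bar>" for x y :: real
  proof -
    have "iexp x - iexp y = iexp y * (iexp (x - y) - 1)"
      by (simp add: right_diff_distrib flip: exp_add)
    also have "cmod \<dots> = cmod (iexp (x - y) - 1)" by (simp add: norm_mult)
    also have "\<dots> \<le> \<bar>x - y\<bar>" using iexp_approx1[of "x - y" 0] by simp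
    finally show ?thesis .
  qed
  have "eventually (\<lambda>m. cmod (char (distr M borel (S m)) u - char (distr M borel X) u) \<le>
    \<bar>u\<bar> * expectation (\<lambda>\<omega>. \<bar>S m \<omega> - X \<omega>\<bar>)) sequentially"
    using L(1)
  proof eventually_elim
    case (elim m)
    have "char (distr M borel (S m)) u - char (distr M borel X) u =
      expectation (\<lambda>\<omega>. iexp (u * S m \<omega>) - iexp (u * X \<omega>))"
      using meas by (simp add: char_def integral_distr ie del: of_real_mult)
    also have "cmod \<dots> \<le> expectation (\<lambda>\<omega>. cmod (iexp (u * S m \<omega>) - iexp (u * X \<omega>)))"
      by (rule integral_norm_bound)
    also have "\<dots> \<le> expectation (\<lambda>\<omega>. \<bar>u\<bar> * \<bar>S m \<omega> - X \<omega>\<bar>)"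
    proof (rule integral_mono)
      show "cmod (iexp (u * S m \<omega>) - iexp (u * X \<omega>)) \<le> \<bar>u\<bar> * \<bar>S m \<omega> - X \<omega>\<bar>" for \<omega>
        using lip[of "u * S m \<omega>" "u * X \<omega>"] by (simp only: abs_mult[symmetric] right_diff_distrib)
    qed (use elim ie meas in auto)
    finally show ?case by simp
  qed
  moreover have "(\<lambda>m. \<bar>u\<bar> * expectation (\<lambda>\<omega>. \<bar>S m \<omega> - X \<omega>\<bar>)) \<longlonglongrightarrow> 0"
    using tendsto_mult_right_zero[OF L(2)] .
  ultimately have "(\<lambda>m. char (distr M borel (S m)) u - char (distr M borel X) u) \<longlonglongrightarrow> 0"
    by (rule Lim_null_comparison)
  thus ?thesis by (simp add: LIM_zero_iff)
qed

section \<open>Real linear forms in several complex Wiener integrals\<close>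

definition comb_steps :: "(complex \<times> steps) list \<Rightarrow> (real \<times> real \<times> real) list" where
  "comb_steps l = concat (map (\<lambda>(a, s). map (\<lambda>(c, x, y). (Re (a * c), x, y)) s) l)"

lemma steps_in01_comb:
  assumes "\<And>a s. (a, s) \<in> set l \<Longrightarrow> steps01 s"
  shows "steps_in01 (comb_steps l)"
proof -
  have "0 \<le> x \<and> x \<le> y \<and> y \<le> 1" if "(a, s) \<in> set l" "(c, x, y) \<in> set s" for a s c x y
    using assms[OF that(1)] that(2) unfolding steps01_def by blast
  thus ?thesis unfolding steps_in01_def comb_steps_def by auto
qed

lemma real_step_append: "real_step (s @ s') F = real_step s F + real_step s' F"
  by (simp add: real_step_def)

text \<open>The real part of a complex combination of step integrals is one real step integral over
  the concatenated lists. The joint law of several complex Wiener integrals thereby reduces to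
  scalar step functions.\<close>

lemma real_step_comb:
  "real_step (comb_steps l) F = (\<Sum>(a, s)\<leftarrow>l. Re (a * step_integral s F))"
proof (induction l)
  case (Cons p l)
  obtain a s where p: "p = (a, s)" by (cases p)
  have "real_step (map (\<lambda>(c, x, y). (Re (a * c), x, y)) s) F = Re (a * step_integral s F)"
    by (induction s) (auto simp: real_step_def step_integral_def algebra_simps)
  with Cons show ?case by (simp add: comb_steps_def p real_step_append)
qed (simp add: real_step_def comb_steps_def)

lemma real_step_fun_comb:
  assumes "\<And>a s. (a, s) \<in> set l \<Longrightarrow> steps01 s"
  shows "real_step_fun (comb_steps l) x = (\<Sum>(a, s)\<leftarrow>l. Re (a * step_fun s x))"
proof -
  have "step_integral s (\<lambda>y. if x \<le> y then 1 else 0) = step_fun s x" if "steps01 s" for s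
    using that unfolding step_integral_def step_fun_def steps01_def
    by (intro arg_cong[where f = sum_list] map_cong) (auto simp: indicator_def)
  thus ?thesis using assms unfolding real_step_fun_def real_step_comb
    by (intro arg_cong[where f = sum_list] map_cong) auto
qed

lemma real_step_path_measurable:
  assumes "steps_in01 s"
  shows "(\<lambda>p. real_step s p) \<in> borel_measurable (Pi\<^sub>M {0..1} (\<lambda>_. borel))"
  using assms
proof (induction s)
  case (Cons x s)
  obtain c a b where x: "x = (c, a, b)" by (metis prod_cases3)
  have ab: "a \<in> {0..1}" "b \<in> {0..1}" and s: "steps_in01 s" using Cons.prems by (auto simp: steps_in01_def x)
  have "(\<lambda>p. c * (p b - p a)) \<in> borel_measurable (Pi\<^sub>M {0..1::real} (\<lambda>_. borel :: real measure))"
    using ab by (intro borel_measurable_times borel_measurable_diff measurable_component_singleton) auto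
  with Cons.IH[OF s] show ?case by (simp add: real_step_def x)
qed (simp add: real_step_def[abs_def])

text \<open>The model states independence of the curves for paths restricted to the unit interval; a
  step integral sees no other times.\<close>

lemma real_step_restrict:
  assumes "steps_in01 s"
  shows "real_step s (\<lambda>t\<in>{0..1}. F t) = real_step s F"
  unfolding real_step_def
  by (intro arg_cong[where f = sum_list] map_cong) (use assms in \<open>auto simp: steps_in01_def\<close>)

lemma step_integral_measurable:
  assumes "steps01 s" "\<And>t. t \<in> {0..1} \<Longrightarrow> W t \<in> borel_measurable M"
  shows "(\<lambda>\<omega>. step_integral s (\<lambda>t. W t \<omega>)) \<in> borel_measurable M"
  using assms(1)
proof (induction s)
  case (Cons x s)
  obtain c a b where x: "x = (c, a, b)" by (metis prod_cases3)
  have ab: "a \<in> {0..1}" "b \<in> {0..1}" and s: "steps01 s" using Cons.prems by (auto simp: steps01_def x)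
  note [measurable] = assms(2)[OF ab(1)] assms(2)[OF ab(2)]
  have "(\<lambda>\<omega>. c * complex_of_real (W b \<omega> - W a \<omega>)) \<in> borel_measurable M" by measurable
  with Cons.IH[OF s] show ?case by (simp add: step_integral_def x)
qed (simp add: step_integral_def)

lemma step_fun_measurable: "step_fun s \<in> borel_measurable borel"
proof (induction s)
  case Nil
  have "step_fun [] = (\<lambda>x. 0)" by (rule ext) (simp add: step_fun_def)
  then show ?case by simp
next
  case (Cons x s)
  obtain c a b where x: "x = (c, a, b)" by (metis prod_cases3)
  have "step_fun (x # s) = (\<lambda>y. c * indicator {a<..b} y + step_fun s y)"
    by (rule ext) (simp add: step_fun_def x)
  moreover have "(\<lambda>y. c * indicator {a<..b} y + step_fun s y) \<in> borel_measurable borel"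
    using Cons.IH by (intro borel_measurable_add borel_measurable_times borel_measurable_indicator) auto
  ultimately show ?case by simp
qed

text \<open>By the Cramer-Wold principle such linear forms determine the joint law. Each integral is
  replaced by step integrals; for these the curves factorise and the variances add, and then the
  mean-square limit is taken on both sides. The coefficients \<open>a k\<close> are the same for all
  curves, hence the factor \<open>card J\<close>.\<close>

lemma char_wiener_lincomb:
  fixes \<phi> :: "'k \<Rightarrow> real \<Rightarrow> complex" and a :: "'k \<Rightarrow> complex"
  assumes M: "prob_space M" and fin: "finite J" "finite K"
    and W: "\<And>j. j \<in> J \<Longrightarrow> brownian_motion01 M (W j)"
    and ind: "prob_space.indep_vars M (\<lambda>_. Pi\<^sub>M {0..1} (\<lambda>_. borel)) (\<lambda>j \<omega>. \<lambda>t\<in>{0..1}. W j t \<omega>) J"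
    and I: "\<And>j k. j \<in> J \<Longrightarrow> k \<in> K \<Longrightarrow> has_wiener_integral M (W j) (\<phi> k) (I j k)"
    and \<phi>: "\<And>k. k \<in> K \<Longrightarrow> \<phi> k \<in> borel_measurable borel" "\<And>k x. k \<in> K \<Longrightarrow> cmod (\<phi> k x) \<le> 1"
  defines "v \<equiv> (LBINT x:{0..1}. (\<Sum>k\<in>K. Re (a k * \<phi> k x))\<^sup>2)"
  shows "char (distr M borel (\<lambda>\<omega>. \<Sum>j\<in>J. \<Sum>k\<in>K. Re (a k * I j k \<omega>))) u =
    of_real (exp (- (u\<^sup>2 * (real (card J) * v) / 2)))"
proof -
  interpret prob_space M by fact
  \<comment> \<open>The predicate packs measurability with one approximating sequence, so that a
    single use of \<open>SOME\<close> fixes a sequence for each pair \<open>j\<close>,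
    \<open>k\<close>.\<close>
  define P where "P j k s \<longleftrightarrow> I j k \<in> borel_measurable M \<and> (\<forall>m. steps01 (s m)) \<and>
        (\<lambda>m. \<integral>\<^sup>+ x\<in>{0..1}. ennreal ((cmod (step_fun (s m) x - \<phi> k x))\<^sup>2) \<partial>lborel) \<longlonglongrightarrow> 0 \<and>
        (\<lambda>m. \<integral>\<^sup>+ \<omega>. ennreal ((cmod (step_integral (s m) (\<lambda>t. W j t \<omega>) - I j k \<omega>))\<^sup>2) \<partial>M) \<longlonglongrightarrow> 0" for j k s
  define s where "s j k = (SOME s. P j k s)" for j k
  have "P j k (s j k)" if "j \<in> J" "k \<in> K" for j k
  proof -
    have "\<exists>s. P j k s"
      using I[OF that] unfolding has_wiener_integral_def P_def
      by (elim conjE exE) (intro exI conjI, assumption+)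
    thus ?thesis unfolding s_def by (rule someI_ex)
  qed
  note s = this[unfolded P_def]
  have s01: "steps01 (s j k m)" if "j \<in> J" "k \<in> K" for j k m using s[OF that] by blast
  have I_meas: "I j k \<in> borel_measurable M" if "j \<in> J" "k \<in> K" for j k using s[OF that] by blast
  have W_meas: "W j t \<in> borel_measurable M" if "j \<in> J" "t \<in> {0..1}" for j t
    using W[OF that(1)] that(2) unfolding brownian_motion01_def by blast
  obtain ks where ks: "set ks = K" "distinct ks" using finite_distinct_list[OF fin(2)] by blast
  define r where "r j m = comb_steps (map (\<lambda>k. (a k, s j k m)) ks)" for j m
  have r01: "steps_in01 (r j m)" if "j \<in> J" for j m
    unfolding r_def using s01[OF that] ks by (intro steps_in01_comb) auto
  have r_int: "real_step (r j m) F = (\<Sum>k\<in>K. Re (a k * step_integral (s j k m) F))" for j m F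
    unfolding r_def real_step_comb using ks by (simp add: o_def sum_list_distinct_conv_sum_set)
  have r_fun: "real_step_fun (r j m) x = (\<Sum>k\<in>K. Re (a k * step_fun (s j k m) x))" if "j \<in> J" for j m x
    unfolding r_def using s01[OF that] ks
    by (subst real_step_fun_comb) (auto simp: o_def sum_list_distinct_conv_sum_set)
  interpret unit: prob_space unit_lborel by (rule prob_space_unit_lborel)
  define v' where "v' j m = (LBINT x:{0..1}. (real_step_fun (r j m) x)\<^sup>2)" for j m
  have v'_lim: "(\<lambda>m. v' j m) \<longlonglongrightarrow> v" if j: "j \<in> J" for j
    unfolding v'_def v_def set_integral_unit_lborel
  proof (rule L2_norm_tendsto)
    fix m
    show "real_step_fun (r j m) \<in> borel_measurable unit_lborel"
      unfolding r_fun[OF j, abs_def] using step_fun_measurable by (intro measurable_unit_lborel) measurable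
    show "integrable unit_lborel (\<lambda>x. (real_step_fun (r j m) x)\<^sup>2)"
      using char_real_step(2)[OF M W[OF j] r01[OF j, of m]] unfolding set_integrable_unit_lborel .
  next
    show m: "(\<lambda>x. \<Sum>k\<in>K. Re (a k * \<phi> k x)) \<in> borel_measurable unit_lborel"
    proof (rule measurable_unit_lborel)
      note [measurable] = \<phi>(1)
      show "(\<lambda>x. \<Sum>k\<in>K. Re (a k * \<phi> k x)) \<in> borel_measurable borel" by measurable
    qed
    have "\<bar>\<Sum>k\<in>K. Re (a k * \<phi> k x)\<bar> \<le> (\<Sum>k\<in>K. cmod (a k))" for x
    proof -
      have "\<bar>Re (a k * \<phi> k x)\<bar> \<le> cmod (a k)" if "k \<in> K" for k
      proof -
        have "\<bar>Re (a k * \<phi> k x)\<bar> \<le> cmod (a k) * cmod (\<phi> k x)"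
          using abs_Re_le_cmod[of "a k * \<phi> k x"] by (simp add: norm_mult)
        also have "\<dots> \<le> cmod (a k)" using \<phi>(2)[OF that, of x] by (simp add: mult_left_le)
        finally show ?thesis .
      qed
      thus ?thesis by (intro order_trans[OF sum_abs] sum_mono)
    qed
    hence "norm ((\<Sum>k\<in>K. Re (a k * \<phi> k x))\<^sup>2) \<le> (\<Sum>k\<in>K. cmod (a k))\<^sup>2" for x
      by (simp add: abs_le_square_iff[symmetric] sum_nonneg)
    thus "integrable unit_lborel (\<lambda>x. (\<Sum>k\<in>K. Re (a k * \<phi> k x))\<^sup>2)"
      using m by (intro unit.integrable_const_bound) auto
    have "(\<lambda>m. \<integral>\<^sup>+ x. ennreal ((\<Sum>k\<in>K. Re (a k * (step_fun (s j k m) x - \<phi> k x)))\<^sup>2) \<partial>unit_lborel) \<longlonglongrightarrow> 0"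
    proof (rule L2_sum_tendsto_0[OF fin(2)])
      fix m k assume k: "k \<in> K"
      show "(\<lambda>x. step_fun (s j k m) x - \<phi> k x) \<in> borel_measurable unit_lborel"
        using \<phi>(1)[OF k] by (intro measurable_unit_lborel borel_measurable_diff step_fun_measurable)
      show "(\<lambda>m. \<integral>\<^sup>+ x. ennreal ((cmod (step_fun (s j k m) x - \<phi> k x))\<^sup>2) \<partial>unit_lborel) \<longlonglongrightarrow> 0"
        using s[OF j k] unfolding unit_lborel_def by (subst nn_integral_restrict_space) auto
    qed
    also have "(\<lambda>m. \<integral>\<^sup>+ x. ennreal ((\<Sum>k\<in>K. Re (a k * (step_fun (s j k m) x - \<phi> k x)))\<^sup>2) \<partial>unit_lborel) =
       (\<lambda>m. \<integral>\<^sup>+ x. ennreal ((real_step_fun (r j m) x - (\<Sum>k\<in>K. Re (a k * \<phi> k x)))\<^sup>2) \<partial>unit_lborel)"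
      by (simp only: r_fun[OF j] sum_subtractf[symmetric] right_diff_distrib minus_complex.simps)
    finally show "(\<lambda>m. \<integral>\<^sup>+ x. ennreal ((real_step_fun (r j m) x - (\<Sum>k\<in>K. Re (a k * \<phi> k x)))\<^sup>2) \<partial>unit_lborel) \<longlonglongrightarrow> 0" .
  qed
  define S where "S m \<omega> = (\<Sum>j\<in>J. real_step (r j m) (\<lambda>t. W j t \<omega>))" for m \<omega>
  have charS: "char (distr M borel (S m)) u = of_real (exp (- (u\<^sup>2 * (\<Sum>j\<in>J. v' j m) / 2)))" for m
  proof -
    have "indep_vars (\<lambda>_. borel) (\<lambda>j \<omega>. real_step (r j m) (\<lambda>t\<in>{0..1}. W j t \<omega>)) J"
      by (rule indep_vars_compose2[OF ind]) (intro real_step_path_measurable r01)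
    hence "indep_vars (\<lambda>_. borel) (\<lambda>j \<omega>. real_step (r j m) (\<lambda>t. W j t \<omega>)) J"
      by (rule indep_vars_cong[THEN iffD1, rotated -1]) (auto simp: real_step_restrict r01)
    hence "char (distr M borel (S m)) u = (\<Prod>j\<in>J. char (distr M borel (\<lambda>\<omega>. real_step (r j m) (\<lambda>t. W j t \<omega>))) u)"
      unfolding S_def[abs_def] by (rule char_distr_sum)
    also have "\<dots> = (\<Prod>j\<in>J. of_real (exp (- (u\<^sup>2 * v' j m / 2))))"
      unfolding v'_def by (intro prod.cong refl char_real_step(3) M W r01)
    also have "\<dots> = of_real (exp (\<Sum>j\<in>J. - (u\<^sup>2 * v' j m / 2)))"
      by (simp add: exp_sum fin flip: of_real_prod)
    also have "(\<Sum>j\<in>J. - (u\<^sup>2 * v' j m / 2)) = - (u\<^sup>2 * (\<Sum>j\<in>J. v' j m) / 2)"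
      by (simp only: sum_negf sum_distrib_left sum_divide_distrib)
    finally show ?thesis .
  qed
  have "(\<lambda>m. char (distr M borel (S m)) u) \<longlonglongrightarrow> char (distr M borel (\<lambda>\<omega>. \<Sum>j\<in>J. \<Sum>k\<in>K. Re (a k * I j k \<omega>))) u"
  proof (rule char_L2_limit)
    show "S m \<in> borel_measurable M" for m
      unfolding S_def[abs_def] by (intro borel_measurable_sum char_real_step(1) M W r01)
    show "(\<lambda>\<omega>. \<Sum>j\<in>J. \<Sum>k\<in>K. Re (a k * I j k \<omega>)) \<in> borel_measurable M"
      by (intro borel_measurable_sum measurable_compose[OF _ borel_measurable_Re] borel_measurable_times borel_measurable_const I_meas)
    have "(\<lambda>m. \<integral>\<^sup>+ \<omega>. ennreal ((\<Sum>p\<in>J \<times> K. Re (a (snd p) *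
      (step_integral (s (fst p) (snd p) m) (\<lambda>t. W (fst p) t \<omega>) - I (fst p) (snd p) \<omega>)))\<^sup>2) \<partial>M) \<longlonglongrightarrow> 0"
    proof (rule L2_sum_tendsto_0)
      fix m p assume p: "p \<in> J \<times> K"
      show "(\<lambda>\<omega>. step_integral (s (fst p) (snd p) m) (\<lambda>t. W (fst p) t \<omega>) - I (fst p) (snd p) \<omega>) \<in> borel_measurable M"
        using p by (intro borel_measurable_diff step_integral_measurable s01 W_meas I_meas) auto
      show "(\<lambda>m. \<integral>\<^sup>+ \<omega>. ennreal ((cmod (step_integral (s (fst p) (snd p) m) (\<lambda>t. W (fst p) t \<omega>) - I (fst p) (snd p) \<omega>))\<^sup>2) \<partial>M) \<longlonglongrightarrow> 0"
        using s[of "fst p" "snd p"] p by auto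
    qed (use fin in auto)
    also have "(\<lambda>m. \<integral>\<^sup>+ \<omega>. ennreal ((\<Sum>p\<in>J \<times> K. Re (a (snd p) *
        (step_integral (s (fst p) (snd p) m) (\<lambda>t. W (fst p) t \<omega>) - I (fst p) (snd p) \<omega>)))\<^sup>2) \<partial>M) =
      (\<lambda>m. \<integral>\<^sup>+ \<omega>. ennreal ((S m \<omega> - (\<Sum>j\<in>J. \<Sum>k\<in>K. Re (a k * I j k \<omega>)))\<^sup>2) \<partial>M)"
      by (simp only: S_def r_int sum_subtractf[symmetric] right_diff_distrib minus_complex.simps
        sum.cartesian_product split_beta)
    finally show "(\<lambda>m. \<integral>\<^sup>+ \<omega>. ennreal ((S m \<omega> - (\<Sum>j\<in>J. \<Sum>k\<in>K. Re (a k * I j k \<omega>)))\<^sup>2) \<partial>M) \<longlonglongrightarrow> 0" .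
  qed
  moreover have "(\<lambda>m. char (distr M borel (S m)) u) \<longlonglongrightarrow> of_real (exp (- (u\<^sup>2 * (\<Sum>j\<in>J. v) / 2)))"
    unfolding charS by (intro tendsto_intros v'_lim) auto
  ultimately have "char (distr M borel (\<lambda>\<omega>. \<Sum>j\<in>J. \<Sum>k\<in>K. Re (a k * I j k \<omega>))) u =
    of_real (exp (- (u\<^sup>2 * (\<Sum>j\<in>J. v) / 2)))" by (rule LIMSEQ_unique)
  thus ?thesis by simp
qed

section \<open>Gaussian moments recovered from a characteristic function\<close>

lemma std_normal_distribution_nn_integral_exp:
  "(\<integral>\<^sup>+ y. ennreal (exp (c * y)) \<partial>std_normal_distribution) = ennreal (exp (c\<^sup>2 / 2))"
proof -
  have eq: "std_normal_density y * exp (c * y) = exp (c\<^sup>2 / 2) * normal_density c 1 y" for y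
    unfolding normal_density_def by (simp add: field_simps power2_eq_square flip: exp_add)
  have "(\<integral>\<^sup>+ y. ennreal (exp (c * y)) \<partial>std_normal_distribution) =
    (\<integral>\<^sup>+ y. ennreal (exp (c\<^sup>2 / 2) * normal_density c 1 y) \<partial>lborel)"
    by (subst nn_integral_density) (auto simp: eq simp flip: ennreal_mult')
  also have "\<dots> = ennreal (exp (c\<^sup>2 / 2)) * (\<integral>\<^sup>+ y. ennreal (normal_density c 1 y) \<partial>lborel)"
    by (subst nn_integral_cmult[symmetric]) (auto simp: ennreal_mult')
  also have "(\<integral>\<^sup>+ y. ennreal (normal_density c 1 y) \<partial>lborel) = 1"
    using prob_space.emeasure_space_1[OF prob_space_normal_density[of 1 c]]
    by (simp add: emeasure_density)
  finally show ?thesis by simp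
qed

text \<open>By Levy's uniqueness theorem \<open>X\<close> has the law of \<open>sqrt v\<close> times
  a standard normal variable. Scaling, rather than a density with standard deviation
  \<open>sqrt v\<close>, includes \<open>v = 0\<close>; that case later turns a vanishing variance
  into an almost sure identity.\<close>

lemma (in prob_space) gaussian_of_char:
  fixes X :: "'a \<Rightarrow> real"
  assumes meas: "X \<in> borel_measurable M" and v: "v \<ge> 0"
    and char: "\<And>u. char (distr M borel X) u = of_real (exp (- (u\<^sup>2 * v / 2)))"
  shows "(\<integral>\<^sup>+ \<omega>. ennreal (exp (X \<omega>)) \<partial>M) = ennreal (exp (v / 2))"
    and "integrable M (\<lambda>\<omega>. (X \<omega>)\<^sup>2)" and "expectation (\<lambda>\<omega>. (X \<omega>)\<^sup>2) = v"
    and "v = 0 \<Longrightarrow> AE \<omega> in M. X \<omega> = 0"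
proof -
  interpret N: prob_space std_normal_distribution by (rule prob_space_normal_density) simp
  have sc: "(\<lambda>y. sqrt v * y) \<in> borel_measurable std_normal_distribution" by simp
  have eq: "distr M borel X = distr std_normal_distribution borel (\<lambda>y. sqrt v * y)"
  proof (rule Levy_uniqueness)
    show "real_distribution (distr M borel X)" using meas by (rule real_distribution_distr)
    show "real_distribution (distr std_normal_distribution borel (\<lambda>y. sqrt v * y))"
      using sc by (rule N.real_distribution_distr)
    show "char (distr M borel X) = char (distr std_normal_distribution borel (\<lambda>y. sqrt v * y))"
    proof
      fix u
      have "char (distr std_normal_distribution borel (\<lambda>y. sqrt v * y)) u = char std_normal_distribution (u * sqrt v)"
        unfolding char_def by (subst integral_distr) (auto simp: mult.assoc)
      also have "\<dots> = of_real (exp (- (u\<^sup>2 * v / 2)))"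
        using v by (simp add: char_std_normal_distribution power_mult_distrib)
      finally show "char (distr M borel X) u = char (distr std_normal_distribution borel (\<lambda>y. sqrt v * y)) u"
        by (simp only: char)
    qed
  qed
  have "(\<integral>\<^sup>+ \<omega>. ennreal (exp (X \<omega>)) \<partial>M) = (\<integral>\<^sup>+ y. ennreal (exp y) \<partial>distr M borel X)"
    using meas by (subst nn_integral_distr) auto
  also have "\<dots> = (\<integral>\<^sup>+ y. ennreal (exp (sqrt v * y)) \<partial>std_normal_distribution)"
    unfolding eq by (subst nn_integral_distr) auto
  finally show "(\<integral>\<^sup>+ \<omega>. ennreal (exp (X \<omega>)) \<partial>M) = ennreal (exp (v / 2))"
    using v by (simp add: std_normal_distribution_nn_integral_exp)
  have mom: "has_bochner_integral lborel (\<lambda>y. std_normal_density y * y^2) 1"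
    using std_normal_moment_even[of 1] by simp
  have int2: "integrable std_normal_distribution (\<lambda>y. y\<^sup>2)" "(\<integral>y. y\<^sup>2 \<partial>std_normal_distribution) = 1"
    using mom by (auto simp: integrable_density integral_density has_bochner_integral_iff)
  have "integrable (distr M borel X) (\<lambda>y. y\<^sup>2)"
    unfolding eq by (subst integrable_distr_eq) (use int2 v in \<open>auto simp: power_mult_distrib\<close>)
  thus "integrable M (\<lambda>\<omega>. (X \<omega>)\<^sup>2)" using meas by (subst (asm) integrable_distr_eq) auto
  have "expectation (\<lambda>\<omega>. (X \<omega>)\<^sup>2) = (\<integral>y. y\<^sup>2 \<partial>distr M borel X)"
    using meas by (subst integral_distr) auto
  also have "\<dots> = (\<integral>y. (sqrt v * y)\<^sup>2 \<partial>std_normal_distribution)"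
    unfolding eq by (subst integral_distr) auto
  finally show E2: "expectation (\<lambda>\<omega>. (X \<omega>)\<^sup>2) = v" using int2 v by (simp add: power_mult_distrib)
  assume "v = 0"
  thus "AE \<omega> in M. X \<omega> = 0"
    using integral_nonneg_eq_0_iff_AE[of M "\<lambda>\<omega>. (X \<omega>)\<^sup>2"] E2 \<open>integrable M (\<lambda>\<omega>. (X \<omega>)\<^sup>2)\<close> by simp
qed

section \<open>Fourier coefficients of square integrable functions\<close>

lemma fourier_char_cis: "fourier_char k x = cis (- (2 * pi * of_int k * x))"
  unfolding fourier_char_def cis_conv_exp by (simp add: mult_ac)

lemma Re_fourier_char: "Re (fourier_char k x) = cos (2 * pi * of_int k * x)"
  and Im_fourier_char: "Im (fourier_char k x) = - sin (2 * pi * of_int k * x)"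
  by (simp_all add: fourier_char_cis)

lemma norm_fourier_char [simp]: "cmod (fourier_char k x) = 1"
  by (simp add: fourier_char_cis)

lemma fourier_char_0 [simp]: "fourier_char 0 x = 1"
  by (simp add: fourier_char_cis)

lemma fourier_char_uminus: "fourier_char (- k) x = cnj (fourier_char k x)"
  by (simp add: fourier_char_cis cis_cnj)

lemma fourier_char_mult: "fourier_char k x * fourier_char l x = fourier_char (k + l) x"
  by (simp add: fourier_char_cis cis_mult algebra_simps)

lemma fourier_char_add: "fourier_char k (x + y) = fourier_char k x * fourier_char k y"
  by (simp add: fourier_char_cis cis_mult algebra_simps)

lemma fourier_char_of_int: "fourier_char k (of_int m) = 1"
proof -
  have "fourier_char k (of_int m) = cis (2 * pi * of_int (- k * m))"
    by (simp add: fourier_char_cis mult_ac)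
  thus ?thesis by (simp only: cis_multiple_2pi Ints_of_int)
qed

lemma fourier_char_measurable [measurable]: "fourier_char k \<in> borel_measurable borel"
  unfolding fourier_char_def[abs_def]
  by (intro borel_measurable_continuous_onI continuous_intros)

lemma integrable_fourier_char: "integrable unit_lborel (fourier_char k)"
proof -
  interpret prob_space unit_lborel by (rule prob_space_unit_lborel)
  show ?thesis
    by (rule integrable_const_bound[where B = 1]) (auto intro: measurable_unit_lborel)
qed

lemma integral_fourier_char: "(\<integral>x. fourier_char k x \<partial>unit_lborel) = (if k = 0 then 1 else 0)"
proof (cases "k = 0")
  case True
  then show ?thesis
    using prob_space.prob_space[OF prob_space_unit_lborel] by simp
next
  case False
  define c where "c = 2 * pi * of_int k"
  have c: "c \<noteq> 0" using False by (simp add: c_def)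
  have ReIm: "Re (fourier_char k x) = cos (c * x)" "Im (fourier_char k x) = - sin (c * x)" for x
    by (simp_all add: c_def Re_fourier_char Im_fourier_char)
  have per: "sin c = 0" "cos c = 1"
    using sin_int_2pin[of k] cos_int_2pin[of k] by (auto simp: c_def mult_ac)
  have "(\<integral>x. cos (c * x) * indicator {0..1} x \<partial>lborel) = sin (c * 1) / c - sin (c * 0) / c"
    by (rule integral_FTC_Icc_real) (use c in \<open>auto intro!: derivative_eq_intros\<close>)
  hence R: "(\<integral>x. Re (fourier_char k x) \<partial>unit_lborel) = 0"
    using per by (simp add: set_integral_unit_lborel[symmetric] set_lebesgue_integral_def ReIm
      mult.commute[of _ "indicator _ _"])
  have "(\<integral>x. - sin (c * x) * indicator {0..1} x \<partial>lborel) = cos (c * 1) / c - cos (c * 0) / c"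
    by (rule integral_FTC_Icc_real) (use c in \<open>auto intro!: derivative_eq_intros\<close>)
  hence I: "(\<integral>x. Im (fourier_char k x) \<partial>unit_lborel) = 0"
    using per by (simp add: set_integral_unit_lborel[symmetric] set_lebesgue_integral_def ReIm
      mult.commute[of _ "indicator _ _"])
  have "Re (\<integral>x. fourier_char k x \<partial>unit_lborel) = 0" "Im (\<integral>x. fourier_char k x \<partial>unit_lborel) = 0"
    using R I by (simp_all add: integral_Re integral_Im integrable_fourier_char)
  with False show ?thesis by (simp add: complex_eq_iff)
qed

lemma integral_Re_Im_fourier_char:
  "(\<integral>x. Re (fourier_char k x) \<partial>unit_lborel) = (if k = 0 then 1 else 0)"
  "(\<integral>x. Im (fourier_char k x) \<partial>unit_lborel) = 0"
  using integral_fourier_char[of k] integrable_fourier_char[of k]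
  by (simp_all add: integral_Re integral_Im)

lemma fourier_coeff_alt: "fourier_coeff f k = (\<integral>x. fourier_char k x * of_real (f x) \<partial>unit_lborel)"
  by (simp add: fourier_coeff_def set_integral_unit_lborel)

lemma periodic_L2_integrable:
  assumes "periodic_L2 f"
  shows "integrable unit_lborel f" "integrable unit_lborel (\<lambda>x. (f x)\<^sup>2)"
    "integrable unit_lborel (\<lambda>x. fourier_char k x * of_real (f x))"
proof -
  interpret prob_space unit_lborel by (rule prob_space_unit_lborel)
  have [measurable]: "f \<in> borel_measurable unit_lborel"
    using assms by (auto simp: periodic_L2_def intro: measurable_unit_lborel)
  have [measurable]: "fourier_char k \<in> borel_measurable unit_lborel"
    by (auto intro: measurable_unit_lborel)
  show sq: "integrable unit_lborel (\<lambda>x. (f x)\<^sup>2)"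
    using assms by (simp add: periodic_L2_def set_integrable_unit_lborel)
  show int: "integrable unit_lborel f"
    by (rule square_integrable_imp_integrable[OF _ sq]) measurable
  show "integrable unit_lborel (\<lambda>x. fourier_char k x * of_real (f x))"
    by (rule Bochner_Integration.integrable_bound[OF int]) (auto simp: norm_mult)
qed

lemma fourier_coeff_uminus:
  assumes "periodic_L2 f"
  shows "fourier_coeff f (- k) = cnj (fourier_coeff f k)"
  unfolding fourier_coeff_alt
  using Bochner_Integration.integral_cnj[of unit_lborel "\<lambda>x. fourier_char k x * of_real (f x)"]
  by (simp add: fourier_char_uminus)

lemma bessel_inequality:
  assumes f: "periodic_L2 f" and K: "finite K"
  shows "(\<Sum>k\<in>K. (cmod (fourier_coeff f k))\<^sup>2) \<le> (\<integral>x. (f x)\<^sup>2 \<partial>unit_lborel)"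
proof -
  define \<theta> where "\<theta> = fourier_coeff f"
  define P where "P x = (\<Sum>k\<in>K. \<theta> k * fourier_char (- k) x)" for x
  have sq: "(cmod (of_real (f x) - P x))\<^sup>2 =
      Re (of_real ((f x)\<^sup>2) - 2 * (\<Sum>k\<in>K. \<theta> k * (fourier_char (- k) x * of_real (f x)))
        + (\<Sum>k\<in>K. \<Sum>l\<in>K. \<theta> k * cnj (\<theta> l) * fourier_char (l - k) x))" for x
  proof -
    have "(cmod (of_real (f x) - P x))\<^sup>2 = Re ((of_real (f x) - P x) * cnj (of_real (f x) - P x))"
      by (simp add: cmod_power2) (simp add: power2_eq_square)
    also have "\<dots> = Re (of_real ((f x)\<^sup>2) - 2 * (of_real (f x) * P x) + P x * cnj (P x))"
      by (simp add: algebra_simps power2_eq_square)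
    also have "of_real (f x) * P x = (\<Sum>k\<in>K. \<theta> k * (fourier_char (- k) x * of_real (f x)))"
      by (simp add: P_def sum_distrib_left mult_ac)
    also have "P x * cnj (P x) = (\<Sum>k\<in>K. \<Sum>l\<in>K. \<theta> k * cnj (\<theta> l) * fourier_char (l - k) x)"
      unfolding P_def cnj_sum sum_product
    proof (intro sum.cong refl)
      fix k l
      have "fourier_char (l - k) x = fourier_char (- k) x * fourier_char l x"
        by (simp add: fourier_char_mult)
      thus "\<theta> k * fourier_char (- k) x * cnj (\<theta> l * fourier_char (- l) x) =
        \<theta> k * cnj (\<theta> l) * fourier_char (l - k) x"
        by (simp add: fourier_char_uminus)
    qed
    finally show ?thesis .
  qed
  note int = periodic_L2_integrable[OF f] integrable_fourier_char
  have int2: "integrable unit_lborel (\<lambda>x. complex_of_real ((f x)\<^sup>2))"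
    using int(2) by (rule integrable_of_real)
  define F where "F = (\<lambda>x. of_real ((f x)\<^sup>2) - 2 * (\<Sum>k\<in>K. \<theta> k * (fourier_char (- k) x * of_real (f x)))
        + (\<Sum>k\<in>K. \<Sum>l\<in>K. \<theta> k * cnj (\<theta> l) * fourier_char (l - k) x))"
  have F: "integrable unit_lborel F" unfolding F_def
    by (intro Bochner_Integration.integrable_add Bochner_Integration.integrable_diff int2
      Bochner_Integration.integrable_sum integrable_mult_right int)
  have "(\<integral>x. F x \<partial>unit_lborel) = of_real (\<integral>x. (f x)\<^sup>2 \<partial>unit_lborel)
      - 2 * (\<Sum>k\<in>K. \<theta> k * \<theta> (- k)) + (\<Sum>k\<in>K. \<Sum>l\<in>K. \<theta> k * cnj (\<theta> l) * (if l - k = 0 then 1 else 0))"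
  proof -
    have i1: "(\<integral>x. complex_of_real ((f x)\<^sup>2) \<partial>unit_lborel) = of_real (\<integral>x. (f x)\<^sup>2 \<partial>unit_lborel)"
      by (rule integral_complex_of_real)
    have int3: "integrable unit_lborel (\<lambda>x. \<theta> k * (fourier_char (- k) x * of_real (f x)))" for k
      by (intro integrable_mult_right int)
    have i2: "(\<integral>x. 2 * (\<Sum>k\<in>K. \<theta> k * (fourier_char (- k) x * of_real (f x))) \<partial>unit_lborel) = 2 * (\<Sum>k\<in>K. \<theta> k * \<theta> (- k))"
    proof -
      have "(\<integral>x. 2 * (\<Sum>k\<in>K. \<theta> k * (fourier_char (- k) x * of_real (f x))) \<partial>unit_lborel) =
        2 * (\<Sum>k\<in>K. \<integral>x. \<theta> k * (fourier_char (- k) x * of_real (f x)) \<partial>unit_lborel)"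
        by (subst integral_mult_right_zero, subst Bochner_Integration.integral_sum) (auto intro: int3)
      thus ?thesis by (simp only: integral_mult_right_zero \<theta>_def fourier_coeff_alt)
    qed
    have int4: "integrable unit_lborel (\<lambda>x. \<theta> k * cnj (\<theta> l) * fourier_char (l - k) x)" for k l
      by (intro integrable_mult_right int)
    have i3: "(\<integral>x. (\<Sum>k\<in>K. \<Sum>l\<in>K. \<theta> k * cnj (\<theta> l) * fourier_char (l - k) x) \<partial>unit_lborel) =
      (\<Sum>k\<in>K. \<Sum>l\<in>K. \<theta> k * cnj (\<theta> l) * (if l - k = 0 then 1 else 0))"
    proof -
      have "(\<integral>x. (\<Sum>k\<in>K. \<Sum>l\<in>K. \<theta> k * cnj (\<theta> l) * fourier_char (l - k) x) \<partial>unit_lborel) =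
        (\<Sum>k\<in>K. \<Sum>l\<in>K. \<integral>x. \<theta> k * cnj (\<theta> l) * fourier_char (l - k) x \<partial>unit_lborel)"
        by (subst Bochner_Integration.integral_sum, (intro Bochner_Integration.integrable_sum int4),
          intro sum.cong refl, subst Bochner_Integration.integral_sum) (auto intro: int4)
      thus ?thesis by (simp only: integral_mult_right_zero integral_fourier_char)
    qed
    show ?thesis unfolding F_def
      by (subst Bochner_Integration.integral_add, intro Bochner_Integration.integrable_diff int2 integrable_mult_right
        Bochner_Integration.integrable_sum int3, intro Bochner_Integration.integrable_sum int4,
        subst Bochner_Integration.integral_diff, rule int2, intro integrable_mult_right
        Bochner_Integration.integrable_sum int3, simp only: i1 i2 i3)
  qed
  also have "(\<Sum>k\<in>K. \<Sum>l\<in>K. \<theta> k * cnj (\<theta> l) * (if l - k = 0 then 1 else 0)) = (\<Sum>k\<in>K. \<theta> k * cnj (\<theta> k))"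
    using K by (intro sum.cong refl) (simp add: if_distrib if_distribR cong: if_cong)
  \<comment> \<open>Since \<open>f\<close> is real, \<open>\<theta> (- k)\<close> is the conjugate
    of \<open>\<theta> k\<close>, so the mixed term is the same sum of squares as the last
    one.\<close>
  also have "(\<Sum>k\<in>K. \<theta> k * \<theta> (- k)) = (\<Sum>k\<in>K. \<theta> k * cnj (\<theta> k))"
    unfolding \<theta>_def by (simp add: fourier_coeff_uminus[OF f])
  also have "(\<Sum>k\<in>K. \<theta> k * cnj (\<theta> k)) = of_real (\<Sum>k\<in>K. (cmod (\<theta> k))\<^sup>2)"
    by (simp add: complex_norm_square[symmetric])
  finally have "(\<integral>x. F x \<partial>unit_lborel) = of_real ((\<integral>x. (f x)\<^sup>2 \<partial>unit_lborel) - (\<Sum>k\<in>K. (cmod (\<theta> k))\<^sup>2))"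
    by simp
  hence "(\<integral>x. Re (F x) \<partial>unit_lborel) = (\<integral>x. (f x)\<^sup>2 \<partial>unit_lborel) - (\<Sum>k\<in>K. (cmod (\<theta> k))\<^sup>2)"
    using F by (simp add: integral_Re)
  moreover have "0 \<le> (\<integral>x. Re (F x) \<partial>unit_lborel)"
    unfolding F_def sq[symmetric] by (rule Bochner_Integration.integral_nonneg) simp
  ultimately show ?thesis by (simp add: \<theta>_def)
qed

lemma fourier_coeff_square_summable:
  assumes "periodic_L2 f"
  shows "(\<lambda>k. (cmod (fourier_coeff f k))\<^sup>2) summable_on A"
proof (rule nonneg_bdd_above_summable_on)
  show "bdd_above (sum (\<lambda>k. (cmod (fourier_coeff f k))\<^sup>2) ` {F. F \<subseteq> A \<and> finite F})"
    using bessel_inequality[OF assms] by (intro bdd_aboveI) auto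
qed simp

section \<open>Shifts of periodic functions\<close>

lemma periodic_add_of_int:
  assumes "\<And>x. h (x + 1) = (h x :: 'b)"
  shows "h (x + of_int m) = h x"
proof (induction m rule: int_induct[of _ 0])
  case (step1 i)
  then show ?case using assms[of "x + of_int i"] by (simp add: add.assoc)
next
  case (step2 i)
  then show ?case using assms[of "x + of_int (i - 1)"] by (simp add: algebra_simps)
qed simp

text \<open>Only the fractional part \<open>t\<close> of the shift matters. The shifted window
  \<open>{- t..1 - t}\<close> is cut at \<open>0\<close>, and its negative piece is moved by one
  period.\<close>

lemma periodic_shift_integral:
  fixes h :: "real \<Rightarrow> complex"
  assumes per: "\<And>x. h (x + 1) = h x" and int: "set_integrable lborel {0..1} h"
  shows "(LBINT x:{0..1}. h (x - \<tau>)) = (LBINT x:{0..1}. h x)"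
proof -
  define t where "t = frac \<tau>"
  have t: "0 \<le> t" "t < 1" by (auto simp: t_def frac_ge_0 frac_lt_1)
  have ht: "h (x - \<tau>) = h (x - t)" for x
  proof -
    have "x - t = (x - \<tau>) + of_int \<lfloor>\<tau>\<rfloor>" by (simp add: t_def frac_def)
    thus ?thesis using periodic_add_of_int[of h, OF per] by metis
  qed
  have i1: "set_integrable lborel {0..1 - t} h" and i2: "set_integrable lborel {1 - t..<1} h"
    by (rule set_integrable_subset[OF int]; use t in force)+
  have i2': "integrable lborel (\<lambda>x. indicator {- t..<0} x *\<^sub>R h x)"
    and e2: "(\<integral>x. indicator {- t..<0} x *\<^sub>R h x \<partial>lborel) = (LBINT x:{1 - t..<1}. h x)"
  proof -
    have eq: "indicator {1 - t..<1} (1 + 1 * x) *\<^sub>R h (1 + 1 * x) = indicator {- t..<0} x *\<^sub>R h x" for x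
      using per[of x] by (auto simp: indicator_def add.commute)
    show "integrable lborel (\<lambda>x. indicator {- t..<0} x *\<^sub>R h x)"
      using lborel_integrable_real_affine[OF i2[unfolded set_integrable_def], of 1 1] unfolding eq by simp
    show "(\<integral>x. indicator {- t..<0} x *\<^sub>R h x \<partial>lborel) = (LBINT x:{1 - t..<1}. h x)"
      unfolding set_lebesgue_integral_def
      by (subst (2) lborel_integral_real_affine[where c = 1 and t = 1]) (simp_all only: eq, simp)
  qed
  have "(LBINT x:{0..1}. h (x - \<tau>)) = (\<integral>x. indicator {0..1} x *\<^sub>R h (x - t) \<partial>lborel)"
    by (simp add: set_lebesgue_integral_def ht)
  also have "\<dots> = (\<integral>x. indicator {0..1} (t + 1 * x) *\<^sub>R h (t + 1 * x - t) \<partial>lborel)"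
    by (subst lborel_integral_real_affine[where c = 1 and t = t]) auto
  also have "\<dots> = (\<integral>x. indicator {- t..<0} x *\<^sub>R h x + indicator {0..1 - t} x *\<^sub>R h x \<partial>lborel)"
    using t by (intro Bochner_Integration.integral_cong) (auto simp: indicator_def)
  also have "\<dots> = (LBINT x:{1 - t..<1}. h x) + (LBINT x:{0..1 - t}. h x)"
    using i1 i2' e2 by (subst Bochner_Integration.integral_add) (auto simp: set_integrable_def set_lebesgue_integral_def)
  also have "\<dots> = (\<integral>x. indicator {1 - t..<1} x *\<^sub>R h x + indicator {0..1 - t} x *\<^sub>R h x \<partial>lborel)"
    using i1 i2 by (subst Bochner_Integration.integral_add) (auto simp: set_integrable_def set_lebesgue_integral_def)
  \<comment> \<open>For positive \<open>t\<close> the two pieces overlap at \<open>1 - t\<close> and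
    miss the point \<open>1\<close>; both points are null sets.\<close>
  also have "\<dots> = (LBINT x:{0..1}. h x)"
    unfolding set_lebesgue_integral_def
  proof (rule integral_cong_AE)
    show "(\<lambda>x. indicator {1 - t..<1} x *\<^sub>R h x + indicator {0..1 - t} x *\<^sub>R h x) \<in> borel_measurable lborel"
      using i1 i2 unfolding set_integrable_def by (intro borel_measurable_add borel_measurable_integrable)
    show "(\<lambda>x. indicator {0..1} x *\<^sub>R h x) \<in> borel_measurable lborel"
      using int unfolding set_integrable_def by (rule borel_measurable_integrable)
    show "AE x in lborel. indicator {1 - t..<1} x *\<^sub>R h x + indicator {0..1 - t} x *\<^sub>R h x = indicator {0..1} x *\<^sub>R h x"
      using AE_lborel_singleton[of 1] AE_lborel_singleton[of "1 - t"]
      by eventually_elim (use t in \<open>auto simp: indicator_def\<close>)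
  qed
  finally show ?thesis .
qed

lemma shifted_fourier_coeff:
  assumes f: "periodic_L2 f"
  shows "(LBINT x:{0..1}. fourier_char k x * of_real (f (x - \<tau>))) = fourier_char k \<tau> * fourier_coeff f k"
proof -
  define h where "h x = fourier_char k x * of_real (f x)" for x
  have per: "h (x + 1) = h x" for x
    using f fourier_char_of_int[of k 1] by (simp add: h_def periodic_L2_def fourier_char_add)
  have int: "set_integrable lborel {0..1} h"
    unfolding h_def set_integrable_unit_lborel by (rule periodic_L2_integrable(3)[OF f])
  have "fourier_char k x * of_real (f (x - \<tau>)) = fourier_char k \<tau> * h (x - \<tau>)" for x
    using fourier_char_add[of k \<tau> "x - \<tau>"] by (simp add: h_def mult.assoc[symmetric])
  hence "(LBINT x:{0..1}. fourier_char k x * of_real (f (x - \<tau>))) = fourier_char k \<tau> * (LBINT x:{0..1}. h (x - \<tau>))"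
    by simp
  thus ?thesis using periodic_shift_integral[OF per int, of \<tau>] by (simp add: fourier_coeff_def h_def)
qed

section \<open>Exponential inequalities for Gaussian sequences\<close>

lemma power_le_fact_exp:
  assumes "0 \<le> (x::real)"
  shows "x ^ n \<le> fact n * exp x"
proof -
  have s: "(\<lambda>k. x ^ k / fact k) sums exp x" using exp_converges[of x] by (simp add: field_simps)
  hence "(\<Sum>k\<in>{n}. x ^ k / fact k) \<le> (\<Sum>k. x ^ k / fact k)"
    using assms by (intro sum_le_suminf) (auto simp: sums_iff)
  hence "x ^ n / fact n \<le> exp x" using s by (simp add: sums_iff)
  thus ?thesis by (simp add: field_simps)
qed

lemma std_normal_integral_exp_square:
  assumes s: "0 \<le> s" "s < 1"
  shows "(\<integral>\<^sup>+ z. ennreal (exp ((b + sqrt s * z)\<^sup>2 / 2)) \<partial>std_normal_distribution)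
    = ennreal (1 / sqrt (1 - s) * exp (b\<^sup>2 / (1 - s) / 2))"
proof -
  \<comment> \<open>\<open>\<rho>\<close> and \<open>\<mu>\<close> are the standard deviation and
    the mean of the Gaussian density that appears when the square in the exponent is
    completed.\<close>
  define \<rho> where "\<rho> = 1 / sqrt (1 - s)"
  have \<rho>: "\<rho> > 0" "\<rho>\<^sup>2 = 1 / (1 - s)" using s by (auto simp: \<rho>_def power_divide)
  define \<mu> where "\<mu> = b * sqrt s * \<rho>\<^sup>2"
  have quad: "(b + sqrt s * z)\<^sup>2 / 2 - z\<^sup>2 / 2 = b\<^sup>2 / (1 - s) / 2 - (z - \<mu>)\<^sup>2 / (2 * \<rho>\<^sup>2)" for z
  proof -
    have "(z - \<mu>)\<^sup>2 / (2 * \<rho>\<^sup>2) = (z * (1 - s) - b * sqrt s)\<^sup>2 / (2 * (1 - s))"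
      unfolding \<mu>_def \<rho>(2) using s by (simp add: power2_eq_square divide_simps)
    moreover have "(b + sqrt s * z)\<^sup>2 = b\<^sup>2 + 2 * (b * sqrt s * z) + s * z\<^sup>2"
      using s by (simp add: power2_sum power_mult_distrib)
    moreover have "(z * (1 - s) - b * sqrt s)\<^sup>2 = z\<^sup>2 * (1 - s)\<^sup>2 - 2 * (b * sqrt s * z) * (1 - s) + b\<^sup>2 * s"
      using s by (simp add: power2_diff power_mult_distrib)
    moreover have "(B + 2 * a + (1 - u) * Z) / 2 - Z / 2 = B / u / 2 - (Z * u\<^sup>2 - 2 * a * u + B * (1 - u)) / (2 * u)"
      if "u \<noteq> 0" for u a B Z :: real
      using that by (simp add: field_simps power2_eq_square)
    from this[of "1 - s" "b\<^sup>2" "b * sqrt s * z" "z\<^sup>2"]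
    have "(b\<^sup>2 + 2 * (b * sqrt s * z) + s * z\<^sup>2) / 2 - z\<^sup>2 / 2 =
      b\<^sup>2 / (1 - s) / 2 - (z\<^sup>2 * (1 - s)\<^sup>2 - 2 * (b * sqrt s * z) * (1 - s) + b\<^sup>2 * s) / (2 * (1 - s))"
      using s by simp
    ultimately show ?thesis by simp
  qed
  have exp_diff': "exp (p - q) = exp p * exp (- q)" for p q :: real
    by (simp flip: exp_add)
  have eq: "std_normal_density z * exp ((b + sqrt s * z)\<^sup>2 / 2) =
    (\<rho> * exp (b\<^sup>2 / (1 - s) / 2)) * normal_density \<mu> \<rho> z" for z
  proof -
    have "std_normal_density z * exp ((b + sqrt s * z)\<^sup>2 / 2) =
      1 / sqrt (2 * pi) * exp ((b + sqrt s * z)\<^sup>2 / 2 - z\<^sup>2 / 2)"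
      unfolding exp_diff' by (simp add: normal_density_def)
    also have "\<dots> = 1 / sqrt (2 * pi) * exp (b\<^sup>2 / (1 - s) / 2) * exp (- (z - \<mu>)\<^sup>2 / (2 * \<rho>\<^sup>2))"
      unfolding quad exp_diff' by simp
    also have "\<dots> = (\<rho> * exp (b\<^sup>2 / (1 - s) / 2)) * normal_density \<mu> \<rho> z"
      using \<rho>(1) by (simp add: normal_density_def real_sqrt_mult)
    finally show ?thesis .
  qed
  have "(\<integral>\<^sup>+ z. ennreal (exp ((b + sqrt s * z)\<^sup>2 / 2)) \<partial>std_normal_distribution) =
    (\<integral>\<^sup>+ z. ennreal ((\<rho> * exp (b\<^sup>2 / (1 - s) / 2)) * normal_density \<mu> \<rho> z) \<partial>lborel)"
    by (subst nn_integral_density) (auto simp: eq simp flip: ennreal_mult')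
  also have "\<dots> = ennreal (\<rho> * exp (b\<^sup>2 / (1 - s) / 2)) * (\<integral>\<^sup>+ z. ennreal (normal_density \<mu> \<rho> z) \<partial>lborel)"
    using \<rho> by (subst nn_integral_cmult[symmetric]) (auto simp: ennreal_mult' intro!: nn_integral_cong)
  also have "(\<integral>\<^sup>+ z. ennreal (normal_density \<mu> \<rho> z) \<partial>lborel) = 1"
    using prob_space.emeasure_space_1[OF prob_space_normal_density[of \<rho> \<mu>]] \<rho>
    by (simp add: emeasure_density)
  finally show ?thesis by (simp add: \<rho>_def)
qed

text \<open>Turns an exponential moment into a bound on an expected excess without integrating
  tails.\<close>

lemma pos_part_exp_bound:
  assumes "(t::real) > 0"
  shows "max 0 z \<le> exp (t * z) / t"
proof -
  have "t * z \<le> exp (t * z)" using exp_ge_add_one_self[of "t * z"] by linarith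
  thus ?thesis using assms by (auto simp: max_def field_simps)
qed

text \<open>The assumption is a joint bound on linear forms, as for independent standard normal
  variables. It is phrased through the moment generating function because this is what
  \<open>gaussian_of_char\<close> delivers.\<close>

locale gaussian_sequence = prob_space +
  fixes x :: "'i \<Rightarrow> 'a \<Rightarrow> real"
  assumes x_meas [measurable]: "x k \<in> borel_measurable M"
    and mgf: "finite K \<Longrightarrow> (\<integral>\<^sup>+ \<omega>. ennreal (exp (\<Sum>k\<in>K. b k * x k \<omega>)) \<partial>M) \<le> ennreal (exp ((\<Sum>k\<in>K. (b k)\<^sup>2) / 2))"
begin

text \<open>Hubbard-Stratonovich: the exponential of a square is a Gaussian mixture of exponentials of linear
  forms, so linear moment generating functions control quadratic ones, with no appeal to independence.\<close>

lemma mgf_quadratic_linear: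
  assumes "finite L" "K \<subseteq> L" "\<And>k. k \<in> K \<Longrightarrow> 0 \<le> c k \<and> c k < 1"
  shows "(\<integral>\<^sup>+ \<omega>. ennreal (exp ((\<Sum>k\<in>K. c k * (x k \<omega>)\<^sup>2 / 2) + (\<Sum>k\<in>L. b k * x k \<omega>))) \<partial>M)
    \<le> ennreal ((\<Prod>k\<in>K. 1 / sqrt (1 - c k)) * exp (((\<Sum>k\<in>K. (b k)\<^sup>2 / (1 - c k)) + (\<Sum>k\<in>L - K. (b k)\<^sup>2)) / 2))"
proof -
  have "finite K" using assms(1,2) by (rule rev_finite_subset)
  from this assms(2,3) show ?thesis
  proof (induction K arbitrary: b)
    case empty
    then show ?case using mgf[OF assms(1), of b] by simp
  next
    case (insert l K)
    interpret N: prob_space std_normal_distribution by (rule prob_space_normal_density) simp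
    interpret P: pair_sigma_finite M std_normal_distribution ..
    have l: "l \<in> L" "0 \<le> c l" "c l < 1" using insert.prems by auto
    \<comment> \<open>One square is traded for a linear term: the coefficient of \<open>x l\<close>
      is shifted by \<open>sqrt (c l) * z\<close> with an auxiliary normal \<open>z\<close>. This is
      why the induction keeps \<open>b\<close> arbitrary.\<close>
    define b' where "b' z = b(l := b l + sqrt (c l) * z)" for z
    have lin: "(\<Sum>k\<in>L. b' z k * x k \<omega>) = sqrt (c l) * x l \<omega> * z + (\<Sum>k\<in>L. b k * x k \<omega>)" for z \<omega>
      using l assms(1) by (simp add: b'_def sum.remove[of L l] algebra_simps)
    define q where "q = (\<Sum>k\<in>K. (b k)\<^sup>2 / (1 - c k)) + (\<Sum>k\<in>L - insert l K. (b k)\<^sup>2)"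
    have q: "(\<Sum>k\<in>K. (b' z k)\<^sup>2 / (1 - c k)) + (\<Sum>k\<in>L - K. (b' z k)\<^sup>2) = q + (b l + sqrt (c l) * z)\<^sup>2" for z
    proof -
      have "(\<Sum>k\<in>K. (b' z k)\<^sup>2 / (1 - c k)) = (\<Sum>k\<in>K. (b k)\<^sup>2 / (1 - c k))"
        using insert.hyps by (intro sum.cong) (auto simp: b'_def)
      moreover have "(\<Sum>k\<in>L - K. (b' z k)\<^sup>2) = (b' z l)\<^sup>2 + (\<Sum>k\<in>L - K - {l}. (b' z k)\<^sup>2)"
        using l insert.hyps assms(1) by (intro sum.remove) auto
      moreover have "(\<Sum>k\<in>L - K - {l}. (b' z k)\<^sup>2) = (\<Sum>k\<in>L - insert l K. (b k)\<^sup>2)"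
        by (intro sum.cong) (auto simp: b'_def)
      ultimately show ?thesis by (simp add: q_def b'_def)
    qed
    let ?A = "\<lambda>\<omega>. (\<Sum>k\<in>K. c k * (x k \<omega>)\<^sup>2 / 2)"
    let ?p = "\<Prod>k\<in>K. 1 / sqrt (1 - c k)"
    have p: "?p \<ge> 0" using insert.prems by (intro prod_nonneg) (auto simp: less_imp_le)
    have "(\<integral>\<^sup>+ \<omega>. ennreal (exp ((\<Sum>k\<in>insert l K. c k * (x k \<omega>)\<^sup>2 / 2) + (\<Sum>k\<in>L. b k * x k \<omega>))) \<partial>M) =
      (\<integral>\<^sup>+ \<omega>. (\<integral>\<^sup>+ z. ennreal (exp (?A \<omega> + (\<Sum>k\<in>L. b' z k * x k \<omega>))) \<partial>std_normal_distribution) \<partial>M)"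
    proof (rule nn_integral_cong)
      fix \<omega>
      have "exp (?A \<omega> + (\<Sum>k\<in>L. b' z k * x k \<omega>)) = exp (?A \<omega> + (\<Sum>k\<in>L. b k * x k \<omega>)) * exp ((sqrt (c l) * x l \<omega>) * z)" for z
        unfolding lin by (simp flip: exp_add add: algebra_simps)
      hence "(\<integral>\<^sup>+ z. ennreal (exp (?A \<omega> + (\<Sum>k\<in>L. b' z k * x k \<omega>))) \<partial>std_normal_distribution) =
        ennreal (exp (?A \<omega> + (\<Sum>k\<in>L. b k * x k \<omega>))) * ennreal (exp ((sqrt (c l) * x l \<omega>)\<^sup>2 / 2))"
        unfolding std_normal_distribution_nn_integral_exp[symmetric]
        by (subst nn_integral_cmult[symmetric]) (auto simp: ennreal_mult')
      also have "\<dots> = ennreal (exp ((\<Sum>k\<in>insert l K. c k * (x k \<omega>)\<^sup>2 / 2) + (\<Sum>k\<in>L. b k * x k \<omega>)))"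
        using insert.hyps l by (simp add: power_mult_distrib algebra_simps flip: ennreal_mult' exp_add)
      finally show "ennreal (exp ((\<Sum>k\<in>insert l K. c k * (x k \<omega>)\<^sup>2 / 2) + (\<Sum>k\<in>L. b k * x k \<omega>))) =
        (\<integral>\<^sup>+ z. ennreal (exp (?A \<omega> + (\<Sum>k\<in>L. b' z k * x k \<omega>))) \<partial>std_normal_distribution)" by simp
    qed
    also have "\<dots> = (\<integral>\<^sup>+ z. (\<integral>\<^sup>+ \<omega>. ennreal (exp (?A \<omega> + (\<Sum>k\<in>L. b' z k * x k \<omega>))) \<partial>M) \<partial>std_normal_distribution)"
    proof (rule P.Fubini'[symmetric])
      have "(\<lambda>p. ennreal (exp (?A (fst p) + (sqrt (c l) * x l (fst p) * snd p + (\<Sum>k\<in>L. b k * x k (fst p))))))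
        \<in> borel_measurable (M \<Otimes>\<^sub>M std_normal_distribution)" by measurable
      thus "(\<lambda>(\<omega>, z). ennreal (exp (?A \<omega> + (\<Sum>k\<in>L. b' z k * x k \<omega>)))) \<in> borel_measurable (M \<Otimes>\<^sub>M std_normal_distribution)"
        unfolding lin by (simp add: split_beta')
    qed
    also have "\<dots> \<le> (\<integral>\<^sup>+ z. ennreal (?p * exp ((q + (b l + sqrt (c l) * z)\<^sup>2) / 2)) \<partial>std_normal_distribution)"
      unfolding q[symmetric] using insert.prems by (intro nn_integral_mono insert.IH) auto
    also have "\<dots> = (\<integral>\<^sup>+ z. ennreal (?p * exp (q / 2)) * ennreal (exp ((b l + sqrt (c l) * z)\<^sup>2 / 2)) \<partial>std_normal_distribution)"
      using p by (intro nn_integral_cong) (simp add: add_divide_distrib exp_add mult.assoc flip: ennreal_mult')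
    also have "\<dots> = ennreal (?p * exp (q / 2)) * ennreal (1 / sqrt (1 - c l) * exp ((b l)\<^sup>2 / (1 - c l) / 2))"
      using l by (subst nn_integral_cmult) (auto simp: std_normal_integral_exp_square)
    also have "\<dots> = ennreal ((\<Prod>k\<in>insert l K. 1 / sqrt (1 - c k)) *
        exp (((\<Sum>k\<in>insert l K. (b k)\<^sup>2 / (1 - c k)) + (\<Sum>k\<in>L - insert l K. (b k)\<^sup>2)) / 2))"
    proof -
      have "(\<Prod>k\<in>insert l K. 1 / sqrt (1 - c k)) *
        exp (((\<Sum>k\<in>insert l K. (b k)\<^sup>2 / (1 - c k)) + (\<Sum>k\<in>L - insert l K. (b k)\<^sup>2)) / 2) =
        (?p * exp (q / 2)) * (1 / sqrt (1 - c l) * exp ((b l)\<^sup>2 / (1 - c l) / 2))"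
        using insert.hyps by (simp add: q_def add_divide_distrib exp_add mult_ac)
      thus ?thesis using p by (simp only: ennreal_mult' mult_nonneg_nonneg exp_ge_zero)
    qed
    finally show ?case .
  qed
qed

text \<open>For weights at most \<open>1 / 4\<close> the factor
  \<open>1 / sqrt (1 - 2 * y k)\<close> exceeds the contribution \<open>exp (y k)\<close> of the
  mean only in second order. That second order term is what the margin in
  \<open>quadratic_excess\<close> has to pay for.\<close>

lemma mgf_quadratic:
  assumes "finite K" "\<And>k. k \<in> K \<Longrightarrow> 0 \<le> y k \<and> y k \<le> 1 / 4"
  shows "(\<integral>\<^sup>+ \<omega>. ennreal (exp (\<Sum>k\<in>K. y k * (x k \<omega>)\<^sup>2)) \<partial>M) \<le> ennreal (exp (\<Sum>k\<in>K. y k + 4 * (y k)\<^sup>2))"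
proof -
  have le: "1 / sqrt (1 - 2 * t) \<le> exp (t + 4 * t\<^sup>2)" if "0 \<le> t" "t \<le> 1 / 4" for t :: real
  proof -
    have "- (2 * t) - 2 * (2 * t)\<^sup>2 \<le> ln (1 - 2 * t)"
      using ln_one_minus_pos_lower_bound[of "2 * t"] that by simp
    hence "- (t + 4 * t\<^sup>2) \<le> ln (sqrt (1 - 2 * t))"
      using that by (simp add: ln_sqrt power2_eq_square)
    hence "exp (- (t + 4 * t\<^sup>2)) \<le> sqrt (1 - 2 * t)"
      using that by (subst (asm) ln_ge_iff) auto
    moreover have "sqrt (1 - 2 * t) > 0" using that by simp
    ultimately have "1 / sqrt (1 - 2 * t) \<le> 1 / exp (- (t + 4 * t\<^sup>2))"
      by (intro divide_left_mono) auto
    also have "\<dots> = exp (t + 4 * t\<^sup>2)"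
      by (simp only: exp_minus divide_inverse mult_1_left inverse_inverse_eq)
    finally show ?thesis .
  qed
  have c: "0 \<le> 2 * y k \<and> 2 * y k < 1" if "k \<in> K" for k using assms(2)[OF that] by auto
  have "(\<integral>\<^sup>+ \<omega>. ennreal (exp (\<Sum>k\<in>K. y k * (x k \<omega>)\<^sup>2)) \<partial>M) \<le> ennreal (\<Prod>k\<in>K. 1 / sqrt (1 - 2 * y k))"
    using mgf_quadratic_linear[OF assms(1) subset_refl c, where b = "\<lambda>_. 0"] by simp
  also have "\<dots> \<le> ennreal (\<Prod>k\<in>K. exp (y k + 4 * (y k)\<^sup>2))"
  proof (intro ennreal_leI prod_mono conjI le)
    fix k assume "k \<in> K"
    thus "0 \<le> 1 / sqrt (1 - 2 * y k)" using c by (simp add: less_imp_le)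
  qed (use assms(2) in auto)
  also have "\<dots> = ennreal (exp (\<Sum>k\<in>K. y k + 4 * (y k)\<^sup>2))" using assms(1) by (simp add: exp_sum)
  finally show ?thesis .
qed

text \<open>The gain is the exponential in \<open>sum w K / wb\<close>. For polynomially growing
  weights this ratio is of the order of the cut-off, so the bounds can be summed over all
  cut-offs.\<close>

lemma quadratic_excess:
  assumes K: "finite K" and w: "\<And>k. k \<in> K \<Longrightarrow> 0 \<le> w k \<and> w k \<le> wb" "0 < wb" and \<eta>: "0 < \<eta>" "\<eta> \<le> 1"
  shows "(\<integral>\<^sup>+ \<omega>. ennreal (max 0 ((\<Sum>k\<in>K. w k * ((x k \<omega>)\<^sup>2 - 1)) - \<eta> * sum w K)) \<partial>M) \<le>
    ennreal (8 * wb / \<eta> * exp (- (\<eta>\<^sup>2 * sum w K / (16 * wb))))"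
proof -
  \<comment> \<open>With this \<open>t\<close> the second order term of \<open>mgf_quadratic\<close>
    uses up half of the margin \<open>t * \<eta> * W\<close>, and every \<open>t * w k\<close> stays
    below \<open>1 / 4\<close>.\<close>
  define t where "t = \<eta> / (8 * wb)"
  have t: "t > 0" using \<eta> w by (simp add: t_def)
  define W where "W = sum w K"
  have y: "0 \<le> t * w k \<and> t * w k \<le> 1 / 4" if "k \<in> K" for k
  proof -
    have "t * w k \<le> t * wb" using w(1)[OF that] t by simp
    also have "\<dots> = \<eta> / 8" using w(2) by (simp add: t_def)
    finally show ?thesis using w(1)[OF that] t \<eta> by auto
  qed
  have "(\<integral>\<^sup>+ \<omega>. ennreal (max 0 ((\<Sum>k\<in>K. w k * ((x k \<omega>)\<^sup>2 - 1)) - \<eta> * W)) \<partial>M) \<le>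
    (\<integral>\<^sup>+ \<omega>. ennreal (exp (- (t * (1 + \<eta>) * W)) / t) * ennreal (exp (\<Sum>k\<in>K. (t * w k) * (x k \<omega>)\<^sup>2)) \<partial>M)"
  proof (intro nn_integral_mono)
    fix \<omega>
    have "t * ((\<Sum>k\<in>K. w k * ((x k \<omega>)\<^sup>2 - 1)) - \<eta> * W) = - (t * (1 + \<eta>) * W) + (\<Sum>k\<in>K. (t * w k) * (x k \<omega>)\<^sup>2)"
      by (simp add: W_def right_diff_distrib sum_subtractf sum_distrib_left algebra_simps)
    hence "max 0 ((\<Sum>k\<in>K. w k * ((x k \<omega>)\<^sup>2 - 1)) - \<eta> * W) \<le>
      exp (- (t * (1 + \<eta>) * W) + (\<Sum>k\<in>K. (t * w k) * (x k \<omega>)\<^sup>2)) / t"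
      using pos_part_exp_bound[OF t, of "(\<Sum>k\<in>K. w k * ((x k \<omega>)\<^sup>2 - 1)) - \<eta> * W"] by (simp only:)
    also have "\<dots> = (exp (- (t * (1 + \<eta>) * W)) / t) * exp (\<Sum>k\<in>K. (t * w k) * (x k \<omega>)\<^sup>2)"
      by (simp only: exp_add times_divide_eq_left)
    finally show "ennreal (max 0 ((\<Sum>k\<in>K. w k * ((x k \<omega>)\<^sup>2 - 1)) - \<eta> * W)) \<le>
      ennreal (exp (- (t * (1 + \<eta>) * W)) / t) * ennreal (exp (\<Sum>k\<in>K. (t * w k) * (x k \<omega>)\<^sup>2))"
      using t by (subst ennreal_mult'[symmetric]) (auto intro!: ennreal_leI)
  qed
  also have "\<dots> = ennreal (exp (- (t * (1 + \<eta>) * W)) / t) * (\<integral>\<^sup>+ \<omega>. ennreal (exp (\<Sum>k\<in>K. (t * w k) * (x k \<omega>)\<^sup>2)) \<partial>M)"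
    by (rule nn_integral_cmult) measurable
  also have "\<dots> \<le> ennreal (exp (- (t * (1 + \<eta>) * W)) / t) * ennreal (exp (\<Sum>k\<in>K. t * w k + 4 * (t * w k)\<^sup>2))"
    by (intro mult_left_mono mgf_quadratic K y) auto
  also have "\<dots> = ennreal (exp (- (t * (1 + \<eta>) * W) + (\<Sum>k\<in>K. t * w k + 4 * (t * w k)\<^sup>2)) / t)"
    using t by (subst ennreal_mult'[symmetric]) (auto simp only: exp_add times_divide_eq_left divide_nonneg_pos exp_ge_zero)
  also have "\<dots> \<le> ennreal (exp (- (\<eta>\<^sup>2 * W / (16 * wb))) / t)"
  proof -
    have "(\<Sum>k\<in>K. 4 * (t * w k)\<^sup>2) \<le> (\<Sum>k\<in>K. 4 * t * (t * wb) * w k)"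
    proof (rule sum_mono)
      fix k assume k: "k \<in> K"
      have "w k * w k \<le> wb * w k" using w(1)[OF k] by (intro mult_right_mono) auto
      thus "4 * (t * w k)\<^sup>2 \<le> 4 * t * (t * wb) * w k"
        using t by (simp add: power2_eq_square mult_ac)
    qed
    also have "\<dots> = 4 * t * (t * wb) * W" by (simp only: W_def sum_distrib_left)
    also have "4 * t * (t * wb) = t * \<eta> / 2" using w(2) by (simp add: t_def)
    finally have "- (t * (1 + \<eta>) * W) + (\<Sum>k\<in>K. t * w k + 4 * (t * w k)\<^sup>2) \<le> - (t * \<eta> * W / 2)"
      by (simp add: sum.distrib sum_distrib_left[symmetric] W_def algebra_simps)
    also have "\<dots> = - (\<eta>\<^sup>2 * W / (16 * wb))" by (simp add: t_def power2_eq_square)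
    finally show ?thesis using t by (intro ennreal_leI divide_right_mono) auto
  qed
  also have "exp (- (\<eta>\<^sup>2 * W / (16 * wb))) / t = 8 * wb / \<eta> * exp (- (\<eta>\<^sup>2 * W / (16 * wb)))"
    by (simp add: t_def)
  finally show ?thesis by (simp add: W_def)
qed

text \<open>The parameter \<open>t\<close> is left free so that the variance of the linear form can
  be balanced against a part of \<open>y\<close>.\<close>

lemma linear_excess:
  assumes K: "finite K" and t: "t > 0"
  shows "(\<integral>\<^sup>+ \<omega>. ennreal (max 0 ((\<Sum>k\<in>K. b k * x k \<omega>) - y)) \<partial>M) \<le>
    ennreal (exp (t\<^sup>2 * (\<Sum>k\<in>K. (b k)\<^sup>2) / 2 - t * y) / t)"
proof -
  have "(\<integral>\<^sup>+ \<omega>. ennreal (max 0 ((\<Sum>k\<in>K. b k * x k \<omega>) - y)) \<partial>M) \<le>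
    (\<integral>\<^sup>+ \<omega>. ennreal (exp (- (t * y)) / t) * ennreal (exp (\<Sum>k\<in>K. (t * b k) * x k \<omega>)) \<partial>M)"
  proof (intro nn_integral_mono)
    fix \<omega>
    have "t * ((\<Sum>k\<in>K. b k * x k \<omega>) - y) = - (t * y) + (\<Sum>k\<in>K. (t * b k) * x k \<omega>)"
      by (simp add: right_diff_distrib sum_distrib_left mult.assoc)
    hence "max 0 ((\<Sum>k\<in>K. b k * x k \<omega>) - y) \<le> exp (- (t * y) + (\<Sum>k\<in>K. (t * b k) * x k \<omega>)) / t"
      using pos_part_exp_bound[OF t, of "(\<Sum>k\<in>K. b k * x k \<omega>) - y"] by (simp only:)
    thus "ennreal (max 0 ((\<Sum>k\<in>K. b k * x k \<omega>) - y)) \<le>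
      ennreal (exp (- (t * y)) / t) * ennreal (exp (\<Sum>k\<in>K. (t * b k) * x k \<omega>))"
      using t by (subst ennreal_mult'[symmetric]) (auto intro!: ennreal_leI simp: exp_diff exp_minus field_simps)
  qed
  also have "\<dots> = ennreal (exp (- (t * y)) / t) * (\<integral>\<^sup>+ \<omega>. ennreal (exp (\<Sum>k\<in>K. (t * b k) * x k \<omega>)) \<partial>M)"
    by (rule nn_integral_cmult) measurable
  also have "\<dots> \<le> ennreal (exp (- (t * y)) / t) * ennreal (exp ((\<Sum>k\<in>K. (t * b k)\<^sup>2) / 2))"
    by (intro mult_left_mono mgf K) auto
  also have "\<dots> = ennreal (exp (t\<^sup>2 * (\<Sum>k\<in>K. (b k)\<^sup>2) / 2 - t * y) / t)"
  proof -
    have "(\<Sum>k\<in>K. (t * b k)\<^sup>2) = t\<^sup>2 * (\<Sum>k\<in>K. (b k)\<^sup>2)"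
      by (simp add: power_mult_distrib sum_distrib_left)
    moreover have "exp (- (t * y)) / t * exp (u / 2) = exp (u / 2 - t * y) / t" for u
      by (simp only: diff_conv_add_uminus exp_add times_divide_eq_left times_divide_eq_right mult.commute)
    ultimately show ?thesis using t by (simp only: ennreal_mult'[symmetric] divide_nonneg_pos exp_ge_zero)
  qed
  finally show ?thesis .
qed

text \<open>From \<open>x ^ 4 \<le> 24 * exp \<bar>x\<bar>\<close> and the moment generating
  function at \<open>1\<close> and \<open>- 1\<close>; the value 96 is \<open>48 * 2\<close>, with 2
  as a crude bound for \<open>exp (1 / 2)\<close>.\<close>

lemma fourth_moment:
  "(\<integral>\<^sup>+ \<omega>. ennreal ((x k \<omega>) ^ 4) \<partial>M) \<le> 96"
proof -
  have "(\<integral>\<^sup>+ \<omega>. ennreal ((x k \<omega>) ^ 4) \<partial>M) \<le>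
    (\<integral>\<^sup>+ \<omega>. 24 * (ennreal (exp (\<Sum>k\<in>{k}. 1 * x k \<omega>)) + ennreal (exp (\<Sum>k\<in>{k}. - 1 * x k \<omega>))) \<partial>M)"
  proof (intro nn_integral_mono)
    fix \<omega>
    have "(x k \<omega>) ^ 4 = \<bar>x k \<omega>\<bar> ^ 4" by simp
    also have "\<dots> \<le> fact 4 * exp \<bar>x k \<omega>\<bar>" by (rule power_le_fact_exp) simp
    also have "\<dots> \<le> 24 * (exp (x k \<omega>) + exp (- x k \<omega>))"
      by (cases "x k \<omega> \<ge> 0") (auto simp: fact_numeral)
    finally show "ennreal ((x k \<omega>) ^ 4) \<le>
      24 * (ennreal (exp (\<Sum>k\<in>{k}. 1 * x k \<omega>)) + ennreal (exp (\<Sum>k\<in>{k}. - 1 * x k \<omega>)))"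
      by (simp add: ennreal_leI flip: ennreal_plus ennreal_numeral ennreal_mult)
  qed
  also have "\<dots> = 24 * ((\<integral>\<^sup>+ \<omega>. ennreal (exp (\<Sum>k\<in>{k}. 1 * x k \<omega>)) \<partial>M) + (\<integral>\<^sup>+ \<omega>. ennreal (exp (\<Sum>k\<in>{k}. - 1 * x k \<omega>)) \<partial>M))"
    by (subst nn_integral_cmult, measurable, subst nn_integral_add) measurable
  also have "\<dots> \<le> 24 * (ennreal (exp ((\<Sum>k\<in>{k}. 1\<^sup>2) / 2)) + ennreal (exp ((\<Sum>k\<in>{k}. (- 1)\<^sup>2) / 2)))"
    by (intro mult_left_mono add_mono mgf) auto
  also have "\<dots> = ennreal (48 * exp (1 / 2))"
    by (simp flip: ennreal_plus ennreal_numeral ennreal_mult)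
  also have "\<dots> \<le> ennreal 96"
  proof (rule ennreal_leI)
    have "exp (1 / 2) \<le> (1 + 1 / 2 + (1 / 2)\<^sup>2 :: real)" by (rule exp_bound) auto
    thus "48 * exp (1 / 2) \<le> (96 :: real)" by (simp add: power2_eq_square)
  qed
  finally show ?thesis by simp
qed

end

section \<open>Pathwise oracle inequalities\<close>

lemma cmod_add_square: "(cmod (p + q))\<^sup>2 = (cmod p)\<^sup>2 + 2 * Re (p * cnj q) + (cmod q)\<^sup>2"
  by (simp only: cmod_power2) (simp add: power2_eq_square algebra_simps)

lemma cmod_add_square_le: "(cmod (p + q))\<^sup>2 \<le> 2 * (cmod p)\<^sup>2 + 2 * (cmod q)\<^sup>2"
proof -
  have "(cmod (p + q))\<^sup>2 \<le> (cmod p + cmod q)\<^sup>2" by (intro power_mono norm_triangle_ineq) simp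
  thus ?thesis using sum_squares_bound[of "cmod p" "cmod q"] by (simp add: power2_sum)
qed

locale cutoff_setup =
  fixes \<theta> \<Gamma> :: "int \<Rightarrow> complex" and \<sigma> :: real
  assumes \<Gamma>_nz: "\<Gamma> k \<noteq> 0" and \<theta>_summable: "(\<lambda>k. (cmod (\<theta> k))\<^sup>2) summable_on UNIV" and \<sigma>: "0 < \<sigma>"
begin

definition w :: "int \<Rightarrow> real" where "w k = 1 / (cmod (\<Gamma> k))\<^sup>2"
definition I :: "nat \<Rightarrow> int set" where "I N = {- int N..int N}"
definition S :: "(int \<Rightarrow> real) \<Rightarrow> nat \<Rightarrow> real" where "S u N = (\<Sum>k\<in>I N. u k)"
definition W :: "nat \<Rightarrow> real" where "W = S w"
definition B :: "nat \<Rightarrow> real" where "B N = (\<Sum>\<^sub>\<infinity>k\<in>{k. \<bar>k\<bar> > int N}. (cmod (\<theta> k))\<^sup>2)"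
text \<open>Bias plus variance, that is, the risk of the cut-off when \<open>\<delta>\<close>
  vanishes. All stochastic increments are measured against it.\<close>

definition Q :: "nat \<Rightarrow> real" where "Q N = B N + \<sigma>\<^sup>2 * W N"
definition G :: "(int \<Rightarrow> complex) \<Rightarrow> nat \<Rightarrow> real" where "G \<xi> = S (\<lambda>k. w k * ((cmod (\<xi> k))\<^sup>2 - 1))"
definition H :: "(int \<Rightarrow> complex) \<Rightarrow> nat \<Rightarrow> real" where "H \<xi> = S (\<lambda>k. w k * (cmod (\<xi> k))\<^sup>2)"
text \<open>Up to a factor 2, the cross term of signal and noise in the squared observed
  coefficients, without the contribution of \<open>\<delta>\<close>.\<close>

definition Zl :: "(int \<Rightarrow> complex) \<Rightarrow> nat \<Rightarrow> real" where
  "Zl \<xi> = S (\<lambda>k. Re (of_real \<sigma> * \<xi> k / \<Gamma> k * cnj (\<theta> k)))"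
text \<open>Here \<open>\<delta>\<close> is the relative error on \<open>\<Gamma>\<close> caused by the random shifts, and \<open>X\<close> stands for
  the observed coefficients divided by \<open>\<Gamma>\<close>.\<close>

definition X :: "(int \<Rightarrow> complex) \<Rightarrow> (int \<Rightarrow> complex) \<Rightarrow> int \<Rightarrow> complex" where
  "X \<delta> \<xi> k = \<theta> k * (1 + \<delta> k) + of_real \<sigma> * \<xi> k / \<Gamma> k"
definition Loss :: "(int \<Rightarrow> complex) \<Rightarrow> (int \<Rightarrow> complex) \<Rightarrow> nat \<Rightarrow> real" where
  "Loss \<delta> \<xi> N = B N + S (\<lambda>k. (cmod (X \<delta> \<xi> k - \<theta> k))\<^sup>2) N"
text \<open>\<open>U_crit\<close> in normalised variables. One \<open>\<sigma>\<^sup>2 * w k\<close>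
  removes the noise energy from the squared coefficient, the other is the variance penalty, so that
  for vanishing \<open>\<delta>\<close> this estimates \<open>Q N\<close> up to an additive
  constant.\<close>

definition U :: "(int \<Rightarrow> complex) \<Rightarrow> (int \<Rightarrow> complex) \<Rightarrow> nat \<Rightarrow> real" where
  "U \<delta> \<xi> N = - S (\<lambda>k. (cmod (X \<delta> \<xi> k))\<^sup>2 - 2 * \<sigma>\<^sup>2 * w k) N"
definition D :: "nat \<Rightarrow> nat \<Rightarrow> int set" where "D a b = I b - I a"

lemma w_pos: "w k > 0" using \<Gamma>_nz by (simp add: w_def)

lemma finite_I [simp]: "finite (I N)" by (simp add: I_def)
lemma finite_D [simp]: "finite (D a b)" by (simp add: D_def)
lemma I_mono: "a \<le> b \<Longrightarrow> I a \<subseteq> I b" by (auto simp: I_def)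

lemma S_mono: "a \<le> b \<Longrightarrow> (\<And>k. 0 \<le> u k) \<Longrightarrow> S u a \<le> S u b"
  unfolding S_def by (intro sum_mono2 I_mono) auto

lemma S_add: "S (\<lambda>k. u k + v k) N = S u N + S v N" by (simp add: S_def sum.distrib)
lemma S_diff: "S (\<lambda>k. u k - v k) N = S u N - S v N" by (simp add: S_def sum_subtractf)
lemma S_cmult: "S (\<lambda>k. c * u k) N = c * S u N" by (simp add: S_def sum_distrib_left)

lemma S_Diff: "a \<le> b \<Longrightarrow> S u b - S u a = (\<Sum>k\<in>D a b. u k)"
  unfolding S_def D_def using I_mono[of a b] by (simp add: sum_diff)

text \<open>The random cut-off may lie on either side of the fixed one; an absolute bound on the
  terms handles both orders at once.\<close>

lemma S_increment_le:
  assumes "\<And>k. k \<in> I (max N N') \<Longrightarrow> \<bar>u k\<bar> \<le> v k"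
  shows "S u N - S u N' \<le> (\<Sum>k\<in>D (min N N') (max N N'). v k)"
proof -
  have b: "\<bar>u k\<bar> \<le> v k" if "k \<in> D (min N N') (max N N')" for k using assms that by (auto simp: D_def)
  show ?thesis
  proof (cases "N' \<le> N")
    case True
    hence "S u N - S u N' = (\<Sum>k\<in>D (min N N') (max N N'). u k)" by (simp add: S_Diff max_def min_def)
    also have "\<dots> \<le> (\<Sum>k\<in>D (min N N') (max N N'). v k)" using b by (intro sum_mono) force
    finally show ?thesis .
  next
    case False
    hence "S u N - S u N' = - (\<Sum>k\<in>D (min N N') (max N N'). u k)" using S_Diff[of N N' u] by (simp add: max_def min_def)
    also have "\<dots> \<le> (\<Sum>k\<in>D (min N N') (max N N'). v k)"
      unfolding sum_negf[symmetric] using b by (intro sum_mono) force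
    finally show ?thesis .
  qed
qed

lemma B_nonneg: "0 \<le> B N" unfolding B_def by (rule infsum_nonneg) simp

lemma \<theta>_summable_on: "(\<lambda>k. (cmod (\<theta> k))\<^sup>2) summable_on A"
  using \<theta>_summable by (rule summable_on_subset_banach) simp

lemma B_S: "B N + S (\<lambda>k. (cmod (\<theta> k))\<^sup>2) N = (\<Sum>\<^sub>\<infinity>k. (cmod (\<theta> k))\<^sup>2)"
proof -
  have "(\<Sum>\<^sub>\<infinity>k\<in>{k. \<bar>k\<bar> > int N} \<union> I N. (cmod (\<theta> k))\<^sup>2) = B N + (\<Sum>\<^sub>\<infinity>k\<in>I N. (cmod (\<theta> k))\<^sup>2)"
    unfolding B_def by (rule infsum_Un_disjoint) (auto simp: \<theta>_summable_on I_def)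
  moreover have "{k. \<bar>k\<bar> > int N} \<union> I N = UNIV" by (auto simp: I_def)
  ultimately show ?thesis by (simp add: S_def)
qed

lemma D_sum_le_B: "a \<le> b \<Longrightarrow> (\<Sum>k\<in>D a b. (cmod (\<theta> k))\<^sup>2) \<le> B a"
  using S_Diff[of a b "\<lambda>k. (cmod (\<theta> k))\<^sup>2"] B_S[of a] B_S[of b] B_nonneg[of b] by simp

lemma W_pos: "0 < W N"
  unfolding W_def S_def by (rule sum_pos) (auto simp: w_pos I_def)

lemma W_mono: "a \<le> b \<Longrightarrow> W a \<le> W b"
  unfolding W_def by (rule S_mono) (auto simp: w_pos less_imp_le)

lemma Q_nonneg: "0 \<le> Q N"
  using B_nonneg[of N] W_pos[of N] by (simp add: Q_def)

lemma H_eq: "H \<xi> N = W N + G \<xi> N"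
  by (simp add: H_def W_def G_def S_add[symmetric] algebra_simps)

lemma H_nonneg: "0 \<le> H \<xi> N"
  unfolding H_def S_def by (intro sum_nonneg mult_nonneg_nonneg) (auto simp: w_pos less_imp_le)

lemma H_mono: "a \<le> b \<Longrightarrow> H \<xi> a \<le> H \<xi> b"
  unfolding H_def by (rule S_mono) (auto simp: w_pos less_imp_le)

lemma Loss_nonneg: "0 \<le> Loss \<delta> \<xi> N"
  unfolding Loss_def S_def using B_nonneg[of N] by (simp add: sum_nonneg)

lemma norm_noise: "(cmod (of_real \<sigma> * \<xi> k / \<Gamma> k))\<^sup>2 = \<sigma>\<^sup>2 * (w k * (cmod (\<xi> k))\<^sup>2)"
  by (simp add: w_def norm_mult norm_divide power_mult_distrib power_divide)

lemma norm_noise': "(cmod (of_real \<sigma> * \<xi> k / \<Gamma> k))\<^sup>2 = \<sigma>\<^sup>2 * w k + \<sigma>\<^sup>2 * (w k * ((cmod (\<xi> k))\<^sup>2 - 1))"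
  by (simp add: norm_noise algebra_simps)

text \<open>Minimality is used twice: for the loss, and for \<open>Q N\<close> itself, which enters
  the first estimate with the small factor \<open>\<eta>\<close> and has to be absorbed.
  \<open>S1\<close> and \<open>S2\<close> stand for the excess of linear and quadratic noise over
  \<open>\<eta>\<close> times bias and variance. \<open>G \<xi> N'\<close> keeps an exact
  deterministic coefficient, because at a fixed cut-off it vanishes in expectation;
  \<open>G \<xi> N\<close> at the random cut-off is only bounded.\<close>

lemma pathwise_fine:
  assumes \<eta>: "0 \<le> \<eta>" "\<eta> \<le> 1 / 12" and \<delta>: "\<And>k. k \<in> I m \<Longrightarrow> cmod (\<delta> k) \<le> \<eta>"
    and N: "N \<le> m" "N' \<le> m" and min: "U \<delta> \<xi> N \<le> U \<delta> \<xi> N'"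
    and S1: "Zl \<xi> N - Zl \<xi> N' \<le> \<eta> * B (min N N') + \<eta> * \<sigma>\<^sup>2 * W (max N N') + S1" "0 \<le> S1"
    and S2: "\<And>N. N \<le> m \<Longrightarrow> G \<xi> N \<le> \<eta> * W N + S2" "0 \<le> S2"
  shows "Loss \<delta> \<xi> N \<le> Loss \<delta> \<xi> N' + 32 * \<eta> * Q N' + 5 * S1 + 7 * \<sigma>\<^sup>2 * S2
    - (2 + 8 * \<eta> / (1 - 6 * \<eta>)) * \<sigma>\<^sup>2 * G \<xi> N'"
proof -
  define a b where "a = min N N'" and "b = max N N'"
  have ab: "a \<le> b" "b \<le> m" "N \<le> b" "N' \<le> b" using N by (auto simp: a_def b_def)
  define e where "e k = of_real \<sigma> * \<xi> k / \<Gamma> k" for k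
  define \<Delta> where "\<Delta> u = S u N - S u N'" for u
  have \<Delta>_add: "\<Delta> (\<lambda>k. u k + v k) = \<Delta> u + \<Delta> v" for u v by (simp add: \<Delta>_def S_add)
  have \<Delta>_diff: "\<Delta> (\<lambda>k. u k - v k) = \<Delta> u - \<Delta> v" for u v by (simp add: \<Delta>_def S_diff)
  have \<Delta>_cmult: "\<Delta> (\<lambda>k. c * u k) = c * \<Delta> u" for c u by (simp add: \<Delta>_def S_cmult algebra_simps)
  define t where "t k = (cmod (\<theta> k))\<^sup>2" for k
  define d2 where "d2 k = (cmod (\<theta> k * \<delta> k))\<^sup>2" for k
  define r where "r k = t k * Re (\<delta> k)" for k
  define cr where "cr k = 2 * Re (\<theta> k * \<delta> k * cnj (e k))" for k
  define z where "z k = Re (e k * cnj (\<theta> k))" for k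
  define g where "g k = w k * ((cmod (\<xi> k))\<^sup>2 - 1)" for k
  have e2: "(cmod (e k))\<^sup>2 = \<sigma>\<^sup>2 * w k + \<sigma>\<^sup>2 * g k" for k by (simp add: e_def g_def norm_noise')
  have X_\<theta>: "(cmod (X \<delta> \<xi> k - \<theta> k))\<^sup>2 = d2 k + cr k + (\<sigma>\<^sup>2 * w k + \<sigma>\<^sup>2 * g k)" for k
  proof -
    have "X \<delta> \<xi> k - \<theta> k = \<theta> k * \<delta> k + e k" by (simp add: X_def e_def algebra_simps)
    thus ?thesis by (simp only: cmod_add_square d2_def cr_def e2)
  qed
  have X2: "(cmod (X \<delta> \<xi> k))\<^sup>2 = t k + 2 * r k + d2 k + cr k + 2 * z k + (\<sigma>\<^sup>2 * w k + \<sigma>\<^sup>2 * g k)" for k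
  proof -
    have "X \<delta> \<xi> k = \<theta> k + (\<theta> k * \<delta> k + e k)" by (simp add: X_def e_def algebra_simps)
    hence "(cmod (X \<delta> \<xi> k))\<^sup>2 = t k + 2 * Re (\<theta> k * cnj (\<theta> k * \<delta> k + e k)) + (d2 k + cr k + (\<sigma>\<^sup>2 * w k + \<sigma>\<^sup>2 * g k))"
      by (simp only: cmod_add_square d2_def cr_def e2 t_def)
    moreover have "Re (\<theta> k * cnj (\<theta> k * \<delta> k + e k)) = r k + z k"
      unfolding r_def z_def t_def cmod_power2 by (simp add: power2_eq_square algebra_simps)
    ultimately show ?thesis by simp
  qed
  have t0: "t k \<ge> 0" for k by (simp add: t_def)
  have \<delta>b: "cmod (\<delta> k) \<le> \<eta>" if "k \<in> I b" for k using \<delta> that I_mono[OF ab(2)] by auto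
  have r_le: "\<bar>r k\<bar> \<le> \<eta> * t k" if "k \<in> I b" for k
  proof -
    have "\<bar>Re (\<delta> k)\<bar> \<le> \<eta>" using abs_Re_le_cmod[of "\<delta> k"] \<delta>b[OF that] by linarith
    thus ?thesis unfolding r_def abs_mult using t0[of k] by (simp add: mult.commute[of "t k"] mult_right_mono)
  qed
  have d2_eq: "d2 k = t k * (cmod (\<delta> k))\<^sup>2" for k by (simp add: d2_def t_def norm_mult power_mult_distrib)
  have d2_le: "\<bar>d2 k\<bar> \<le> \<eta> * t k" if "k \<in> I b" for k
  proof -
    have "(cmod (\<delta> k))\<^sup>2 \<le> \<eta>\<^sup>2" using \<delta>b[OF that] by (intro power_mono) auto
    also have "\<dots> \<le> \<eta>" using \<eta> by (simp add: power2_eq_square mult_left_le)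
    finally show ?thesis unfolding d2_eq using t0[of k] by (simp add: abs_mult mult.commute[of "t k"] mult_right_mono)
  qed
  have cr_le: "\<bar>cr k\<bar> \<le> \<eta> * (t k + (cmod (e k))\<^sup>2)" if "k \<in> I b" for k
  proof -
    have "\<bar>cr k\<bar> \<le> 2 * (cmod (\<theta> k) * cmod (\<delta> k) * cmod (e k))"
      unfolding cr_def using abs_Re_le_cmod[of "\<theta> k * \<delta> k * cnj (e k)"] by (simp add: norm_mult)
    also have "\<dots> = cmod (\<delta> k) * (2 * cmod (\<theta> k) * cmod (e k))" by simp
    also have "\<dots> \<le> \<eta> * (t k + (cmod (e k))\<^sup>2)"
      unfolding t_def using \<delta>b[OF that] \<eta>(1) by (intro mult_mono sum_squares_bound) auto
    finally show ?thesis .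
  qed
  have sumD_t: "(\<Sum>k\<in>D a b. t k) \<le> B a" unfolding t_def using ab(1) by (rule D_sum_le_B)
  have Gb: "G \<xi> b \<le> W b + S2"
  proof -
    have "\<eta> * W b \<le> 1 * W b" using \<eta> W_pos[of b] by (intro mult_right_mono) auto
    thus ?thesis using S2(1)[OF ab(2)] by linarith
  qed
  have sumD_e: "(\<Sum>k\<in>D a b. (cmod (e k))\<^sup>2) \<le> \<sigma>\<^sup>2 * (2 * W b + S2)"
  proof -
    have "(\<Sum>k\<in>D a b. (cmod (e k))\<^sup>2) \<le> (\<Sum>k\<in>I b. (cmod (e k))\<^sup>2)"
      by (intro sum_mono2) (auto simp: D_def)
    also have "\<dots> = \<sigma>\<^sup>2 * (W b + G \<xi> b)"
      by (simp add: e2 sum.distrib sum_distrib_left[symmetric] W_def G_def S_def g_def distrib_left)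
    finally show ?thesis using Gb \<sigma> by (auto intro: order_trans mult_left_mono)
  qed
  have \<Delta>_le: "\<Delta> u \<le> (\<Sum>k\<in>D a b. v k)" if "\<And>k. k \<in> I b \<Longrightarrow> \<bar>u k\<bar> \<le> v k" for u v
    unfolding \<Delta>_def a_def b_def using that by (intro S_increment_le) (simp add: b_def)
  have bt: "(\<Sum>k\<in>D a b. \<eta> * t k) \<le> \<eta> * B a"
    unfolding sum_distrib_left[symmetric] using sumD_t \<eta> by (intro mult_left_mono) auto
  have be: "(\<Sum>k\<in>D a b. \<eta> * (t k + (cmod (e k))\<^sup>2)) \<le> \<eta> * (B a + \<sigma>\<^sup>2 * (2 * W b + S2))"
    unfolding sum_distrib_left[symmetric] sum.distrib using sumD_t sumD_e \<eta> by (intro mult_left_mono add_mono) auto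
  have \<Delta>d2: "\<Delta> d2 \<le> \<eta> * B a" using \<Delta>_le[of d2 "\<lambda>k. \<eta> * t k"] d2_le bt by fastforce
  have \<Delta>r: "\<Delta> r \<le> \<eta> * B a" using \<Delta>_le[of r "\<lambda>k. \<eta> * t k"] r_le bt by fastforce
  have \<Delta>cr: "\<Delta> cr \<le> \<eta> * (B a + \<sigma>\<^sup>2 * (2 * W b + S2))"
    using \<Delta>_le[of cr "\<lambda>k. \<eta> * (t k + (cmod (e k))\<^sup>2)"] cr_le be by fastforce
  have \<Delta>z: "\<Delta> z \<le> \<eta> * B a + \<eta> * \<sigma>\<^sup>2 * W b + S1"
    using S1(1) by (simp add: \<Delta>_def Zl_def z_def[abs_def] e_def a_def b_def)
  have \<Delta>g: "\<Delta> g \<le> \<eta> * W b + S2 - G \<xi> N'"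
  proof -
    have "G \<xi> N \<le> \<eta> * W b + S2" using S2(1)[OF N(1)] mult_left_mono[OF W_mono[OF ab(3)] \<eta>(1)] by simp
    thus ?thesis by (simp add: \<Delta>_def G_def g_def[abs_def])
  qed
  have \<Delta>U: "0 \<le> \<Delta> (\<lambda>k. (cmod (X \<delta> \<xi> k))\<^sup>2 - 2 * \<sigma>\<^sup>2 * w k)"
    using min by (simp add: U_def \<Delta>_def)
  have \<Delta>B: "B N - B N' = - \<Delta> t" using B_S[of N] B_S[of N'] by (simp add: \<Delta>_def t_def[abs_def])
  have \<Delta>W: "W N - W N' = \<Delta> w" by (simp add: \<Delta>_def W_def)
  have U_expand: "0 \<le> \<Delta> t + 2 * \<Delta> r + \<Delta> d2 + \<Delta> cr + 2 * \<Delta> z + (\<sigma>\<^sup>2 * \<Delta> w + \<sigma>\<^sup>2 * \<Delta> g) - 2 * \<sigma>\<^sup>2 * \<Delta> w"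
    using \<Delta>U unfolding X2 \<Delta>_add \<Delta>_diff \<Delta>_cmult .
  have L_expand: "Loss \<delta> \<xi> N - Loss \<delta> \<xi> N' = - \<Delta> t + \<Delta> d2 + \<Delta> cr + (\<sigma>\<^sup>2 * \<Delta> w + \<sigma>\<^sup>2 * \<Delta> g)"
  proof -
    have "Loss \<delta> \<xi> N - Loss \<delta> \<xi> N' = - \<Delta> t + \<Delta> (\<lambda>k. (cmod (X \<delta> \<xi> k - \<theta> k))\<^sup>2)"
      using \<Delta>B by (simp add: Loss_def \<Delta>_def)
    thus ?thesis unfolding X_\<theta> \<Delta>_add \<Delta>_cmult by simp
  qed
  have \<sigma>2: "\<sigma>\<^sup>2 \<ge> 0" by simp
  \<comment> \<open>The smaller cut-off has the larger bias and the larger cut-off the larger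
    variance, so \<open>P\<close> controls every increment and is itself at most
    \<open>Q N + Q N'\<close>.\<close>
  define P where "P = B a + \<sigma>\<^sup>2 * W b"
  have P: "P \<le> Q N + Q N'"
  proof -
    have "B a \<le> B N + B N'" using B_nonneg[of N] B_nonneg[of N'] by (auto simp: a_def min_def)
    moreover have "\<sigma>\<^sup>2 * W b \<le> \<sigma>\<^sup>2 * (W N + W N')"
      using W_pos[of N] W_pos[of N'] by (intro mult_left_mono) (auto simp: b_def max_def)
    ultimately show ?thesis by (simp add: P_def Q_def algebra_simps)
  qed
  have \<sigma>W: "0 \<le> \<eta> * (\<sigma>\<^sup>2 * W b)" using \<eta> W_pos[of b] by simp
  have \<eta>S2: "\<eta> * (\<sigma>\<^sup>2 * S2) \<le> \<sigma>\<^sup>2 * S2"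
  proof -
    have "\<eta> * (\<sigma>\<^sup>2 * S2) \<le> 1 * (\<sigma>\<^sup>2 * S2)" using \<eta> S2(2) by (intro mult_right_mono) auto
    thus ?thesis by simp
  qed
  have \<sigma>\<Delta>g: "\<sigma>\<^sup>2 * \<Delta> g \<le> \<eta> * (\<sigma>\<^sup>2 * W b) + \<sigma>\<^sup>2 * S2 - \<sigma>\<^sup>2 * G \<xi> N'"
    using mult_left_mono[OF \<Delta>g \<sigma>2] by (simp add: algebra_simps)
  have \<Delta>cr': "\<Delta> cr \<le> \<eta> * B a + 2 * (\<eta> * (\<sigma>\<^sup>2 * W b)) + \<eta> * (\<sigma>\<^sup>2 * S2)"
    using \<Delta>cr by (simp add: algebra_simps)
  have \<Delta>z': "\<Delta> z \<le> \<eta> * B a + \<eta> * (\<sigma>\<^sup>2 * W b) + S1" using \<Delta>z by (simp add: mult.assoc)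
  have \<eta>P: "\<eta> * P = \<eta> * B a + \<eta> * (\<sigma>\<^sup>2 * W b)" by (simp add: P_def distrib_left)
  \<comment> \<open>The sum of \<open>L_expand\<close> and \<open>U_expand\<close> contains neither
    \<open>\<Delta> t\<close> nor \<open>\<Delta> w\<close>; what remains is twice \<open>\<Delta> r
    + \<Delta> d2 + \<Delta> cr + \<Delta> z + \<sigma>\<^sup>2 * \<Delta> g\<close>.\<close>
  have L1: "Loss \<delta> \<xi> N - Loss \<delta> \<xi> N' \<le> 8 * (\<eta> * P) + 2 * S1 + 4 * (\<sigma>\<^sup>2 * S2) - 2 * (\<sigma>\<^sup>2 * G \<xi> N')"
    using L_expand U_expand \<Delta>d2 \<Delta>r \<Delta>cr' \<Delta>z' \<sigma>\<Delta>g \<eta>S2 \<sigma>W \<eta>P by linarith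
  have Q_expand: "Q N - Q N' = - \<Delta> t + \<sigma>\<^sup>2 * \<Delta> w"
    using \<Delta>B by (simp add: Q_def \<Delta>W[symmetric] algebra_simps)
  have Q1: "Q N - Q N' \<le> 6 * (\<eta> * P) + 2 * S1 + 2 * (\<sigma>\<^sup>2 * S2) - \<sigma>\<^sup>2 * G \<xi> N'"
    using Q_expand U_expand \<Delta>d2 \<Delta>r \<Delta>cr' \<Delta>z' \<sigma>\<Delta>g \<eta>S2 \<sigma>W \<eta>P by linarith
  \<comment> \<open>The factor that arises from moving \<open>6 * \<eta> * Q N\<close> to the
    left-hand side; \<open>\<eta> \<le> 1 / 12\<close> keeps it at most 2.\<close>
  define \<kappa> where "\<kappa> = 1 / (1 - 6 * \<eta>)"
  have \<kappa>: "1 \<le> \<kappa>" "\<kappa> \<le> 2" "\<kappa> * (1 - 6 * \<eta>) = 1" using \<eta> by (auto simp: \<kappa>_def field_simps)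
  have \<eta>P2: "\<eta> * P \<le> \<eta> * Q N + \<eta> * Q N'" using mult_left_mono[OF P \<eta>(1)] by (simp add: distrib_left)
  have "(1 - 6 * \<eta>) * Q N \<le> (1 + 6 * \<eta>) * Q N' + 2 * S1 + 2 * (\<sigma>\<^sup>2 * S2) - \<sigma>\<^sup>2 * G \<xi> N'"
    using Q1 \<eta>P2 by (simp add: algebra_simps)
  hence "\<kappa> * ((1 - 6 * \<eta>) * Q N) \<le> \<kappa> * ((1 + 6 * \<eta>) * Q N' + 2 * S1 + 2 * (\<sigma>\<^sup>2 * S2) - \<sigma>\<^sup>2 * G \<xi> N')"
    using \<kappa> by (intro mult_left_mono) auto
  hence QN: "Q N \<le> (\<kappa> * (1 + 6 * \<eta>)) * Q N' + \<kappa> * (2 * S1 + 2 * (\<sigma>\<^sup>2 * S2)) - \<kappa> * (\<sigma>\<^sup>2 * G \<xi> N')"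
    unfolding mult.assoc[symmetric] \<kappa>(3) by (simp add: algebra_simps)
  have "\<kappa> * (1 + 6 * \<eta>) \<le> 3" using \<eta> by (simp add: \<kappa>_def field_simps)
  hence "(\<kappa> * (1 + 6 * \<eta>)) * Q N' \<le> 3 * Q N'" using Q_nonneg by (intro mult_right_mono) auto
  moreover have "\<kappa> * (2 * S1 + 2 * (\<sigma>\<^sup>2 * S2)) \<le> 2 * (2 * S1 + 2 * (\<sigma>\<^sup>2 * S2))"
    using \<kappa> S1 S2 by (intro mult_right_mono) auto
  moreover have "x \<le> p + q - r \<Longrightarrow> p \<le> 3 * y \<Longrightarrow> q \<le> 2 * (2 * u + 2 * v) \<Longrightarrow> x \<le> 3 * y + 4 * u + 4 * v - r"
    for x p q r y u v :: real by argo
  ultimately have "Q N \<le> 3 * Q N' + 4 * S1 + 4 * (\<sigma>\<^sup>2 * S2) - \<kappa> * (\<sigma>\<^sup>2 * G \<xi> N')" using QN by blast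
  hence "\<eta> * Q N \<le> \<eta> * (3 * Q N' + 4 * S1 + 4 * (\<sigma>\<^sup>2 * S2) - \<kappa> * (\<sigma>\<^sup>2 * G \<xi> N'))"
    using \<eta> by (intro mult_left_mono)
  hence \<eta>Q: "\<eta> * Q N \<le> 3 * (\<eta> * Q N') + 4 * (\<eta> * S1) + 4 * (\<eta> * (\<sigma>\<^sup>2 * S2)) - \<eta> * (\<kappa> * (\<sigma>\<^sup>2 * G \<xi> N'))"
    by (simp add: algebra_simps)
  have "\<eta> * S1 \<le> 1 / 12 * S1" by (rule mult_right_mono[OF \<eta>(2) S1(2)])
  moreover have "\<eta> * (\<sigma>\<^sup>2 * S2) \<le> 1 / 12 * (\<sigma>\<^sup>2 * S2)"
    by (rule mult_right_mono[OF \<eta>(2) mult_nonneg_nonneg[OF \<sigma>2 S2(2)]])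
  \<comment> \<open>The coefficient 32 is \<open>8 + 8 * 3\<close>; for \<open>S1\<close> and
    \<open>S2\<close> the bounds are \<open>2 + 32 / 12 \<le> 5\<close> and
    \<open>4 + 32 / 12 \<le> 7\<close>.\<close>
  ultimately have "Loss \<delta> \<xi> N - Loss \<delta> \<xi> N' \<le> 32 * (\<eta> * Q N') + 5 * S1 + 7 * (\<sigma>\<^sup>2 * S2)
    - 2 * (\<sigma>\<^sup>2 * G \<xi> N') - 8 * (\<eta> * (\<kappa> * (\<sigma>\<^sup>2 * G \<xi> N')))"
    using L1 \<eta>P2 \<eta>Q S1(2) S2(2) \<sigma>2 mult_nonneg_nonneg[OF \<sigma>2 S2(2)] by linarith
  moreover have "(2 + 8 * \<eta> / (1 - 6 * \<eta>)) * \<sigma>\<^sup>2 * G \<xi> N' = 2 * (\<sigma>\<^sup>2 * G \<xi> N') + 8 * (\<eta> * (\<kappa> * (\<sigma>\<^sup>2 * G \<xi> N')))"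
    by (simp add: \<kappa>_def algebra_simps)
  ultimately show ?thesis by simp
qed

text \<open>If the random cut-off is the larger one, an extra frequency costs only noise, because
  \<open>\<delta>\<close> is too small for the shift error to exceed the bias removed. If it is the
  smaller one, minimality bounds the observed energy of the skipped frequencies by
  \<open>2 * \<sigma>\<^sup>2\<close> times their weights, and the signal energy is at most 6 times
  observed plus noise energy. The price is the whole variance up to \<open>m\<close>.\<close>

lemma pathwise_crude:
  assumes \<delta>: "\<And>k. k \<in> I m \<Longrightarrow> cmod (\<delta> k) \<le> 1 / 4"
    and N: "N \<le> m" "N' \<le> m" and min: "U \<delta> \<xi> N \<le> U \<delta> \<xi> N'"
  shows "Loss \<delta> \<xi> N \<le> Loss \<delta> \<xi> N' + 12 * \<sigma>\<^sup>2 * (W m + H \<xi> m)"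
proof -
  define e where "e k = of_real \<sigma> * \<xi> k / \<Gamma> k" for k
  define t where "t k = (cmod (\<theta> k))\<^sup>2" for k
  have e2: "(cmod (e k))\<^sup>2 = \<sigma>\<^sup>2 * (w k * (cmod (\<xi> k))\<^sup>2)" for k by (simp add: e_def norm_noise)
  have X_\<theta>: "X \<delta> \<xi> k - \<theta> k = \<theta> k * \<delta> k + e k" for k by (simp add: X_def e_def algebra_simps)
  have d2: "(cmod (\<theta> k * \<delta> k))\<^sup>2 \<le> t k / 16" if "k \<in> I m" for k
  proof -
    have "(cmod (\<delta> k))\<^sup>2 \<le> (1 / 4)\<^sup>2" using \<delta>[OF that] by (intro power_mono) auto
    hence "t k * (cmod (\<delta> k))\<^sup>2 \<le> t k * (1 / 16)" by (intro mult_left_mono) (auto simp: t_def power2_eq_square)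
    thus ?thesis by (simp add: t_def norm_mult power_mult_distrib)
  qed
  have le1: "(cmod (X \<delta> \<xi> k - \<theta> k))\<^sup>2 - t k \<le> 2 * (cmod (e k))\<^sup>2" if "k \<in> I m" for k
  proof -
    have "Y \<le> 2 * P + 2 * E \<Longrightarrow> P \<le> u / 16 \<Longrightarrow> 0 \<le> u \<Longrightarrow> Y - u \<le> 2 * E" for Y P E u :: real by linarith
    from this[OF cmod_add_square_le d2[OF that]] show ?thesis unfolding X_\<theta> by (simp add: t_def)
  qed
  \<comment> \<open>The signal is the observed coefficient minus an error that returns a quarter of
    \<open>t k\<close>. Absorbing it leaves the factors \<open>8 / 3\<close> and
    \<open>16 / 3\<close>, both below 6.\<close>
  have le2: "t k \<le> 6 * ((cmod (X \<delta> \<xi> k))\<^sup>2 + (cmod (e k))\<^sup>2)" if "k \<in> I m" for k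
  proof -
    have "(cmod (\<theta> k))\<^sup>2 = (cmod (X \<delta> \<xi> k + - (\<theta> k * \<delta> k + e k)))\<^sup>2" using X_\<theta>[of k] by (simp add: algebra_simps)
    also have "\<dots> \<le> 2 * (cmod (X \<delta> \<xi> k))\<^sup>2 + 2 * (cmod (\<theta> k * \<delta> k + e k))\<^sup>2"
      using cmod_add_square_le[of "X \<delta> \<xi> k" "- (\<theta> k * \<delta> k + e k)"] by (simp only: norm_minus_cancel)
    also have "\<dots> \<le> 2 * (cmod (X \<delta> \<xi> k))\<^sup>2 + 2 * (2 * (t k / 16) + 2 * (cmod (e k))\<^sup>2)"
    proof (intro add_left_mono mult_left_mono)
      have "(cmod (\<theta> k * \<delta> k + e k))\<^sup>2 \<le> 2 * (cmod (\<theta> k * \<delta> k))\<^sup>2 + 2 * (cmod (e k))\<^sup>2" by (rule cmod_add_square_le)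
      also have "\<dots> \<le> 2 * (t k / 16) + 2 * (cmod (e k))\<^sup>2"
        using d2[OF that] by (intro add_right_mono mult_left_mono) auto
      finally show "(cmod (\<theta> k * \<delta> k + e k))\<^sup>2 \<le> 2 * (t k / 16) + 2 * (cmod (e k))\<^sup>2" .
    qed simp
    finally have "t k \<le> 2 * (cmod (X \<delta> \<xi> k))\<^sup>2 + 2 * (2 * (t k / 16) + 2 * (cmod (e k))\<^sup>2)" by (simp add: t_def)
    thus ?thesis using zero_le_power2[of "cmod (X \<delta> \<xi> k)"] zero_le_power2[of "cmod (e k)"] by argo
  qed
  have He: "S (\<lambda>k. (cmod (e k))\<^sup>2) m = \<sigma>\<^sup>2 * H \<xi> m" by (simp add: e2 H_def S_cmult)
  have De: "(\<Sum>k\<in>D a b. (cmod (e k))\<^sup>2) \<le> \<sigma>\<^sup>2 * H \<xi> m" if "b \<le> m" for a b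
    unfolding He[symmetric] S_def using I_mono[OF that] by (intro sum_mono2) (auto simp: D_def)
  have DI: "D a b \<subseteq> I m" if "b \<le> m" for a b using I_mono[OF that] by (auto simp: D_def)
  have L: "Loss \<delta> \<xi> N - Loss \<delta> \<xi> N' = S (\<lambda>k. (cmod (X \<delta> \<xi> k - \<theta> k))\<^sup>2 - t k) N - S (\<lambda>k. (cmod (X \<delta> \<xi> k - \<theta> k))\<^sup>2 - t k) N'"
    using B_S[of N] B_S[of N'] by (simp add: Loss_def S_diff t_def[abs_def])
  have WH: "0 \<le> \<sigma>\<^sup>2 * W m" "0 \<le> \<sigma>\<^sup>2 * H \<xi> m" using W_pos[of m] H_nonneg[of \<xi> m] by auto
  show ?thesis
  proof (cases "N' \<le> N")
    case True
    have "Loss \<delta> \<xi> N - Loss \<delta> \<xi> N' = (\<Sum>k\<in>D N' N. (cmod (X \<delta> \<xi> k - \<theta> k))\<^sup>2 - t k)"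
      unfolding L using True by (rule S_Diff)
    also have "\<dots> \<le> (\<Sum>k\<in>D N' N. 2 * (cmod (e k))\<^sup>2)" using le1 DI[OF N(1)] by (intro sum_mono) auto
    also have "\<dots> \<le> 2 * (\<sigma>\<^sup>2 * H \<xi> m)" using De[OF N(1)] by (simp add: sum_distrib_left[symmetric])
    finally show ?thesis using WH by (simp add: distrib_left)
  next
    case False
    hence le: "N \<le> N'" by simp
    have "Loss \<delta> \<xi> N - Loss \<delta> \<xi> N' = - (\<Sum>k\<in>D N N'. (cmod (X \<delta> \<xi> k - \<theta> k))\<^sup>2 - t k)"
      unfolding L using S_Diff[OF le, of "\<lambda>k. (cmod (X \<delta> \<xi> k - \<theta> k))\<^sup>2 - t k"] by simp
    also have "\<dots> \<le> (\<Sum>k\<in>D N N'. t k)" unfolding sum_negf[symmetric] by (intro sum_mono) simp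
    also have "\<dots> \<le> (\<Sum>k\<in>D N N'. 6 * ((cmod (X \<delta> \<xi> k))\<^sup>2 + (cmod (e k))\<^sup>2))"
      using le2 DI[OF N(2)] by (intro sum_mono) auto
    also have "\<dots> = 6 * (\<Sum>k\<in>D N N'. (cmod (X \<delta> \<xi> k))\<^sup>2) + 6 * (\<Sum>k\<in>D N N'. (cmod (e k))\<^sup>2)"
      by (simp add: sum.distrib sum_distrib_left)
    also have "(\<Sum>k\<in>D N N'. (cmod (X \<delta> \<xi> k))\<^sup>2) \<le> (\<Sum>k\<in>D N N'. 2 * \<sigma>\<^sup>2 * w k)"
      using min S_Diff[OF le, of "\<lambda>k. (cmod (X \<delta> \<xi> k))\<^sup>2 - 2 * \<sigma>\<^sup>2 * w k"] by (simp add: U_def sum_subtractf)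
    also have "\<dots> \<le> S (\<lambda>k. 2 * \<sigma>\<^sup>2 * w k) m"
      unfolding S_def using DI[OF N(2)] by (intro sum_mono2) (auto simp: w_pos less_imp_le)
    also have "\<dots> = 2 * \<sigma>\<^sup>2 * W m" by (simp only: S_cmult W_def)
    finally show ?thesis using De[OF N(2), of N] WH by (simp add: distrib_left)
  qed
qed

text \<open>Meant for the exceptional event, where only the deterministic bound on
  \<open>\<delta>\<close> through the largest weight is available.\<close>

lemma Loss_bound:
  assumes \<delta>: "\<And>k. k \<in> I m \<Longrightarrow> (cmod (\<delta> k))\<^sup>2 \<le> 4 * wb" and N: "N \<le> m" and "0 \<le> wb"
  shows "Loss \<delta> \<xi> N \<le> (1 + 8 * wb) * (\<Sum>\<^sub>\<infinity>k. (cmod (\<theta> k))\<^sup>2) + 2 * \<sigma>\<^sup>2 * H \<xi> m"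
proof -
  have "S (\<lambda>k. (cmod (X \<delta> \<xi> k - \<theta> k))\<^sup>2) N \<le> S (\<lambda>k. 8 * wb * (cmod (\<theta> k))\<^sup>2 + 2 * \<sigma>\<^sup>2 * (w k * (cmod (\<xi> k))\<^sup>2)) N"
    unfolding S_def
  proof (rule sum_mono)
    fix k assume "k \<in> I N"
    hence k: "k \<in> I m" using I_mono[OF N] by auto
    have "X \<delta> \<xi> k - \<theta> k = \<theta> k * \<delta> k + of_real \<sigma> * \<xi> k / \<Gamma> k" by (simp add: X_def algebra_simps)
    hence "(cmod (X \<delta> \<xi> k - \<theta> k))\<^sup>2 \<le> 2 * (cmod (\<theta> k * \<delta> k))\<^sup>2 + 2 * (\<sigma>\<^sup>2 * (w k * (cmod (\<xi> k))\<^sup>2))"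
      using cmod_add_square_le[of "\<theta> k * \<delta> k" "of_real \<sigma> * \<xi> k / \<Gamma> k"] by (simp only: norm_noise)
    moreover have "(cmod (\<theta> k * \<delta> k))\<^sup>2 \<le> 4 * wb * (cmod (\<theta> k))\<^sup>2"
      using mult_left_mono[OF \<delta>[OF k], of "(cmod (\<theta> k))\<^sup>2"] by (simp add: norm_mult power_mult_distrib mult_ac)
    ultimately show "(cmod (X \<delta> \<xi> k - \<theta> k))\<^sup>2 \<le> 8 * wb * (cmod (\<theta> k))\<^sup>2 + 2 * \<sigma>\<^sup>2 * (w k * (cmod (\<xi> k))\<^sup>2)" by simp
  qed
  also have "\<dots> = 8 * wb * S (\<lambda>k. (cmod (\<theta> k))\<^sup>2) N + 2 * \<sigma>\<^sup>2 * H \<xi> N"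
    by (simp only: S_add S_cmult H_def)
  finally have 1: "S (\<lambda>k. (cmod (X \<delta> \<xi> k - \<theta> k))\<^sup>2) N \<le> 8 * wb * S (\<lambda>k. (cmod (\<theta> k))\<^sup>2) N + 2 * \<sigma>\<^sup>2 * H \<xi> N" .
  have St: "0 \<le> S (\<lambda>k. (cmod (\<theta> k))\<^sup>2) N" by (simp add: S_def sum_nonneg)
  have 2: "8 * wb * S (\<lambda>k. (cmod (\<theta> k))\<^sup>2) N \<le> 8 * wb * (\<Sum>\<^sub>\<infinity>k. (cmod (\<theta> k))\<^sup>2)"
    using B_S[of N] B_nonneg[of N] \<open>0 \<le> wb\<close> by (intro mult_left_mono) auto
  have 3: "2 * \<sigma>\<^sup>2 * H \<xi> N \<le> 2 * \<sigma>\<^sup>2 * H \<xi> m" using H_mono[OF N] by (intro mult_left_mono) auto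
  show ?thesis using 1 2 3 B_S[of N] St by (simp add: Loss_def distrib_right)
qed

end

section \<open>Oracle inequalities in expectation\<close>

lemma integrable_of_nn_bound:
  fixes f :: "'a \<Rightarrow> real"
  assumes "f \<in> borel_measurable M" "\<And>\<omega>. 0 \<le> f \<omega>" "(\<integral>\<^sup>+ \<omega>. ennreal (f \<omega>) \<partial>M) \<le> ennreal c" "0 \<le> c"
  shows "integrable M f" "(\<integral>\<omega>. f \<omega> \<partial>M) \<le> c"
proof -
  show i: "integrable M f" using assms by (intro integrableI_nonneg) (auto simp: le_less_trans)
  show "(\<integral>\<omega>. f \<omega> \<partial>M) \<le> c" using assms i by (subst (asm) nn_integral_eq_integral) auto
qed

text \<open>The interface between the curve model and the sequence-space argument.
  \<open>\<delta>_le\<close> is the deterministic bound for the exceptional event,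
  \<open>\<delta>_var\<close> produces the last term of the risk, and \<open>cross\<close> expresses
  the independence of shifts and noise.\<close>

locale noisy_cutoff = cutoff_setup \<theta> \<Gamma> \<sigma> + prob_space M
  for \<theta> \<Gamma> :: "int \<Rightarrow> complex" and \<sigma> :: real and M :: "'a measure" +
  fixes \<delta> \<xi> :: "int \<Rightarrow> 'a \<Rightarrow> complex" and n :: nat
  assumes \<Gamma>_sym: "cmod (\<Gamma> (- k)) = cmod (\<Gamma> k)"
    and \<delta>_meas [measurable]: "\<delta> k \<in> borel_measurable M"
    and \<xi>_meas [measurable]: "\<xi> k \<in> borel_measurable M"
    and gauss: "gaussian_sequence M (\<lambda>k \<omega>. Re (\<xi> k \<omega>) + Im (\<xi> k \<omega>))"
    and x2: "integrable M (\<lambda>\<omega>. (Re (\<xi> k \<omega>) + Im (\<xi> k \<omega>))\<^sup>2)"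
      "expectation (\<lambda>\<omega>. (Re (\<xi> k \<omega>) + Im (\<xi> k \<omega>))\<^sup>2) = 1"
    and \<xi>_sym: "AE \<omega> in M. \<forall>k. \<xi> (- k) \<omega> = cnj (\<xi> k \<omega>)"
    and \<delta>_le: "(cmod (\<delta> k \<omega>))\<^sup>2 \<le> 4 * (1 / (cmod (\<Gamma> k))\<^sup>2)"
    and \<delta>_var: "expectation (\<lambda>\<omega>. (cmod (\<delta> k \<omega>))\<^sup>2) \<le> (1 / (cmod (\<Gamma> k))\<^sup>2 - 1) / real n"
    and cross: "expectation (\<lambda>\<omega>. \<delta> k \<omega> * cnj (\<xi> k \<omega>)) = 0"
begin

text \<open>The Hartley coefficients of the noise are orthonormal over all of \<open>\<int>\<close>, whereas
  \<open>\<xi> (- k)\<close> is the conjugate of \<open>\<xi> k\<close>.\<close>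

definition x :: "int \<Rightarrow> 'a \<Rightarrow> real" where "x k \<omega> = Re (\<xi> k \<omega>) + Im (\<xi> k \<omega>)"

sublocale g: gaussian_sequence M x
  using gauss by (simp add: x_def[abs_def])

lemma w_sym: "w (- k) = w k" by (simp add: w_def \<Gamma>_sym)

lemma norm_\<xi>_x:
  assumes "\<forall>k. \<xi> (- k) \<omega> = cnj (\<xi> k \<omega>)"
  shows "(cmod (\<xi> k \<omega>))\<^sup>2 = ((x k \<omega>)\<^sup>2 + (x (- k) \<omega>)\<^sup>2) / 2"
  unfolding x_def using assms by (simp add: cmod_power2 power2_sum power2_diff)

lemma sum_I_uminus: "(\<Sum>k\<in>I N. u (- k)) = (\<Sum>k\<in>I N. u k)"
  by (rule sum.reindex_bij_witness[of _ uminus uminus]) (auto simp: I_def)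

lemma sum_D_uminus: "(\<Sum>k\<in>D a b. u (- k)) = (\<Sum>k\<in>D a b. u k)"
  by (rule sum.reindex_bij_witness[of _ uminus uminus]) (auto simp: D_def I_def)

text \<open>Weights and index sets are symmetric in \<open>k\<close>, so averaging over
  \<open>k\<close> and \<open>- k\<close> does not change the sum, and the complex noise may be
  replaced by its Hartley coefficients.\<close>

lemma sum_w_norm_\<xi>:
  assumes "\<forall>k. \<xi> (- k) \<omega> = cnj (\<xi> k \<omega>)"
  shows "G (\<lambda>k. \<xi> k \<omega>) N = (\<Sum>k\<in>I N. w k * ((x k \<omega>)\<^sup>2 - 1))"
proof -
  have "G (\<lambda>k. \<xi> k \<omega>) N = (\<Sum>k\<in>I N. w k * ((x k \<omega>)\<^sup>2 - 1) / 2 + w (- k) * ((x (- k) \<omega>)\<^sup>2 - 1) / 2)"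
    unfolding G_def S_def
    by (intro sum.cong refl) (simp add: norm_\<xi>_x[OF assms] w_sym field_simps)
  also have "\<dots> = (\<Sum>k\<in>I N. w k * ((x k \<omega>)\<^sup>2 - 1) / 2) + (\<Sum>k\<in>I N. w k * ((x k \<omega>)\<^sup>2 - 1) / 2)"
    unfolding sum.distrib by (simp only: sum_I_uminus[of "\<lambda>k. w k * ((x k \<omega>)\<^sup>2 - 1) / 2"])
  also have "\<dots> = (\<Sum>k\<in>I N. w k * ((x k \<omega>)\<^sup>2 - 1))" by (simp flip: sum.distrib)
  finally show ?thesis .
qed

text \<open>\<open>\<beta> k\<close> collects what \<open>A k\<close> and \<open>A (- k)\<close>
  contribute to \<open>x k\<close>. Passing to real coefficients does not increase the square sum,
  so variance bounds for \<open>A\<close> carry over to \<open>\<beta>\<close>.\<close>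

lemma sum_linear_\<xi>:
  fixes A :: "int \<Rightarrow> complex"
  defines "\<beta> \<equiv> (\<lambda>k. ((Re (A k) - Im (A k)) + (Re (A (- k)) + Im (A (- k)))) / 2)"
  shows "\<forall>k. \<xi> (- k) \<omega> = cnj (\<xi> k \<omega>) \<Longrightarrow> (\<Sum>k\<in>D a b. Re (A k * \<xi> k \<omega>)) = (\<Sum>k\<in>D a b. \<beta> k * x k \<omega>)"
    and "(\<Sum>k\<in>D a b. (\<beta> k)\<^sup>2) \<le> (\<Sum>k\<in>D a b. (cmod (A k))\<^sup>2)"
proof -
  assume sym: "\<forall>k. \<xi> (- k) \<omega> = cnj (\<xi> k \<omega>)"
  define u v where "u k = (Re (A k) - Im (A k)) / 2 * x k \<omega>" and "v k = (Re (A k) + Im (A k)) / 2 * x (- k) \<omega>" for k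
  have "Re (A k * \<xi> k \<omega>) = u k + v k" for k
  proof -
    have "Re (\<xi> k \<omega>) = (x k \<omega> + x (- k) \<omega>) / 2" "Im (\<xi> k \<omega>) = (x k \<omega> - x (- k) \<omega>) / 2"
      using sym by (simp_all add: x_def)
    thus ?thesis unfolding times_complex.sel u_def v_def by (simp only:) (simp add: field_simps)
  qed
  hence "(\<Sum>k\<in>D a b. Re (A k * \<xi> k \<omega>)) = (\<Sum>k\<in>D a b. u k) + (\<Sum>k\<in>D a b. v k)" by (simp add: sum.distrib)
  also have "(\<Sum>k\<in>D a b. v k) = (\<Sum>k\<in>D a b. v (- k))" by (simp add: sum_D_uminus)
  finally show "(\<Sum>k\<in>D a b. Re (A k * \<xi> k \<omega>)) = (\<Sum>k\<in>D a b. \<beta> k * x k \<omega>)"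
    by (simp add: u_def v_def \<beta>_def algebra_simps add_divide_distrib diff_divide_distrib flip: sum.distrib)
next
  define p q where "p k = (Re (A k) - Im (A k))\<^sup>2 / 2" and "q k = (Re (A k) + Im (A k))\<^sup>2 / 2" for k
  have le: "((y + z) / 2)\<^sup>2 \<le> y\<^sup>2 / 2 + z\<^sup>2 / 2" for y z :: real
    using sum_squares_bound[of y z] by (simp add: power_divide power2_sum)
  have "(\<Sum>k\<in>D a b. (\<beta> k)\<^sup>2) \<le> (\<Sum>k\<in>D a b. p k + q (- k))"
    unfolding \<beta>_def p_def q_def by (intro sum_mono le)
  also have "\<dots> = (\<Sum>k\<in>D a b. p k + q k)" by (simp add: sum.distrib sum_D_uminus)
  also have "\<dots> = (\<Sum>k\<in>D a b. (cmod (A k))\<^sup>2)"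
    unfolding p_def q_def by (intro sum.cong refl) (simp add: cmod_power2 power2_sum power2_diff, simp add: field_simps)
  finally show "(\<Sum>k\<in>D a b. (\<beta> k)\<^sup>2) \<le> (\<Sum>k\<in>D a b. (cmod (A k))\<^sup>2)" .
qed

lemma \<xi>_square:
  shows "integrable M (\<lambda>\<omega>. (cmod (\<xi> k \<omega>))\<^sup>2)" "expectation (\<lambda>\<omega>. (cmod (\<xi> k \<omega>))\<^sup>2) = 1"
proof -
  have ae: "AE \<omega> in M. ((x k \<omega>)\<^sup>2 + (x (- k) \<omega>)\<^sup>2) / 2 = (cmod (\<xi> k \<omega>))\<^sup>2"
    using \<xi>_sym by eventually_elim (rule norm_\<xi>_x[symmetric])
  have int: "integrable M (\<lambda>\<omega>. ((x k \<omega>)\<^sup>2 + (x (- k) \<omega>)\<^sup>2) / 2)"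
    using x2(1) unfolding x_def by auto
  show "integrable M (\<lambda>\<omega>. (cmod (\<xi> k \<omega>))\<^sup>2)"
    by (rule integrable_cong_AE_imp[OF int _ ae]) measurable
  have "expectation (\<lambda>\<omega>. (cmod (\<xi> k \<omega>))\<^sup>2) = expectation (\<lambda>\<omega>. ((x k \<omega>)\<^sup>2 + (x (- k) \<omega>)\<^sup>2) / 2)"
    by (rule integral_cong_AE[OF _ _ ae, symmetric]) measurable
  also have "\<dots> = 1" using x2 by (simp add: x_def)
  finally show "expectation (\<lambda>\<omega>. (cmod (\<xi> k \<omega>))\<^sup>2) = 1" .
qed

lemma \<xi>_fourth:
  shows "integrable M (\<lambda>\<omega>. (cmod (\<xi> k \<omega>)) ^ 4)" "expectation (\<lambda>\<omega>. (cmod (\<xi> k \<omega>)) ^ 4) \<le> 96"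
proof -
  have "(\<integral>\<^sup>+ \<omega>. ennreal ((cmod (\<xi> k \<omega>)) ^ 4) \<partial>M) \<le> (\<integral>\<^sup>+ \<omega>. ennreal (1 / 2) * ennreal ((x k \<omega>) ^ 4) + ennreal (1 / 2) * ennreal ((x (- k) \<omega>) ^ 4) \<partial>M)"
  proof (rule nn_integral_mono_AE, use \<xi>_sym in eventually_elim)
    case (elim \<omega>)
    have "(cmod (\<xi> k \<omega>)) ^ 4 = ((cmod (\<xi> k \<omega>))\<^sup>2)\<^sup>2" by simp
    also have "\<dots> = (((x k \<omega>)\<^sup>2 + (x (- k) \<omega>)\<^sup>2) / 2)\<^sup>2" by (simp only: norm_\<xi>_x[OF elim])
    also have "\<dots> \<le> ((x k \<omega>)\<^sup>2)\<^sup>2 / 2 + ((x (- k) \<omega>)\<^sup>2)\<^sup>2 / 2"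
      using sum_squares_bound[of "(x k \<omega>)\<^sup>2" "(x (- k) \<omega>)\<^sup>2"]
      by (simp only: power_divide power2_sum) (simp add: field_simps)
    also have "\<dots> = 1 / 2 * (x k \<omega>) ^ 4 + 1 / 2 * (x (- k) \<omega>) ^ 4" by simp
    finally show ?case by (subst (1 2) ennreal_mult'[symmetric]) (auto simp: ennreal_leI simp flip: ennreal_plus)
  qed
  also have "\<dots> = ennreal (1 / 2) * (\<integral>\<^sup>+ \<omega>. ennreal ((x k \<omega>) ^ 4) \<partial>M) + ennreal (1 / 2) * (\<integral>\<^sup>+ \<omega>. ennreal ((x (- k) \<omega>) ^ 4) \<partial>M)"
    by (subst nn_integral_add) (auto simp: nn_integral_cmult)
  also have "\<dots> \<le> ennreal (1 / 2) * 96 + ennreal (1 / 2) * 96"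
    by (intro add_mono mult_left_mono g.fourth_moment) auto
  also have "\<dots> = ennreal 96"
  proof -
    have "ennreal (1 / 2) * ennreal 96 = ennreal (1 / 2 * 96)" by (rule ennreal_mult[symmetric]) auto
    hence h: "ennreal (1 / 2) * 96 = 48" by simp
    show ?thesis unfolding h by simp
  qed
  finally have b: "(\<integral>\<^sup>+ \<omega>. ennreal ((cmod (\<xi> k \<omega>)) ^ 4) \<partial>M) \<le> ennreal 96" .
  show i: "integrable M (\<lambda>\<omega>. (cmod (\<xi> k \<omega>)) ^ 4)"
    using b by (intro integrableI_nonneg) (auto simp: le_less_trans)
  show "expectation (\<lambda>\<omega>. (cmod (\<xi> k \<omega>)) ^ 4) \<le> 96"
  proof -
    have "ennreal (expectation (\<lambda>\<omega>. (cmod (\<xi> k \<omega>)) ^ 4)) \<le> ennreal 96"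
      using b i by (subst (asm) nn_integral_eq_integral) auto
    thus ?thesis by (subst (asm) ennreal_le_iff) auto
  qed
qed

lemma \<delta>_integrable: "integrable M (\<lambda>\<omega>. (cmod (\<delta> k \<omega>))\<^sup>2)"
proof (rule integrable_const_bound)
  show "AE \<omega> in M. norm ((cmod (\<delta> k \<omega>))\<^sup>2) \<le> 4 * (1 / (cmod (\<Gamma> k))\<^sup>2)"
    using \<delta>_le[of k] by (intro AE_I2) simp
qed measurable

lemma cross_integrable: "integrable M (\<lambda>\<omega>. \<delta> k \<omega> * cnj (\<xi> k \<omega>))"
proof (rule Bochner_Integration.integrable_bound)
  show "integrable M (\<lambda>\<omega>. (cmod (\<delta> k \<omega>))\<^sup>2 + (cmod (\<xi> k \<omega>))\<^sup>2)"
    using \<delta>_integrable \<xi>_square(1) by auto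
  have "cmod (\<delta> k \<omega>) * cmod (\<xi> k \<omega>) \<le> (cmod (\<delta> k \<omega>))\<^sup>2 + (cmod (\<xi> k \<omega>))\<^sup>2" for \<omega>
    using sum_squares_bound[of "cmod (\<delta> k \<omega>)" "cmod (\<xi> k \<omega>)"] mult_nonneg_nonneg[of "cmod (\<delta> k \<omega>)" "cmod (\<xi> k \<omega>)"]
    unfolding mult.assoc by (simp del: mult_nonneg_nonneg)
  thus "AE \<omega> in M. norm (\<delta> k \<omega> * cnj (\<xi> k \<omega>)) \<le> norm ((cmod (\<delta> k \<omega>))\<^sup>2 + (cmod (\<xi> k \<omega>))\<^sup>2)"
    by (auto simp: norm_mult)
  have [measurable]: "cnj \<in> borel_measurable borel"
    by (intro borel_measurable_continuous_onI continuous_intros)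
  show "(\<lambda>\<omega>. \<delta> k \<omega> * cnj (\<xi> k \<omega>)) \<in> borel_measurable M" by measurable
qed

section \<open>Loss and risk at a fixed cut-off\<close>

abbreviation LossM :: "nat \<Rightarrow> 'a \<Rightarrow> real" where "LossM N \<omega> \<equiv> Loss (\<lambda>k. \<delta> k \<omega>) (\<lambda>k. \<xi> k \<omega>) N"
abbreviation GM :: "nat \<Rightarrow> 'a \<Rightarrow> real" where "GM N \<omega> \<equiv> G (\<lambda>k. \<xi> k \<omega>) N"
abbreviation HM :: "nat \<Rightarrow> 'a \<Rightarrow> real" where "HM N \<omega> \<equiv> H (\<lambda>k. \<xi> k \<omega>) N"
abbreviation ZM :: "nat \<Rightarrow> 'a \<Rightarrow> real" where "ZM N \<omega> \<equiv> Zl (\<lambda>k. \<xi> k \<omega>) N"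

definition R :: "nat \<Rightarrow> real" where
  "R N = B N + \<sigma>\<^sup>2 * W N + 1 / real n * S (\<lambda>k. (cmod (\<theta> k))\<^sup>2 * (w k - 1)) N"

lemma LossM_meas [measurable]: "LossM N \<in> borel_measurable M"
  unfolding Loss_def S_def X_def by measurable
lemma GM_meas [measurable]: "GM N \<in> borel_measurable M"
  unfolding G_def S_def by measurable
lemma HM_meas [measurable]: "HM N \<in> borel_measurable M"
  unfolding H_def S_def by measurable
lemma ZM_meas [measurable]: "ZM N \<in> borel_measurable M"
  unfolding Zl_def S_def by measurable

lemma GM_expectation: "integrable M (GM N)" "expectation (GM N) = 0"
  unfolding G_def S_def using \<xi>_square by (auto simp: prob_space)

lemma HM_expectation: "integrable M (HM N)" "expectation (HM N) = W N"
  unfolding H_def S_def W_def using \<xi>_square by auto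

text \<open>The product of shift error and noise has mean zero by \<open>cross\<close>; bias, noise
  and shift error then give the three terms of \<open>R\<close>.\<close>

lemma LossM_expectation: "integrable M (LossM N)" "expectation (LossM N) \<le> R N"
proof -
  define c where "c k = of_real \<sigma> / cnj (\<Gamma> k) * \<theta> k" for k
  define y where "y k \<omega> = Re (c k * (\<delta> k \<omega> * cnj (\<xi> k \<omega>)))" for k \<omega>
  have eq: "(cmod (X (\<lambda>k. \<delta> k \<omega>) (\<lambda>k. \<xi> k \<omega>) k - \<theta> k))\<^sup>2 =
    (cmod (\<theta> k))\<^sup>2 * (cmod (\<delta> k \<omega>))\<^sup>2 + 2 * y k \<omega> + \<sigma>\<^sup>2 * (w k * (cmod (\<xi> k \<omega>))\<^sup>2)" for k \<omega>
  proof -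
    have "X (\<lambda>k. \<delta> k \<omega>) (\<lambda>k. \<xi> k \<omega>) k - \<theta> k = \<theta> k * \<delta> k \<omega> + of_real \<sigma> * \<xi> k \<omega> / \<Gamma> k"
      by (simp add: X_def algebra_simps)
    moreover have "\<theta> k * \<delta> k \<omega> * cnj (of_real \<sigma> * \<xi> k \<omega> / \<Gamma> k) = c k * (\<delta> k \<omega> * cnj (\<xi> k \<omega>))"
      by (simp add: c_def)
    ultimately show ?thesis unfolding y_def
      by (simp only: cmod_add_square norm_noise[of "\<lambda>k. \<xi> k \<omega>" k]) (simp add: norm_mult power_mult_distrib)
  qed
  note int = \<delta>_integrable \<xi>_square(1) cross_integrable
  have intR: "integrable M (y k)" for k
    unfolding y_def using int(3)[of k] by (intro integrable_Re integrable_mult_right) auto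
  have ER: "expectation (y k) = 0" for k
    unfolding y_def using int(3)[of k] cross[of k] by (subst integral_Re) auto
  have int2: "integrable M (\<lambda>\<omega>. (cmod (X (\<lambda>k. \<delta> k \<omega>) (\<lambda>k. \<xi> k \<omega>) k - \<theta> k))\<^sup>2)" for k
    unfolding eq using int intR by auto
  show "integrable M (LossM N)"
    unfolding Loss_def S_def using int2 by auto
  have "expectation (\<lambda>\<omega>. (cmod (X (\<lambda>k. \<delta> k \<omega>) (\<lambda>k. \<xi> k \<omega>) k - \<theta> k))\<^sup>2) =
    (cmod (\<theta> k))\<^sup>2 * expectation (\<lambda>\<omega>. (cmod (\<delta> k \<omega>))\<^sup>2) + \<sigma>\<^sup>2 * w k" for k
    unfolding eq using int intR by (simp add: ER \<xi>_square(2))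
  hence "expectation (LossM N) = B N + (\<Sum>k\<in>I N. (cmod (\<theta> k))\<^sup>2 * expectation (\<lambda>\<omega>. (cmod (\<delta> k \<omega>))\<^sup>2) + \<sigma>\<^sup>2 * w k)"
    unfolding Loss_def S_def using int2 by (simp add: prob_space)
  also have "\<dots> \<le> B N + (\<Sum>k\<in>I N. (cmod (\<theta> k))\<^sup>2 * ((w k - 1) / real n) + \<sigma>\<^sup>2 * w k)"
    using \<delta>_var by (intro add_left_mono sum_mono add_right_mono mult_left_mono) (auto simp: w_def)
  also have "\<dots> = R N"
    by (simp add: R_def S_def W_def sum.distrib sum_distrib_left)
  finally show "expectation (LossM N) \<le> R N" .
qed

text \<open>The bias part of the threshold pays for the variance of the linear form, which is at
  most \<open>\<sigma>\<^sup>2 * vb\<close> times the bias at the smaller cut-off. The variance part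
  of the threshold is left over and makes the bound exponentially small.\<close>

lemma linear_noise_excess:
  assumes v: "\<And>k. k \<in> I (max N N') \<Longrightarrow> w k \<le> vb" "0 < vb" and \<eta>: "0 < \<eta>"
  shows "(\<integral>\<^sup>+ \<omega>. ennreal (max 0 (ZM N \<omega> - ZM N' \<omega> - (\<eta> * B (min N N') + \<eta> * \<sigma>\<^sup>2 * W (max N N')))) \<partial>M)
    \<le> ennreal (\<sigma>\<^sup>2 * (vb / (2 * \<eta>) * exp (- (2 * \<eta>\<^sup>2 * W (max N N') / vb))))"
proof -
  define a b where "a = min N N'" and "b = max N N'"
  \<comment> \<open>The sign of the increment, so that both orders of \<open>N\<close> and
    \<open>N'\<close> become sums over the same frequencies.\<close>
  define sg where "sg = (if N' \<le> N then 1 else - 1 :: real)"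
  define A where "A k = of_real (sg * \<sigma>) / \<Gamma> k * cnj (\<theta> k)" for k
  define \<beta> where "\<beta> = (\<lambda>k. ((Re (A k) - Im (A k)) + (Re (A (- k)) + Im (A (- k)))) / 2)"
  define y where "y = \<eta> * B a + \<eta> * \<sigma>\<^sup>2 * W b"
  have sg2: "sg\<^sup>2 = 1" by (simp add: sg_def)
  have Zd: "ZM N \<omega> - ZM N' \<omega> = (\<Sum>k\<in>D a b. Re (A k * \<xi> k \<omega>))" for \<omega>
  proof -
    have e: "Re (A k * \<xi> k \<omega>) = sg * Re (of_real \<sigma> * \<xi> k \<omega> / \<Gamma> k * cnj (\<theta> k))" for k
    proof -
      have "A k * \<xi> k \<omega> = of_real sg * (of_real \<sigma> * \<xi> k \<omega> / \<Gamma> k * cnj (\<theta> k))" by (simp add: A_def)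
      thus ?thesis by (simp only: times_complex.sel Re_complex_of_real Im_complex_of_real mult_zero_left diff_zero)
    qed
    show ?thesis
    proof (cases "N' \<le> N")
      case True
      then show ?thesis unfolding e Zl_def using S_Diff[OF True] by (simp add: a_def b_def sg_def min_def max_def)
    next
      case False
      hence le: "N \<le> N'" by simp
      show ?thesis unfolding e Zl_def using S_Diff[OF le, of "\<lambda>k. Re (of_real \<sigma> * \<xi> k \<omega> / \<Gamma> k * cnj (\<theta> k))"] False
        by (simp add: a_def b_def sg_def min_def max_def sum_negf)
    qed
  qed
  have var: "(\<Sum>k\<in>D a b. (\<beta> k)\<^sup>2) \<le> \<sigma>\<^sup>2 * vb * B a"
  proof -
    have "(\<Sum>k\<in>D a b. (\<beta> k)\<^sup>2) \<le> (\<Sum>k\<in>D a b. (cmod (A k))\<^sup>2)"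
      unfolding \<beta>_def by (rule sum_linear_\<xi>(2))
    also have "\<dots> \<le> (\<Sum>k\<in>D a b. \<sigma>\<^sup>2 * vb * (cmod (\<theta> k))\<^sup>2)"
    proof (rule sum_mono)
      fix k assume "k \<in> D a b"
      hence "w k \<le> vb" using v(1) by (auto simp: D_def b_def)
      moreover have "(cmod (A k))\<^sup>2 = \<sigma>\<^sup>2 * w k * (cmod (\<theta> k))\<^sup>2"
        using sg2 by (simp add: A_def w_def norm_mult norm_divide power_mult_distrib power_divide)
      ultimately show "(cmod (A k))\<^sup>2 \<le> \<sigma>\<^sup>2 * vb * (cmod (\<theta> k))\<^sup>2" by (simp add: mult_left_mono mult_right_mono)
    qed
    also have "\<dots> = \<sigma>\<^sup>2 * vb * (\<Sum>k\<in>D a b. (cmod (\<theta> k))\<^sup>2)" by (simp only: sum_distrib_left)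
    also have "\<dots> \<le> \<sigma>\<^sup>2 * vb * B a" using v(2) by (intro mult_left_mono D_sum_le_B) (auto simp: a_def b_def)
    finally show ?thesis .
  qed
  \<comment> \<open>Chosen so that the variance bound contributes exactly
    \<open>t * \<eta> * B a\<close> to the exponent of \<open>linear_excess\<close>, cancelling the
    bias part of \<open>t * y\<close>.\<close>
  define t where "t = 2 * \<eta> / (\<sigma>\<^sup>2 * vb)"
  have sv: "0 < \<sigma>\<^sup>2 * vb" using \<sigma> v(2) by simp
  have t: "t > 0" using \<eta> sv by (simp add: t_def)
  have "(\<integral>\<^sup>+ \<omega>. ennreal (max 0 (ZM N \<omega> - ZM N' \<omega> - y)) \<partial>M) = (\<integral>\<^sup>+ \<omega>. ennreal (max 0 ((\<Sum>k\<in>D a b. \<beta> k * x k \<omega>) - y)) \<partial>M)"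
  proof (rule nn_integral_cong_AE, use \<xi>_sym in eventually_elim)
    case (elim \<omega>)
    show ?case unfolding Zd \<beta>_def sum_linear_\<xi>(1)[OF elim] ..
  qed
  also have "\<dots> \<le> ennreal (exp (t\<^sup>2 * (\<Sum>k\<in>D a b. (\<beta> k)\<^sup>2) / 2 - t * y) / t)"
    by (rule g.linear_excess[OF finite_D t])
  also have "\<dots> \<le> ennreal (exp (- (2 * \<eta>\<^sup>2 * W b / vb)) / t)"
  proof (intro ennreal_leI divide_right_mono)
    have "t\<^sup>2 * (\<Sum>k\<in>D a b. (\<beta> k)\<^sup>2) / 2 - t * y \<le> t\<^sup>2 * (\<sigma>\<^sup>2 * vb * B a) / 2 - t * y"
      using var by (intro diff_right_mono divide_right_mono mult_left_mono) auto
    also have "t\<^sup>2 * (\<sigma>\<^sup>2 * vb * B a) / 2 = t * (\<eta> * B a)"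
      using \<sigma> v(2) by (simp add: t_def power2_eq_square)
    also have "t * (\<eta> * B a) - t * y = - (t * (\<eta> * \<sigma>\<^sup>2 * W b))" by (simp add: y_def algebra_simps)
    also have "t * (\<eta> * \<sigma>\<^sup>2 * W b) = 2 * \<eta>\<^sup>2 * W b / vb"
      using \<sigma> v(2) by (simp add: t_def power2_eq_square)
    finally show "exp (t\<^sup>2 * (\<Sum>k\<in>D a b. (\<beta> k)\<^sup>2) / 2 - t * y) \<le> exp (- (2 * \<eta>\<^sup>2 * W b / vb))" by simp
  qed (use t in simp)
  also have "exp (- (2 * \<eta>\<^sup>2 * W b / vb)) / t = \<sigma>\<^sup>2 * (vb / (2 * \<eta>) * exp (- (2 * \<eta>\<^sup>2 * W b / vb)))"
    by (simp add: t_def)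
  finally show ?thesis by (simp add: y_def a_def b_def)
qed

lemma quadratic_noise_excess:
  assumes v: "\<And>k. k \<in> I N \<Longrightarrow> w k \<le> vb" "0 < vb" and \<eta>: "0 < \<eta>" "\<eta> \<le> 1"
  shows "(\<integral>\<^sup>+ \<omega>. ennreal (max 0 (GM N \<omega> - \<eta> * W N)) \<partial>M) \<le> ennreal (8 * vb / \<eta> * exp (- (\<eta>\<^sup>2 * W N / (16 * vb))))"
proof -
  have "(\<integral>\<^sup>+ \<omega>. ennreal (max 0 (GM N \<omega> - \<eta> * W N)) \<partial>M) =
    (\<integral>\<^sup>+ \<omega>. ennreal (max 0 ((\<Sum>k\<in>I N. w k * ((x k \<omega>)\<^sup>2 - 1)) - \<eta> * sum w (I N))) \<partial>M)"
  proof (rule nn_integral_cong_AE, use \<xi>_sym in eventually_elim)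
    case (elim \<omega>)
    show ?case unfolding sum_w_norm_\<xi>[OF elim] W_def S_def ..
  qed
  also have "\<dots> \<le> ennreal (8 * vb / \<eta> * exp (- (\<eta>\<^sup>2 * sum w (I N) / (16 * vb))))"
    using v \<eta> by (intro g.quadratic_excess) (auto simp: w_pos less_imp_le)
  finally show ?thesis by (simp add: W_def S_def)
qed

text \<open>Cauchy-Schwarz in additive form: \<open>l\<close> trades the probability of
  \<open>E\<close> against the fourth moment and is later taken to be a power of
  \<open>n\<close>.\<close>

lemma indicator_HM_expectation:
  assumes E: "E \<in> events" and l: "l > 0"
  shows "integrable M (\<lambda>\<omega>. indicator E \<omega> * HM m \<omega>)"
    and "expectation (\<lambda>\<omega>. indicator E \<omega> * HM m \<omega>) \<le> W m * ((l * prob E + 96 / l) / 2)"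
proof -
  note [measurable] = E
  show i: "integrable M (\<lambda>\<omega>. indicator E \<omega> * HM m \<omega>)"
    using integrable_mult_indicator[OF E HM_expectation(1)] by simp
  have le: "indicator E \<omega> * (cmod (\<xi> k \<omega>))\<^sup>2 \<le> (l * indicator E \<omega> + (cmod (\<xi> k \<omega>)) ^ 4 / l) / 2" for k \<omega>
  proof (cases "\<omega> \<in> E")
    case True
    have "2 * (l * (cmod (\<xi> k \<omega>))\<^sup>2) \<le> l\<^sup>2 + ((cmod (\<xi> k \<omega>))\<^sup>2)\<^sup>2" using sum_squares_bound[of l "(cmod (\<xi> k \<omega>))\<^sup>2"] by simp
    hence "2 * (l * (cmod (\<xi> k \<omega>))\<^sup>2) / (2 * l) \<le> (l\<^sup>2 + (cmod (\<xi> k \<omega>)) ^ 4) / (2 * l)"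
      using l by (intro divide_right_mono) auto
    thus ?thesis using True l by (simp add: field_simps power2_eq_square)
  qed (use l in simp)
  have "expectation (\<lambda>\<omega>. indicator E \<omega> * HM m \<omega>) \<le>
    expectation (\<lambda>\<omega>. \<Sum>k\<in>I m. w k * ((l * indicator E \<omega> + (cmod (\<xi> k \<omega>)) ^ 4 / l) / 2))"
  proof (rule integral_mono[OF i])
    show "integrable M (\<lambda>\<omega>. \<Sum>k\<in>I m. w k * ((l * indicator E \<omega> + (cmod (\<xi> k \<omega>)) ^ 4 / l) / 2))"
      using \<xi>_fourth(1) by (auto simp: emeasure_eq_measure)
    fix \<omega>
    have "indicator E \<omega> * HM m \<omega> = (\<Sum>k\<in>I m. w k * (indicator E \<omega> * (cmod (\<xi> k \<omega>))\<^sup>2))"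
      by (simp add: H_def S_def sum_distrib_left mult_ac)
    also have "\<dots> \<le> (\<Sum>k\<in>I m. w k * ((l * indicator E \<omega> + (cmod (\<xi> k \<omega>)) ^ 4 / l) / 2))"
      using w_pos by (intro sum_mono mult_left_mono le) (auto simp: less_imp_le)
    finally show "indicator E \<omega> * HM m \<omega> \<le> (\<Sum>k\<in>I m. w k * ((l * indicator E \<omega> + (cmod (\<xi> k \<omega>)) ^ 4 / l) / 2))" .
  qed
  also have "\<dots> = (\<Sum>k\<in>I m. w k * ((l * prob E + expectation (\<lambda>\<omega>. (cmod (\<xi> k \<omega>)) ^ 4) / l) / 2))"
    using \<xi>_fourth(1) by (simp add: emeasure_eq_measure)
  also have "\<dots> \<le> (\<Sum>k\<in>I m. w k * ((l * prob E + 96 / l) / 2))"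
    using w_pos l \<xi>_fourth(2) by (intro sum_mono mult_left_mono divide_right_mono add_left_mono) (auto simp: less_imp_le)
  also have "\<dots> = W m * ((l * prob E + 96 / l) / 2)" by (simp only: W_def S_def sum_distrib_right)
  finally show "expectation (\<lambda>\<omega>. indicator E \<omega> * HM m \<omega>) \<le> W m * ((l * prob E + 96 / l) / 2)" .
qed

section \<open>Data-driven cut-offs\<close>

definition \<Omega> :: "nat \<Rightarrow> real \<Rightarrow> 'a set" where
  "\<Omega> m \<eta> = {\<omega>\<in>space M. \<forall>k\<in>I m. cmod (\<delta> k \<omega>) \<le> \<eta>}"

lemma \<Omega>_event: "\<Omega> m \<eta> \<in> events"
  unfolding \<Omega>_def by measurable

definition T :: real where "T = (\<Sum>\<^sub>\<infinity>k. (cmod (\<theta> k))\<^sup>2)"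

lemma T_nonneg: "0 \<le> T" unfolding T_def by (rule infsum_nonneg) simp

lemma LossM_always:
  assumes v: "\<And>k. k \<in> I m \<Longrightarrow> w k \<le> vb" "0 \<le> vb" and N: "N \<le> m"
  shows "LossM N \<omega> \<le> (1 + 8 * vb) * T + 2 * \<sigma>\<^sup>2 * HM m \<omega>"
  unfolding T_def
proof (rule Loss_bound[OF _ N v(2)])
  fix k assume "k \<in> I m"
  show "(cmod (\<delta> k \<omega>))\<^sup>2 \<le> 4 * vb" using \<delta>_le[of k \<omega>] v(1)[OF \<open>k \<in> I m\<close>] by (simp add: w_def)
qed

context
  fixes Nt :: "'a \<Rightarrow> nat" and m :: nat
  assumes Nt [measurable]: "Nt \<in> measurable M (count_space UNIV)"
    and Nt_le: "\<And>\<omega>. \<omega> \<in> space M \<Longrightarrow> Nt \<omega> \<le> m"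
    and Nt_min: "\<And>\<omega> N'. \<omega> \<in> space M \<Longrightarrow> N' \<le> m \<Longrightarrow>
      U (\<lambda>k. \<delta> k \<omega>) (\<lambda>k. \<xi> k \<omega>) (Nt \<omega>) \<le> U (\<lambda>k. \<delta> k \<omega>) (\<lambda>k. \<xi> k \<omega>) N'"
begin

text \<open>The random index takes finitely many values, so its loss is dominated by the sum of the
  losses at all fixed cut-offs.\<close>

lemma Loss_Nt_integrable: "integrable M (\<lambda>\<omega>. LossM (Nt \<omega>) \<omega>)"
proof (rule Bochner_Integration.integrable_bound)
  show "integrable M (\<lambda>\<omega>. \<Sum>N\<le>m. LossM N \<omega>)" using LossM_expectation(1) by auto
  show "(\<lambda>\<omega>. LossM (Nt \<omega>) \<omega>) \<in> borel_measurable M"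
    by (rule measurable_compose_countable[OF _ Nt]) measurable
  show "AE \<omega> in M. norm (LossM (Nt \<omega>) \<omega>) \<le> norm (\<Sum>N\<le>m. LossM N \<omega>)"
  proof (rule AE_I2)
    fix \<omega> assume "\<omega> \<in> space M"
    hence "LossM (Nt \<omega>) \<omega> \<le> (\<Sum>N\<le>m. LossM N \<omega>)"
      using Nt_le by (intro member_le_sum) (auto simp: Loss_nonneg)
    thus "norm (LossM (Nt \<omega>) \<omega>) \<le> norm (\<Sum>N\<le>m. LossM N \<omega>)" by (simp add: Loss_nonneg sum_nonneg)
  qed
qed

lemma oracle_crude:
  assumes v: "\<And>k. k \<in> I m \<Longrightarrow> w k \<le> vb" "0 \<le> vb" and N': "N' \<le> m"
  shows "expectation (\<lambda>\<omega>. LossM (Nt \<omega>) \<omega>) \<le> R N' + 26 * \<sigma>\<^sup>2 * W m + (1 + 8 * vb) * T * prob (space M - \<Omega> m (1 / 4))"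
proof -
  define E where "E = space M - \<Omega> m (1 / 4)"
  have E [measurable]: "E \<in> events" unfolding E_def using \<Omega>_event by auto
  have pt: "LossM (Nt \<omega>) \<omega> \<le> LossM N' \<omega> + 12 * \<sigma>\<^sup>2 * (W m + HM m \<omega>) + ((1 + 8 * vb) * T * indicator E \<omega> + 2 * \<sigma>\<^sup>2 * HM m \<omega>)"
    if \<omega>: "\<omega> \<in> space M" for \<omega>
  proof (cases "\<omega> \<in> E")
    case True
    have "LossM (Nt \<omega>) \<omega> \<le> (1 + 8 * vb) * T + 2 * \<sigma>\<^sup>2 * HM m \<omega>" by (intro LossM_always v Nt_le \<omega>)
    moreover have "0 \<le> LossM N' \<omega>" "0 \<le> 12 * \<sigma>\<^sup>2 * (W m + HM m \<omega>)"
      using Loss_nonneg W_pos[of m] H_nonneg[of "\<lambda>k. \<xi> k \<omega>" m] by auto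
    ultimately show ?thesis using True by simp
  next
    case False
    hence \<delta>: "cmod (\<delta> k \<omega>) \<le> 1 / 4" if "k \<in> I m" for k using \<omega> that by (auto simp: E_def \<Omega>_def)
    have "LossM (Nt \<omega>) \<omega> \<le> LossM N' \<omega> + 12 * \<sigma>\<^sup>2 * (W m + HM m \<omega>)"
      by (rule pathwise_crude[OF \<delta> Nt_le[OF \<omega>] N' Nt_min[OF \<omega> N']])
    moreover have "0 \<le> 2 * \<sigma>\<^sup>2 * HM m \<omega>" using H_nonneg by simp
    ultimately show ?thesis using False by simp
  qed
  have "expectation (\<lambda>\<omega>. LossM (Nt \<omega>) \<omega>) \<le>
    expectation (\<lambda>\<omega>. LossM N' \<omega> + 12 * \<sigma>\<^sup>2 * (W m + HM m \<omega>) + ((1 + 8 * vb) * T * indicator E \<omega> + 2 * \<sigma>\<^sup>2 * HM m \<omega>))"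
    using LossM_expectation(1) HM_expectation(1) pt
    by (intro integral_mono Loss_Nt_integrable) (auto simp: emeasure_eq_measure)
  \<comment> \<open>\<open>HM m\<close> has mean \<open>W m\<close>, so the total variance enters
    with the coefficient \<open>12 * 2 + 2 = 26\<close>.\<close>
  also have "\<dots> = expectation (LossM N') + 12 * \<sigma>\<^sup>2 * (W m + W m) + ((1 + 8 * vb) * T * prob E + 2 * \<sigma>\<^sup>2 * W m)"
    using LossM_expectation(1) HM_expectation by (simp add: emeasure_eq_measure prob_space)
  also have "\<dots> \<le> R N' + 12 * \<sigma>\<^sup>2 * (W m + W m) + ((1 + 8 * vb) * T * prob E + 2 * \<sigma>\<^sup>2 * W m)"
    using LossM_expectation(2) by simp
  also have "\<dots> = R N' + 26 * \<sigma>\<^sup>2 * W m + (1 + 8 * vb) * T * prob E" by (simp add: algebra_simps)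
  finally show ?thesis by (simp add: E_def)
qed

text \<open>Uniformity over the random cut-off is obtained by summing the positive parts of the
  excesses over all \<open>N \<le> m\<close>. The decay in \<open>F\<close> bounds these sums by
  multiples of \<open>2 * K\<close> that do not depend on \<open>m\<close>; the coefficient 24 is
  \<open>5 * 2 + 7 * 2\<close>.\<close>

lemma oracle_fine:
  assumes v: "\<And>N k. k \<in> I N \<Longrightarrow> w k \<le> v N" "\<And>N. 0 < v N" and N': "N' \<le> m"
    and \<eta>: "0 < \<eta>" "\<eta> \<le> 1 / 12" and l: "0 < l"
    and F: "\<And>N. 8 * v N / \<eta> * exp (- (\<eta>\<^sup>2 * W N / (16 * v N))) \<le> K / (real N + 1)\<^sup>2" and K: "0 \<le> K"
  defines "\<rho> \<equiv> prob (space M - \<Omega> m \<eta>)"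
  shows "expectation (\<lambda>\<omega>. LossM (Nt \<omega>) \<omega>) \<le> R N' + 32 * \<eta> * Q N' + 24 * \<sigma>\<^sup>2 * K
    + (1 + 8 * v m) * T * \<rho> + 3 * \<sigma>\<^sup>2 * W m * (l * \<rho> + 96 / l)"
proof -
  define E where "E = space M - \<Omega> m \<eta>"
  have E [measurable]: "E \<in> events" unfolding E_def using \<Omega>_event by auto
  define s1 where "s1 N \<omega> = max 0 (ZM N \<omega> - ZM N' \<omega> - (\<eta> * B (min N N') + \<eta> * \<sigma>\<^sup>2 * W (max N N')))" for N \<omega>
  define s2 where "s2 N \<omega> = max 0 (GM N \<omega> - \<eta> * W N)" for N \<omega>
  define S1 where "S1 \<omega> = (\<Sum>N\<le>m. s1 N \<omega>)" for \<omega>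
  define S2 where "S2 \<omega> = (\<Sum>N\<le>m. s2 N \<omega>)" for \<omega>
  define \<kappa> where "\<kappa> = 2 + 8 * \<eta> / (1 - 6 * \<eta>)"
  have \<kappa>: "0 \<le> \<kappa>" "\<kappa> \<le> 4" using \<eta> by (auto simp: \<kappa>_def field_simps)
  have s0: "0 \<le> s1 N \<omega>" "0 \<le> s2 N \<omega>" for N \<omega> by (auto simp: s1_def s2_def)
  have S0: "0 \<le> S1 \<omega>" "0 \<le> S2 \<omega>" for \<omega> using s0 by (auto simp: S1_def S2_def sum_nonneg)
  have s1_le: "s1 N \<omega> \<le> S1 \<omega>" "s2 N \<omega> \<le> S2 \<omega>" if "N \<le> m" for N \<omega>
    unfolding S1_def S2_def using that s0 by (auto intro!: member_le_sum)
  have \<sigma>2: "0 \<le> \<sigma>\<^sup>2" by simp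
  have pt: "LossM (Nt \<omega>) \<omega> \<le> LossM N' \<omega> + 32 * \<eta> * Q N' + 5 * S1 \<omega> + 7 * \<sigma>\<^sup>2 * S2 \<omega> - \<kappa> * \<sigma>\<^sup>2 * GM N' \<omega>
      + ((1 + 8 * v m) * T * indicator E \<omega> + 6 * \<sigma>\<^sup>2 * (indicator E \<omega> * HM m \<omega>))" (is "_ \<le> ?rhs \<omega>")
    if \<omega>: "\<omega> \<in> space M" for \<omega>
  proof (cases "\<omega> \<in> E")
    case True
    have 1: "LossM (Nt \<omega>) \<omega> \<le> (1 + 8 * v m) * T + 2 * \<sigma>\<^sup>2 * HM m \<omega>"
      using v by (intro LossM_always Nt_le \<omega>) (auto simp: less_imp_le)
    \<comment> \<open>The subtracted term
      \<open>\<kappa> * \<sigma>\<^sup>2 * GM N' \<omega>\<close> has to be compensated on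
      \<open>E\<close> as well. With \<open>\<kappa> \<le> 4\<close> this costs 4, which together
      with the 2 of \<open>LossM_always\<close> makes the coefficient 6.\<close>
    have "GM N' \<omega> \<le> HM m \<omega>" using H_mono[OF N', of "\<lambda>k. \<xi> k \<omega>"] H_eq[of "\<lambda>k. \<xi> k \<omega>" N'] W_pos[of N'] by simp
    hence "\<kappa> * \<sigma>\<^sup>2 * GM N' \<omega> \<le> \<kappa> * \<sigma>\<^sup>2 * HM m \<omega>" using \<kappa> by (intro mult_left_mono) auto
    also have "\<dots> \<le> 4 * \<sigma>\<^sup>2 * HM m \<omega>" using \<kappa> H_nonneg by (intro mult_right_mono) auto
    finally have 2: "\<kappa> * \<sigma>\<^sup>2 * GM N' \<omega> \<le> 4 * \<sigma>\<^sup>2 * HM m \<omega>" .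
    have 3: "0 \<le> LossM N' \<omega>" "0 \<le> 32 * \<eta> * Q N'" "0 \<le> 5 * S1 \<omega>" "0 \<le> 7 * \<sigma>\<^sup>2 * S2 \<omega>"
      using Loss_nonneg Q_nonneg S0 \<eta> by auto
    have ind: "indicator E \<omega> = (1 :: real)" using True by simp
    show ?thesis unfolding ind mult_1_right mult_1_left using 1 2 3 by linarith
  next
    case False
    hence \<delta>: "cmod (\<delta> k \<omega>) \<le> \<eta>" if "k \<in> I m" for k using \<omega> that by (auto simp: E_def \<Omega>_def)
    have "LossM (Nt \<omega>) \<omega> \<le> LossM N' \<omega> + 32 * \<eta> * Q N' + 5 * S1 \<omega> + 7 * \<sigma>\<^sup>2 * S2 \<omega> - \<kappa> * \<sigma>\<^sup>2 * GM N' \<omega>"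
      unfolding \<kappa>_def
    proof (rule pathwise_fine[OF _ \<eta>(2) \<delta> Nt_le[OF \<omega>] N' Nt_min[OF \<omega> N']])
      show "ZM (Nt \<omega>) \<omega> - ZM N' \<omega> \<le> \<eta> * B (min (Nt \<omega>) N') + \<eta> * \<sigma>\<^sup>2 * W (max (Nt \<omega>) N') + S1 \<omega>"
        using s1_le(1)[OF Nt_le[OF \<omega>], of \<omega>] by (simp add: s1_def)
      show "GM N \<omega> \<le> \<eta> * W N + S2 \<omega>" if "N \<le> m" for N
        using s1_le(2)[OF that, of \<omega>] by (simp add: s2_def)
    qed (use \<eta> S0 in auto)
    thus ?thesis using False by simp
  qed
  have Kb: "8 * v N / \<eta> * exp (- (\<eta>\<^sup>2 * W N / (16 * v N))) \<le> K / (real M + 1)\<^sup>2" if "M \<le> N" for N M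
  proof -
    have "K / (real N + 1)\<^sup>2 \<le> K / (real M + 1)\<^sup>2"
      using that K by (intro divide_left_mono power_mono mult_pos_pos) auto
    thus ?thesis using F[of N] by linarith
  qed
  have s2_int: "integrable M (s2 N)" "expectation (s2 N) \<le> K / (real N + 1)\<^sup>2" for N
  proof -
    have "(\<integral>\<^sup>+ \<omega>. ennreal (s2 N \<omega>) \<partial>M) \<le> ennreal (8 * v N / \<eta> * exp (- (\<eta>\<^sup>2 * W N / (16 * v N))))"
      unfolding s2_def using v \<eta> by (intro quadratic_noise_excess) auto
    also have "\<dots> \<le> ennreal (K / (real N + 1)\<^sup>2)" by (intro ennreal_leI F)
    finally have b: "(\<integral>\<^sup>+ \<omega>. ennreal (s2 N \<omega>) \<partial>M) \<le> ennreal (K / (real N + 1)\<^sup>2)" .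
    have "s2 N \<in> borel_measurable M" unfolding s2_def by measurable
    from integrable_of_nn_bound[OF this s0(2) b] K
    show "integrable M (s2 N)" "expectation (s2 N) \<le> K / (real N + 1)\<^sup>2" by auto
  qed
  have s1_int: "integrable M (s1 N)" "expectation (s1 N) \<le> \<sigma>\<^sup>2 * (K / (real N + 1)\<^sup>2)" for N
  proof -
    define b where "b = max N N'"
    have "(\<integral>\<^sup>+ \<omega>. ennreal (s1 N \<omega>) \<partial>M) \<le> ennreal (\<sigma>\<^sup>2 * (v b / (2 * \<eta>) * exp (- (2 * \<eta>\<^sup>2 * W b / v b))))"
      unfolding s1_def b_def using v \<eta> by (intro linear_noise_excess) auto
    \<comment> \<open>The bound for the linear excess is smaller than the one for the quadratic
      excess, so the single hypothesis \<open>F\<close> serves both. It is needed at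
      \<open>max N N'\<close>, which is the reason for \<open>Kb\<close>.\<close>
    also have "\<dots> \<le> ennreal (\<sigma>\<^sup>2 * (8 * v b / \<eta> * exp (- (\<eta>\<^sup>2 * W b / (16 * v b)))))"
    proof (intro ennreal_leI mult_left_mono \<sigma>2 mult_mono)
      have vb: "0 < v b" by (rule v)
      show "v b / (2 * \<eta>) \<le> 8 * v b / \<eta>" using vb \<eta> by (simp add: field_simps)
      have "0 \<le> \<eta>\<^sup>2 * W b / v b" using vb W_pos[of b] by (simp add: less_imp_le)
      moreover have "2 * \<eta>\<^sup>2 * W b / v b = 2 * (\<eta>\<^sup>2 * W b / v b)" "\<eta>\<^sup>2 * W b / (16 * v b) = (\<eta>\<^sup>2 * W b / v b) / 16" by auto
      moreover have gen: "- (2 * q) \<le> - (q / 16)" if "0 \<le> q" for q :: real using that by simp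
      ultimately show "exp (- (2 * \<eta>\<^sup>2 * W b / v b)) \<le> exp (- (\<eta>\<^sup>2 * W b / (16 * v b)))"
        using gen by (simp only: exp_le_cancel_iff)
      show "0 \<le> 8 * v b / \<eta>" using vb \<eta> by simp
    qed simp
    also have "\<dots> \<le> ennreal (\<sigma>\<^sup>2 * (K / (real N + 1)\<^sup>2))"
      by (intro ennreal_leI mult_left_mono Kb) (auto simp: b_def)
    finally have bd: "(\<integral>\<^sup>+ \<omega>. ennreal (s1 N \<omega>) \<partial>M) \<le> ennreal (\<sigma>\<^sup>2 * (K / (real N + 1)\<^sup>2))" .
    have "s1 N \<in> borel_measurable M" unfolding s1_def by measurable
    from integrable_of_nn_bound[OF this s0(1) bd] K
    show "integrable M (s1 N)" "expectation (s1 N) \<le> \<sigma>\<^sup>2 * (K / (real N + 1)\<^sup>2)" by auto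
  qed
  have basel: "(\<Sum>N\<le>M. K / (real N + 1)\<^sup>2) \<le> 2 * K" for M
  proof -
    have "(\<Sum>N\<le>M. 1 / (real N + 1)\<^sup>2) \<le> 2 - 1 / (real M + 1)"
    proof (induction M)
      case (Suc M)
      have "1 / (real (Suc M) + 1)\<^sup>2 \<le> 1 / (real M + 1) - 1 / (real (Suc M) + 1)"
        by (simp add: power2_eq_square divide_simps)
      with Suc show ?case by simp
    qed simp
    hence "(\<Sum>N\<le>M. 1 / (real N + 1)\<^sup>2) \<le> 2" by (smt (verit) divide_nonneg_nonneg of_nat_0_le_iff)
    hence "K * (\<Sum>N\<le>M. 1 / (real N + 1)\<^sup>2) \<le> K * 2" using K by (rule mult_left_mono)
    thus ?thesis by (simp add: sum_distrib_left)
  qed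
  have S1_int: "integrable M S1" unfolding S1_def using s1_int(1) by auto
  have S2_int: "integrable M S2" unfolding S2_def using s2_int(1) by auto
  have ES2: "expectation S2 \<le> 2 * K"
  proof -
    have "expectation S2 = (\<Sum>N\<le>m. expectation (s2 N))" unfolding S2_def using s2_int(1) by simp
    also have "\<dots> \<le> (\<Sum>N\<le>m. K / (real N + 1)\<^sup>2)" by (intro sum_mono s2_int)
    finally show ?thesis using basel[of m] by linarith
  qed
  have ES1: "expectation S1 \<le> \<sigma>\<^sup>2 * (2 * K)"
  proof -
    have "expectation S1 = (\<Sum>N\<le>m. expectation (s1 N))" unfolding S1_def using s1_int(1) by simp
    also have "\<dots> \<le> (\<Sum>N\<le>m. \<sigma>\<^sup>2 * (K / (real N + 1)\<^sup>2))" by (intro sum_mono s1_int)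
    also have "\<dots> = \<sigma>\<^sup>2 * (\<Sum>N\<le>m. K / (real N + 1)\<^sup>2)" by (simp only: sum_distrib_left)
    also have "\<dots> \<le> \<sigma>\<^sup>2 * (2 * K)" by (intro mult_left_mono basel) simp
    finally show ?thesis .
  qed
  note ints = LossM_expectation(1) GM_expectation(1) S1_int S2_int indicator_HM_expectation(1)[OF E l]
  have int_ind: "integrable M (indicator E :: 'a \<Rightarrow> real)" by (simp add: emeasure_eq_measure)
  have "expectation (\<lambda>\<omega>. LossM (Nt \<omega>) \<omega>) \<le> expectation ?rhs"
    using ints int_ind pt by (intro integral_mono Loss_Nt_integrable) auto
  also have "expectation ?rhs = expectation (LossM N') + 32 * \<eta> * Q N' + 5 * expectation S1 + 7 * \<sigma>\<^sup>2 * expectation S2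
      - \<kappa> * \<sigma>\<^sup>2 * expectation (GM N')
      + ((1 + 8 * v m) * T * prob E + 6 * \<sigma>\<^sup>2 * expectation (\<lambda>\<omega>. indicator E \<omega> * HM m \<omega>))"
    using ints int_ind by (simp add: prob_space)
  also have "\<dots> \<le> R N' + 32 * \<eta> * Q N' + 5 * (\<sigma>\<^sup>2 * (2 * K)) + 7 * \<sigma>\<^sup>2 * (2 * K) - \<kappa> * \<sigma>\<^sup>2 * 0
      + ((1 + 8 * v m) * T * prob E + 6 * \<sigma>\<^sup>2 * (W m * ((l * prob E + 96 / l) / 2)))"
    unfolding GM_expectation(2)
    by (intro add_mono diff_mono order_refl LossM_expectation(2)
      mult_left_mono[OF ES1] mult_left_mono[OF ES2] mult_left_mono[OF indicator_HM_expectation(2)[OF E l]]) auto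
  also have "\<dots> = R N' + 32 * \<eta> * Q N' + 24 * \<sigma>\<^sup>2 * K
    + (1 + 8 * v m) * T * prob E + 3 * \<sigma>\<^sup>2 * W m * (l * prob E + 96 / l)"
    by (simp add: field_simps)
  finally show ?thesis by (simp add: \<rho>_def E_def)
qed

end

end

section \<open>The shifted curves model as a noisy sequence model\<close>

text \<open>Converts independence of the generated sigma-algebras, the form in which the model
  states it, into independence of a functional of the shifts and a functional of the paths.\<close>

lemma (in prob_space) indep_var_vimage_algebra:
  assumes ind: "indep_set (sets (vimage_algebra (space M) X N1)) (sets (vimage_algebra (space M) Y N2))"
    and X: "X \<in> space M \<rightarrow> space N1" and Y: "Y \<in> space M \<rightarrow> space N2"
    and f: "f \<in> measurable N1 borel" and g: "g \<in> measurable N2 borel"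
  shows "indep_var borel (\<lambda>\<omega>. f (X \<omega>)) borel (\<lambda>\<omega>. g (Y \<omega>))"
proof -
  have mf: "(\<lambda>\<omega>. f (X \<omega>)) \<in> measurable (vimage_algebra (space M) X N1) borel"
    by (rule measurable_compose[OF measurable_vimage_algebra1[OF X] f])
  have mg: "(\<lambda>\<omega>. g (Y \<omega>)) \<in> measurable (vimage_algebra (space M) Y N2) borel"
    by (rule measurable_compose[OF measurable_vimage_algebra1[OF Y] g])
  have sub: "sets (vimage_algebra (space M) X N1) \<subseteq> events" "sets (vimage_algebra (space M) Y N2) \<subseteq> events"
    using ind unfolding indep_sets2_eq by auto
  have pre: "{f' -` A \<inter> space M |A. A \<in> sets borel} \<subseteq> sets V"
    if "f' \<in> measurable V borel" "space V = space M" for f' :: "'a \<Rightarrow> 'z::topological_space" and V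
    using measurable_sets[OF that(1)] that(2) by auto
  have gen: "sigma_sets (space M) {f' -` A \<inter> space M |A. A \<in> sets borel} \<subseteq> sets V"
    if "f' \<in> measurable V borel" "space V = space M" for f' :: "'a \<Rightarrow> 'z::topological_space" and V
    using sets.sigma_sets_subset[OF pre[OF that]] that(2) by simp
  have rv: "f' \<in> measurable M borel" if "f' \<in> measurable V borel" "space V = space M" "sets V \<subseteq> events"
    for f' :: "'a \<Rightarrow> 'z::topological_space" and V
    using that unfolding measurable_def by auto
  show ?thesis
    unfolding indep_var_eq
  proof (intro conjI)
    show "random_variable borel (\<lambda>\<omega>. f (X \<omega>))" using rv[OF mf _ sub(1)] by simp
    show "random_variable borel (\<lambda>\<omega>. g (Y \<omega>))" using rv[OF mg _ sub(2)] by simp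
    show "indep_set (sigma_sets (space M) {(\<lambda>\<omega>. f (X \<omega>)) -` A \<inter> space M |A. A \<in> sets borel})
     (sigma_sets (space M) {(\<lambda>\<omega>. g (Y \<omega>)) -` A \<inter> space M |A. A \<in> sets borel})"
      unfolding indep_set_def
      by (rule indep_sets_mono_sets[OF ind[unfolded indep_set_def]])
        (use gen[OF mf] gen[OF mg] in \<open>auto split: bool.split\<close>)
  qed
qed

lemma prob_density_integrable:
  assumes "prob_density g"
  shows "integrable lborel g" "(\<integral>x. g x \<partial>lborel) = 1"
proof -
  have m: "g \<in> borel_measurable lborel" "\<And>x. 0 \<le> g x" and i: "(\<integral>\<^sup>+ x. ennreal (g x) \<partial>lborel) = 1"
    using assms by (auto simp: prob_density_def)
  show "integrable lborel g" using m i by (intro integrableI_nonneg) auto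
  show "(\<integral>x. g x \<partial>lborel) = 1" using m i by (subst integral_eq_nn_integral) auto
qed

lemma shift_coeff_norm_le:
  assumes "prob_density g"
  shows "cmod (shift_coeff g k) \<le> 1"
proof -
  have "cmod (shift_coeff g k) \<le> (\<integral>x. cmod (fourier_char k x * of_real (g x)) \<partial>lborel)"
    unfolding shift_coeff_def by (rule integral_norm_bound)
  also have "\<dots> = (\<integral>x. g x \<partial>lborel)"
    using assms by (intro Bochner_Integration.integral_cong) (auto simp: norm_mult prob_density_def)
  finally show ?thesis using prob_density_integrable(2)[OF assms] by simp
qed

lemma shift_coeff_0: "prob_density g \<Longrightarrow> shift_coeff g 0 = 1"
  using prob_density_integrable[of g] by (simp add: shift_coeff_def)

lemma shift_coeff_uminus: "shift_coeff g (- k) = cnj (shift_coeff g k)"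
  unfolding shift_coeff_def
  using Bochner_Integration.integral_cnj[of lborel "\<lambda>x. fourier_char k x * of_real (g x)"]
  by (simp add: fourier_char_uminus)

section \<open>Shift errors in the curve model\<close>

locale curves_model =
  fixes M :: "'a measure" and f g :: "real \<Rightarrow> real" and \<epsilon> :: real and n :: nat
    and \<tau> :: "nat \<Rightarrow> 'a \<Rightarrow> real" and Wn :: "nat \<Rightarrow> real \<Rightarrow> 'a \<Rightarrow> real" and Z :: "nat \<Rightarrow> int \<Rightarrow> 'a \<Rightarrow> complex"
  assumes model: "shifted_curves_model M f g \<epsilon> n \<tau> Wn Z" and f: "periodic_L2 f" and g: "prob_density g"
    and \<Gamma>_nz: "\<And>k. shift_coeff g k \<noteq> 0" and \<epsilon>: "0 < \<epsilon>" and n: "0 < n"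
begin

sublocale prob_space M using model by (simp add: shifted_curves_model_def)

abbreviation "\<theta> \<equiv> fourier_coeff f"
abbreviation "\<Gamma> \<equiv> shift_coeff g"

text \<open>The observation only asserts that some version of the Wiener integral exists; one
  version is fixed here together with its link to \<open>Z\<close>.\<close>

definition noise :: "nat \<Rightarrow> int \<Rightarrow> 'a \<Rightarrow> complex" where
  "noise j k = (SOME I. has_wiener_integral M (Wn j) (fourier_char k) I \<and>
    (\<forall>\<omega>\<in>space M. Z j k \<omega> = (LBINT x:{0..1}. fourier_char k x * of_real (f (x - \<tau> j \<omega>))) + of_real \<epsilon> * I \<omega>))"

lemma noise:
  assumes "j \<in> {1..n}"
  shows "has_wiener_integral M (Wn j) (fourier_char k) (noise j k)"
    and "\<omega> \<in> space M \<Longrightarrow> Z j k \<omega> = fourier_char k (\<tau> j \<omega>) * \<theta> k + of_real \<epsilon> * noise j k \<omega>"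
proof -
  have "\<exists>I. has_wiener_integral M (Wn j) (fourier_char k) I \<and>
    (\<forall>\<omega>\<in>space M. Z j k \<omega> = (LBINT x:{0..1}. fourier_char k x * of_real (f (x - \<tau> j \<omega>))) + of_real \<epsilon> * I \<omega>)"
    using model assms unfolding shifted_curves_model_def has_obs_integral_def by blast
  from someI_ex[OF this, folded noise_def]
  show "has_wiener_integral M (Wn j) (fourier_char k) (noise j k)"
    "\<omega> \<in> space M \<Longrightarrow> Z j k \<omega> = fourier_char k (\<tau> j \<omega>) * \<theta> k + of_real \<epsilon> * noise j k \<omega>"
    by (auto simp: shifted_fourier_coeff[OF f])
qed

definition \<delta> :: "int \<Rightarrow> 'a \<Rightarrow> complex" where
  "\<delta> k \<omega> = (1 / of_nat n) * (\<Sum>j\<in>{1..n}. fourier_char k (\<tau> j \<omega>)) / \<Gamma> k - 1"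
definition \<xi> :: "int \<Rightarrow> 'a \<Rightarrow> complex" where
  "\<xi> k \<omega> = (\<Sum>j\<in>{1..n}. noise j k \<omega>) / of_real (sqrt (real n))"
definition \<sigma> :: real where "\<sigma> = \<epsilon> / sqrt (real n)"

lemma \<sigma>_pos: "0 < \<sigma>" using \<epsilon> n by (simp add: \<sigma>_def)

lemma \<sigma>2: "\<sigma>\<^sup>2 = \<epsilon>\<^sup>2 / real n" using n by (simp add: \<sigma>_def power_divide)

lemma mean_coeff_eq:
  assumes "\<omega> \<in> space M"
  shows "mean_coeff n Z \<omega> k / \<Gamma> k = \<theta> k * (1 + \<delta> k \<omega>) + of_real \<sigma> * \<xi> k \<omega> / \<Gamma> k"
proof -
  have "(\<Sum>j\<in>{1..n}. Z j k \<omega>) = (\<Sum>j\<in>{1..n}. fourier_char k (\<tau> j \<omega>) * \<theta> k + of_real \<epsilon> * noise j k \<omega>)"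
    by (intro sum.cong refl noise(2) assms)
  also have "\<dots> = (\<Sum>j\<in>{1..n}. fourier_char k (\<tau> j \<omega>)) * \<theta> k + of_real \<epsilon> * (\<Sum>j\<in>{1..n}. noise j k \<omega>)"
    by (simp add: sum.distrib sum_distrib_left sum_distrib_right)
  finally have s: "(\<Sum>j\<in>{1..n}. Z j k \<omega>) =
    (\<Sum>j\<in>{1..n}. fourier_char k (\<tau> j \<omega>)) * \<theta> k + of_real \<epsilon> * (\<Sum>j\<in>{1..n}. noise j k \<omega>)" .
  have "of_real \<sigma> * \<xi> k \<omega> = of_real (\<epsilon> / real n) * (\<Sum>j\<in>{1..n}. noise j k \<omega>)"
  proof -
    have "complex_of_real (sqrt (real n)) * complex_of_real (sqrt (real n)) = of_real (real n)"
      by (simp flip: of_real_mult)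
    thus ?thesis using n by (simp add: \<sigma>_def \<xi>_def)
  qed
  thus ?thesis unfolding mean_coeff_def s \<delta>_def
    by (simp add: add_divide_distrib distrib_left)
qed

lemma \<tau>_meas [measurable]: "j \<in> {1..n} \<Longrightarrow> \<tau> j \<in> borel_measurable M"
  using model by (auto simp: shifted_curves_model_def distributed_def)

lemma noise_meas: "j \<in> {1..n} \<Longrightarrow> noise j k \<in> borel_measurable M"
  using noise(1)[of j k] by (simp add: has_wiener_integral_def)

lemma \<delta>_meas: "\<delta> k \<in> borel_measurable M"
proof -
  have "(\<lambda>\<omega>. fourier_char k (\<tau> j \<omega>)) \<in> borel_measurable M" if "j \<in> {1..n}" for j
    by (rule measurable_compose[OF \<tau>_meas[OF that] fourier_char_measurable])
  thus ?thesis unfolding \<delta>_def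
    by (intro borel_measurable_diff borel_measurable_divide borel_measurable_times borel_measurable_sum) auto
qed

lemma \<xi>_meas: "\<xi> k \<in> borel_measurable M"
  unfolding \<xi>_def by (intro borel_measurable_divide borel_measurable_sum noise_meas) auto

lemma \<tau>_expectation:
  assumes j: "j \<in> {1..n}"
  shows "integrable M (\<lambda>\<omega>. fourier_char k (\<tau> j \<omega>))" "expectation (\<lambda>\<omega>. fourier_char k (\<tau> j \<omega>)) = \<Gamma> k"
proof -
  note [measurable] = \<tau>_meas[OF j]
  show "integrable M (\<lambda>\<omega>. fourier_char k (\<tau> j \<omega>))"
    by (rule integrable_const_bound[where B = 1]) auto
  have D: "distr M lborel (\<tau> j) = density lborel (\<lambda>x. ennreal (g x))"
    using model j by (auto simp: shifted_curves_model_def distributed_def)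
  have gm: "g \<in> borel_measurable lborel" "\<And>x. 0 \<le> g x" using g by (auto simp: prob_density_def)
  have "expectation (\<lambda>\<omega>. fourier_char k (\<tau> j \<omega>)) = (\<integral>x. fourier_char k x \<partial>distr M lborel (\<tau> j))"
    by (subst integral_distr) auto
  also have "\<dots> = (\<integral>x. g x *\<^sub>R fourier_char k x \<partial>lborel)"
    unfolding D using gm by (subst integral_density) auto
  also have "\<dots> = \<Gamma> k"
    unfolding shift_coeff_def by (intro Bochner_Integration.integral_cong) (auto simp: scaleR_conv_of_real)
  finally show "expectation (\<lambda>\<omega>. fourier_char k (\<tau> j \<omega>)) = \<Gamma> k" .
qed

lemma \<delta>_le: "(cmod (\<delta> k \<omega>))\<^sup>2 \<le> 4 * (1 / (cmod (\<Gamma> k))\<^sup>2)"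
proof -
  have G: "0 < cmod (\<Gamma> k)" "cmod (\<Gamma> k) \<le> 1" using \<Gamma>_nz shift_coeff_norm_le[OF g] by auto
  have "cmod (\<Sum>j\<in>{1..n}. fourier_char k (\<tau> j \<omega>)) \<le> (\<Sum>j\<in>{1..n}. 1)"
    by (rule order_trans[OF norm_sum]) simp
  hence "cmod ((1 / of_nat n) * (\<Sum>j\<in>{1..n}. fourier_char k (\<tau> j \<omega>))) \<le> 1"
    using n by (simp add: norm_mult norm_divide)
  hence "cmod ((1 / of_nat n) * (\<Sum>j\<in>{1..n}. fourier_char k (\<tau> j \<omega>)) / \<Gamma> k) \<le> 1 / cmod (\<Gamma> k)"
    unfolding norm_divide by (intro divide_right_mono) auto
  hence "cmod (\<delta> k \<omega>) \<le> 1 / cmod (\<Gamma> k) + 1"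
    unfolding \<delta>_def by (intro order_trans[OF norm_triangle_ineq4]) simp
  also have "\<dots> \<le> 2 / cmod (\<Gamma> k)" using G by (simp add: field_simps)
  finally have "(cmod (\<delta> k \<omega>))\<^sup>2 \<le> (2 / cmod (\<Gamma> k))\<^sup>2" by (intro power_mono) auto
  thus ?thesis by (simp add: power_divide)
qed

lemma \<tau>_indep: "indep_vars (\<lambda>_. borel) \<tau> {1..n}"
  using model by (simp add: shifted_curves_model_def)

text \<open>The centred variables \<open>Y j\<close> are orthogonal by pairwise independence, and
  since characters have modulus one each has variance
  \<open>1 - (cmod (\<Gamma> k))\<^sup>2\<close>.\<close>

lemma \<delta>_var: "expectation (\<lambda>\<omega>. (cmod (\<delta> k \<omega>))\<^sup>2) \<le> (1 / (cmod (\<Gamma> k))\<^sup>2 - 1) / real n"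
proof -
  define Y where "Y j \<omega> = fourier_char k (\<tau> j \<omega>) - \<Gamma> k" for j \<omega>
  have Yb: "cmod (Y j \<omega>) \<le> 2" for j \<omega>
    unfolding Y_def using shift_coeff_norm_le[OF g, of k]
    by (intro order_trans[OF norm_triangle_ineq4]) simp
  have [measurable]: "Y j \<in> borel_measurable M" if "j \<in> {1..n}" for j
    unfolding Y_def using measurable_compose[OF \<tau>_meas[OF that] fourier_char_measurable] by measurable
  have cnj_m [measurable]: "cnj \<in> borel_measurable borel"
    by (intro borel_measurable_continuous_onI continuous_intros)
  have int: "integrable M (\<lambda>\<omega>. Y i \<omega> * cnj (Y j \<omega>))" if "i \<in> {1..n}" "j \<in> {1..n}" for i j
  proof (rule integrable_const_bound[where B = 4])
    note [measurable] = that
    show "(\<lambda>\<omega>. Y i \<omega> * cnj (Y j \<omega>)) \<in> borel_measurable M"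
      using that by measurable
    have "cmod (Y i \<omega>) * cmod (Y j \<omega>) \<le> 2 * 2" for \<omega> by (intro mult_mono Yb) auto
    thus "AE \<omega> in M. norm (Y i \<omega> * cnj (Y j \<omega>)) \<le> 4" by (auto simp: norm_mult)
  qed
  have EY: "expectation (Y j) = 0" if "j \<in> {1..n}" for j
    unfolding Y_def using \<tau>_expectation[OF that, of k] by (simp add: prob_space)
  have off: "expectation (\<lambda>\<omega>. Y i \<omega> * cnj (Y j \<omega>)) = 0" if "i \<in> {1..n}" "j \<in> {1..n}" "i \<noteq> j" for i j
  proof -
    \<comment> \<open>The conjugate is built into the function for the second index, so that the
      product rule for independent variables applies to the two-element set.\<close>
    define h where "h l t = (if l = i then fourier_char k t - \<Gamma> k else cnj (fourier_char k t - \<Gamma> k))" for l :: nat and t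
    have hm: "h l \<in> borel_measurable borel" for l unfolding h_def by measurable
    have ind: "indep_vars (\<lambda>_. borel) (\<lambda>l \<omega>. h l (\<tau> l \<omega>)) {i, j}"
      using indep_vars_compose2[OF indep_vars_subset[OF \<tau>_indep, of "{i, j}"], of h "\<lambda>_. borel"] that hm by auto
    have inth: "integrable M (\<lambda>\<omega>. h l (\<tau> l \<omega>))" if "l \<in> {i, j}" for l
    proof (rule integrable_const_bound[where B = 2])
      have "l \<in> {1..n}" using that \<open>i \<in> {1..n}\<close> \<open>j \<in> {1..n}\<close> by auto
      show "(\<lambda>\<omega>. h l (\<tau> l \<omega>)) \<in> borel_measurable M"
        by (rule measurable_compose[OF \<tau>_meas[OF \<open>l \<in> {1..n}\<close>] hm])
      have "cmod (h l (\<tau> l \<omega>)) \<le> 2" for \<omega>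
        using Yb[of l \<omega>] unfolding h_def Y_def by (auto simp del: complex_cnj_diff)
      thus "AE \<omega> in M. norm (h l (\<tau> l \<omega>)) \<le> 2" by simp
    qed
    have "expectation (\<lambda>\<omega>. \<Prod>l\<in>{i, j}. h l (\<tau> l \<omega>)) = (\<Prod>l\<in>{i, j}. expectation (\<lambda>\<omega>. h l (\<tau> l \<omega>)))"
      by (rule indep_vars_lebesgue_integral[OF _ ind inth]) auto
    moreover have "(\<Prod>l\<in>{i, j}. h l (\<tau> l \<omega>)) = Y i \<omega> * cnj (Y j \<omega>)" for \<omega>
      using \<open>i \<noteq> j\<close> by (simp add: h_def Y_def)
    moreover have "expectation (\<lambda>\<omega>. h i (\<tau> i \<omega>)) = 0" using EY[OF that(1)] by (simp add: h_def Y_def[abs_def])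
    ultimately show ?thesis using \<open>i \<noteq> j\<close> by simp
  qed
  have diag: "expectation (\<lambda>\<omega>. Y j \<omega> * cnj (Y j \<omega>)) = of_real (1 - (cmod (\<Gamma> k))\<^sup>2)" if j: "j \<in> {1..n}" for j
  proof -
    let ?e = "\<lambda>\<omega>. fourier_char k (\<tau> j \<omega>)"
    note i = \<tau>_expectation[OF j, of k]
    have "Y j \<omega> * cnj (Y j \<omega>) = 1 - ?e \<omega> * cnj (\<Gamma> k) - \<Gamma> k * cnj (?e \<omega>) + \<Gamma> k * cnj (\<Gamma> k)" for \<omega>
    proof -
      have "?e \<omega> * cnj (?e \<omega>) = 1" by (simp add: complex_norm_square[symmetric])
      thus ?thesis by (simp add: Y_def algebra_simps)
    qed
    hence "expectation (\<lambda>\<omega>. Y j \<omega> * cnj (Y j \<omega>)) =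
      expectation (\<lambda>\<omega>. 1 - ?e \<omega> * cnj (\<Gamma> k) - \<Gamma> k * cnj (?e \<omega>) + \<Gamma> k * cnj (\<Gamma> k))" by simp
    also have "\<dots> = 1 - \<Gamma> k * cnj (\<Gamma> k) - \<Gamma> k * cnj (\<Gamma> k) + \<Gamma> k * cnj (\<Gamma> k)"
      using i by (simp add: prob_space)
    also have "\<dots> = of_real (1 - (cmod (\<Gamma> k))\<^sup>2)" by (simp add: complex_norm_square[symmetric])
    finally show ?thesis .
  qed
  have \<delta>Y: "\<delta> k \<omega> = (\<Sum>j\<in>{1..n}. Y j \<omega>) / (of_nat n * \<Gamma> k)" for \<omega>
    using n \<Gamma>_nz by (simp add: \<delta>_def Y_def sum_subtractf diff_divide_distrib)
  have sq: "of_real ((cmod (\<delta> k \<omega>))\<^sup>2) = (\<Sum>i\<in>{1..n}. \<Sum>j\<in>{1..n}. Y i \<omega> * cnj (Y j \<omega>)) / of_real ((real n * cmod (\<Gamma> k))\<^sup>2)" for \<omega>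
  proof -
    have den: "of_nat n * \<Gamma> k * cnj (of_nat n * \<Gamma> k) = complex_of_real ((real n * cmod (\<Gamma> k))\<^sup>2)"
      unfolding complex_norm_square[symmetric] by (simp add: norm_mult)
    have "complex_of_real ((cmod (\<delta> k \<omega>))\<^sup>2) = (\<Sum>j\<in>{1..n}. Y j \<omega>) * cnj (\<Sum>j\<in>{1..n}. Y j \<omega>) / (of_nat n * \<Gamma> k * cnj (of_nat n * \<Gamma> k))"
      unfolding complex_norm_square \<delta>Y by (simp only: complex_cnj_divide times_divide_times_eq)
    thus ?thesis unfolding den by (simp only: cnj_sum sum_product)
  qed
  have "of_real (expectation (\<lambda>\<omega>. (cmod (\<delta> k \<omega>))\<^sup>2)) = expectation (\<lambda>\<omega>. complex_of_real ((cmod (\<delta> k \<omega>))\<^sup>2))"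
    by (rule integral_complex_of_real[symmetric])
  also have "\<dots> = expectation (\<lambda>\<omega>. \<Sum>i\<in>{1..n}. \<Sum>j\<in>{1..n}. Y i \<omega> * cnj (Y j \<omega>)) / of_real ((real n * cmod (\<Gamma> k))\<^sup>2)"
    unfolding sq by (rule integral_divide_zero)
  also have "expectation (\<lambda>\<omega>. \<Sum>i\<in>{1..n}. \<Sum>j\<in>{1..n}. Y i \<omega> * cnj (Y j \<omega>)) =
    (\<Sum>i\<in>{1..n}. \<Sum>j\<in>{1..n}. expectation (\<lambda>\<omega>. Y i \<omega> * cnj (Y j \<omega>)))"
    by (subst Bochner_Integration.integral_sum, intro Bochner_Integration.integrable_sum int, assumption+,
      intro sum.cong refl, subst Bochner_Integration.integral_sum) (auto intro: int)
  also have "\<dots> = (\<Sum>i\<in>{1..n}. \<Sum>j\<in>{1..n}. if j = i then of_real (1 - (cmod (\<Gamma> k))\<^sup>2) else 0)"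
    by (intro sum.cong refl) (simp add: diag off)
  also have "\<dots> = of_real (real n * (1 - (cmod (\<Gamma> k))\<^sup>2))" by simp
  finally have "complex_of_real (expectation (\<lambda>\<omega>. (cmod (\<delta> k \<omega>))\<^sup>2)) =
    of_real (real n * (1 - (cmod (\<Gamma> k))\<^sup>2) / (real n * cmod (\<Gamma> k))\<^sup>2)" by (simp only: of_real_divide)
  hence "expectation (\<lambda>\<omega>. (cmod (\<delta> k \<omega>))\<^sup>2) = real n * (1 - (cmod (\<Gamma> k))\<^sup>2) / (real n * cmod (\<Gamma> k))\<^sup>2"
    by (simp only: of_real_eq_iff)
  also have "\<dots> = (1 / (cmod (\<Gamma> k))\<^sup>2 - 1) / real n"
    using n \<Gamma>_nz[of k] by (simp add: field_simps power2_eq_square)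
  finally show ?thesis by simp
qed

text \<open>Hoeffding's inequality for the real and the imaginary part, each at level
  \<open>x / 2\<close>; the summands lie between \<open>- r\<close> and \<open>r\<close> with
  \<open>r = 1 / cmod (\<Gamma> k)\<close>.\<close>

lemma \<delta>_deviation:
  assumes x: "0 < x"
  shows "prob {\<omega>\<in>space M. x < cmod (\<delta> k \<omega>)} \<le> 4 * exp (- (real n * x\<^sup>2 * (cmod (\<Gamma> k))\<^sup>2 / 8))"
proof -
  \<comment> \<open>Multiplication by \<open>a = 1\<close> and \<open>a = - \<i>\<close> extracts
    the real and the imaginary part, so one bound covers both.\<close>
  define V where "V a j \<omega> = Re (a * (fourier_char k (\<tau> j \<omega>) / \<Gamma> k))" for a :: complex and j :: nat and \<omega>
  define r where "r = 1 / cmod (\<Gamma> k)"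
  have r: "0 < r" using \<Gamma>_nz by (simp add: r_def)
  have H: "prob {\<omega>\<in>space M. real n * x / 2 \<le> \<bar>(\<Sum>j\<in>{1..n}. V a j \<omega>) - real n * Re a\<bar>} \<le>
    2 * exp (- (real n * x\<^sup>2 * (cmod (\<Gamma> k))\<^sup>2 / 8))" if a: "cmod a = 1" for a
  proof -
    have cm: "(\<lambda>t. Re (a * (fourier_char k t / \<Gamma> k))) \<in> borel_measurable borel" by measurable
    have ind: "indep_vars (\<lambda>_. borel) (V a) {1..n}"
      unfolding V_def[abs_def] by (rule indep_vars_compose2[OF \<tau>_indep]) (rule cm)
    have EV: "expectation (V a j) = Re a" if j: "j \<in> {1..n}" for j
    proof -
      have "integrable M (\<lambda>\<omega>. a * (fourier_char k (\<tau> j \<omega>) / \<Gamma> k))"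
        using \<tau>_expectation[OF j, of k] by (intro integrable_mult_right integrable_divide) auto
      hence "expectation (V a j) = Re (expectation (\<lambda>\<omega>. a * (fourier_char k (\<tau> j \<omega>) / \<Gamma> k)))"
        unfolding V_def by (rule integral_Re)
      also have "\<dots> = Re a" using \<tau>_expectation[OF j, of k] \<Gamma>_nz[of k] by simp
      finally show ?thesis .
    qed
    interpret Hoeffding_ineq M "{1..n}" "V a" "\<lambda>_. - r" "\<lambda>_. r" "real n * Re a"
    proof unfold_locales
      show "AE \<omega> in M. V a j \<omega> \<in> {- r..r}" for j
      proof (rule AE_I2)
        fix \<omega>
        have "\<bar>V a j \<omega>\<bar> \<le> r"
          unfolding V_def r_def using abs_Re_le_cmod[of "a * (fourier_char k (\<tau> j \<omega>) / \<Gamma> k)"] a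
          by (simp add: norm_mult norm_divide)
        thus "V a j \<omega> \<in> {- r..r}" by auto
      qed
      show "real n * Re a \<equiv> \<Sum>j\<in>{1..n}. expectation (V a j)"
        by (rule eq_reflection) (simp add: EV)
    qed (use ind in auto)
    have sum: "(\<Sum>i\<in>{1..n}. (r - - r)\<^sup>2) = real n * 4 * r\<^sup>2" by (simp add: power2_eq_square)
    have "prob {\<omega>\<in>space M. real n * x / 2 \<le> \<bar>(\<Sum>j\<in>{1..n}. V a j \<omega>) - real n * Re a\<bar>} \<le>
      2 * exp (- 2 * (real n * x / 2)\<^sup>2 / (\<Sum>i\<in>{1..n}. (r - - r)\<^sup>2))"
      by (rule Hoeffding_ineq_abs_ge) (use x n r in \<open>auto simp: sum\<close>)
    also have "- 2 * (real n * x / 2)\<^sup>2 / (\<Sum>i\<in>{1..n}. (r - - r)\<^sup>2) = - (real n * x\<^sup>2 * (cmod (\<Gamma> k))\<^sup>2 / 8)"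
      unfolding sum using n \<Gamma>_nz[of k] by (simp add: r_def power_divide power_mult_distrib) (simp add: field_simps power2_eq_square)
    finally show ?thesis .
  qed
  have sub: "{\<omega>\<in>space M. x < cmod (\<delta> k \<omega>)} \<subseteq>
    {\<omega>\<in>space M. real n * x / 2 \<le> \<bar>(\<Sum>j\<in>{1..n}. V 1 j \<omega>) - real n * Re 1\<bar>} \<union>
    {\<omega>\<in>space M. real n * x / 2 \<le> \<bar>(\<Sum>j\<in>{1..n}. V (- \<i>) j \<omega>) - real n * Re (- \<i>)\<bar>}"
  proof
    fix \<omega> assume \<omega>: "\<omega> \<in> {\<omega>\<in>space M. x < cmod (\<delta> k \<omega>)}"
    define s where "s = (\<Sum>j\<in>{1..n}. fourier_char k (\<tau> j \<omega>)) / \<Gamma> k - of_nat n"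
    have s: "s = of_nat n * \<delta> k \<omega>" using n by (simp add: s_def \<delta>_def right_diff_distrib)
    have "real n * x < cmod s" using \<omega> n by (simp add: s norm_mult)
    also have "cmod s \<le> \<bar>Re s\<bar> + \<bar>Im s\<bar>" by (rule cmod_le)
    finally have "real n * x / 2 \<le> \<bar>Re s\<bar> \<or> real n * x / 2 \<le> \<bar>Im s\<bar>" by linarith
    moreover have "Re s = (\<Sum>j\<in>{1..n}. V 1 j \<omega>) - real n * Re 1"
      by (simp add: s_def V_def sum_divide_distrib)
    moreover have "Im s = (\<Sum>j\<in>{1..n}. V (- \<i>) j \<omega>) - real n * Re (- \<i>)"
    proof -
      have aux: "Re (- \<i> * z) = Im z" for z by simp
      show ?thesis unfolding V_def aux by (simp add: s_def sum_divide_distrib)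
    qed
    ultimately show "\<omega> \<in> {\<omega>\<in>space M. real n * x / 2 \<le> \<bar>(\<Sum>j\<in>{1..n}. V 1 j \<omega>) - real n * Re 1\<bar>} \<union>
      {\<omega>\<in>space M. real n * x / 2 \<le> \<bar>(\<Sum>j\<in>{1..n}. V (- \<i>) j \<omega>) - real n * Re (- \<i>)\<bar>}"
      using \<omega> by auto
  qed
  have V_meas: "V a j \<in> borel_measurable M" if "j \<in> {1..n}" for a j
    unfolding V_def
    by (rule measurable_compose[OF \<tau>_meas[OF that], of "\<lambda>t. Re (a * (fourier_char k t / \<Gamma> k))"]) measurable
  have ev: "{\<omega>\<in>space M. real n * x / 2 \<le> \<bar>(\<Sum>j\<in>{1..n}. V a j \<omega>) - real n * Re a\<bar>} \<in> events" for a
  proof -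
    have "(\<lambda>\<omega>. \<Sum>j\<in>{1..n}. V a j \<omega>) \<in> borel_measurable M" by (intro borel_measurable_sum V_meas)
    thus ?thesis by measurable
  qed
  have "prob {\<omega>\<in>space M. x < cmod (\<delta> k \<omega>)} \<le>
    prob ({\<omega>\<in>space M. real n * x / 2 \<le> \<bar>(\<Sum>j\<in>{1..n}. V 1 j \<omega>) - real n * Re 1\<bar>} \<union>
    {\<omega>\<in>space M. real n * x / 2 \<le> \<bar>(\<Sum>j\<in>{1..n}. V (- \<i>) j \<omega>) - real n * Re (- \<i>)\<bar>})"
    by (intro finite_measure_mono sub sets.Un ev)
  also have "\<dots> \<le> 2 * exp (- (real n * x\<^sup>2 * (cmod (\<Gamma> k))\<^sup>2 / 8)) + 2 * exp (- (real n * x\<^sup>2 * (cmod (\<Gamma> k))\<^sup>2 / 8))"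
    by (intro order_trans[OF measure_Un_le] add_mono H ev) auto
  finally show ?thesis by simp
qed

end

section \<open>Gaussianity of the averaged noise\<close>

lemma integral_hartley_square:
  fixes b :: "int \<Rightarrow> real"
  assumes K: "finite K"
  shows "(LBINT x:{0..1}. (\<Sum>k\<in>K. b k * (Re (fourier_char k x) + Im (fourier_char k x)))\<^sup>2) = (\<Sum>k\<in>K. (b k)\<^sup>2)"
proof -
  define \<psi> where "\<psi> k x = Re (fourier_char k x) + Im (fourier_char k x)" for k x
  \<comment> \<open>The product of two Hartley functions splits into the frequencies
    \<open>k - l\<close> and \<open>k + l\<close>. The imaginary part integrates to zero even when
    \<open>k + l = 0\<close>, so the functions at \<open>k\<close> and \<open>- k\<close> are
    orthogonal for \<open>k \<noteq> 0\<close>.\<close>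
  have prod: "\<psi> k x * \<psi> l x = Re (fourier_char (k - l) x) + Im (fourier_char (k + l) x)" for k l x
  proof -
    have "fourier_char (k - l) x = fourier_char k x * cnj (fourier_char l x)"
      using fourier_char_mult[of k x "- l"] by (simp add: fourier_char_uminus)
    moreover have "fourier_char (k + l) x = fourier_char k x * fourier_char l x" by (simp add: fourier_char_mult)
    ultimately show ?thesis by (simp add: \<psi>_def algebra_simps)
  qed
  have int: "integrable unit_lborel (\<lambda>x. Re (fourier_char k x))" "integrable unit_lborel (\<lambda>x. Im (fourier_char k x))" for k
    using integrable_fourier_char[of k] by auto
  have ip: "integrable unit_lborel (\<lambda>x. b k * b l * (\<psi> k x * \<psi> l x))" for k l
    unfolding prod by (intro integrable_mult_right Bochner_Integration.integrable_add int)
  have "(LBINT x:{0..1}. (\<Sum>k\<in>K. b k * \<psi> k x)\<^sup>2) = (\<integral>x. (\<Sum>k\<in>K. \<Sum>l\<in>K. b k * b l * (\<psi> k x * \<psi> l x)) \<partial>unit_lborel)"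
    unfolding set_integral_unit_lborel by (simp add: power2_eq_square sum_product mult_ac)
  also have "\<dots> = (\<Sum>k\<in>K. \<Sum>l\<in>K. \<integral>x. b k * b l * (\<psi> k x * \<psi> l x) \<partial>unit_lborel)"
    by (simp only: Bochner_Integration.integral_sum Bochner_Integration.integrable_sum ip)
  also have "\<dots> = (\<Sum>k\<in>K. \<Sum>l\<in>K. if l = k then (b k)\<^sup>2 else 0)"
  proof (intro sum.cong refl)
    fix k l
    have i: "(\<integral>x. \<psi> k x * \<psi> l x \<partial>unit_lborel) = (if l = k then 1 else 0)"
      unfolding prod by (simp add: Bochner_Integration.integral_add[OF int] integral_Re_Im_fourier_char)
    thus "(\<integral>x. b k * b l * (\<psi> k x * \<psi> l x) \<partial>unit_lborel) = (if l = k then (b k)\<^sup>2 else 0)"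
      unfolding integral_mult_right_zero i by (simp add: power2_eq_square)
  qed
  also have "\<dots> = (\<Sum>k\<in>K. (b k)\<^sup>2)" using K by simp
  finally show ?thesis by (simp add: \<psi>_def)
qed

context curves_model
begin

lemma brownian: "j \<in> {1..n} \<Longrightarrow> brownian_motion01 M (Wn j)"
  using model by (simp add: shifted_curves_model_def)

text \<open>Frequencies are indexed through \<open>q\<close> so that \<open>k\<close> and
  \<open>- k\<close> remain two indices even when \<open>k = 0\<close>.\<close>

lemma char_noise:
  fixes q :: "'k \<Rightarrow> int"
  assumes "finite K"
  shows "char (distr M borel (\<lambda>\<omega>. \<Sum>j\<in>{1..n}. \<Sum>k\<in>K. Re (a k * noise j (q k) \<omega>))) u =
    of_real (exp (- (u\<^sup>2 * (real n * (LBINT x:{0..1}. (\<Sum>k\<in>K. Re (a k * fourier_char (q k) x))\<^sup>2)) / 2)))"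
proof -
  have "indep_vars (\<lambda>_. Pi\<^sub>M {0..1} (\<lambda>_. borel)) (\<lambda>j \<omega>. \<lambda>t\<in>{0..1}. Wn j t \<omega>) {1..n}"
    using model by (simp add: shifted_curves_model_def)
  from char_wiener_lincomb[OF prob_space_axioms _ assms brownian this, where \<phi> = "\<lambda>k. fourier_char (q k)" and
      I = "\<lambda>j k. noise j (q k)" and a = a and u = u]
  show ?thesis using noise(1) by simp
qed

lemma noise_sum_meas:
  "(\<lambda>\<omega>. \<Sum>j\<in>{1..n}. \<Sum>k\<in>K. Re (a k * noise j (q k) \<omega>)) \<in> borel_measurable M"
  by (intro borel_measurable_sum measurable_compose[OF _ borel_measurable_Re] borel_measurable_times
    borel_measurable_const noise_meas)

lemma hartley_noise:
  fixes b :: "int \<Rightarrow> real"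
  assumes K: "finite K"
  defines "X \<equiv> (\<lambda>\<omega>. \<Sum>k\<in>K. b k * (Re (\<xi> k \<omega>) + Im (\<xi> k \<omega>)))"
  shows "(\<integral>\<^sup>+ \<omega>. ennreal (exp (X \<omega>)) \<partial>M) = ennreal (exp ((\<Sum>k\<in>K. (b k)\<^sup>2) / 2))"
    and "integrable M (\<lambda>\<omega>. (X \<omega>)\<^sup>2)" and "expectation (\<lambda>\<omega>. (X \<omega>)\<^sup>2) = (\<Sum>k\<in>K. (b k)\<^sup>2)"
proof -
  define s where "s = sqrt (real n)"
  have s: "s > 0" "s\<^sup>2 = real n" using n by (auto simp: s_def)
  \<comment> \<open>Multiplication by \<open>1 - \<i>\<close> turns the real part into
    \<open>Re + Im\<close>; division by \<open>s\<close> standardises the sum over the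
    \<open>n\<close> curves.\<close>
  define a where "a k = of_real (b k / s) * (1 - \<i>)" for k
  have Re_a: "Re (a k * z) = b k / s * (Re z + Im z)" for k z
    unfolding a_def mult.assoc times_complex.sel(1)[of "of_real _"] by simp
  have X: "X \<omega> = (\<Sum>j\<in>{1..n}. \<Sum>k\<in>K. Re (a k * noise j k \<omega>))" for \<omega>
  proof -
    have "(\<Sum>j\<in>{1..n}. \<Sum>k\<in>K. Re (a k * noise j k \<omega>)) = (\<Sum>k\<in>K. \<Sum>j\<in>{1..n}. b k / s * (Re (noise j k \<omega>) + Im (noise j k \<omega>)))"
      unfolding Re_a by (rule sum.swap)
    also have "\<dots> = X \<omega>" unfolding X_def
    proof (intro sum.cong refl)
      fix k
      have "Re (\<xi> k \<omega>) + Im (\<xi> k \<omega>) = ((\<Sum>j\<in>{1..n}. Re (noise j k \<omega>)) + (\<Sum>j\<in>{1..n}. Im (noise j k \<omega>))) / s"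
        by (simp add: \<xi>_def s_def add_divide_distrib)
      moreover have "(\<Sum>j\<in>{1..n}. b k / s * (Re (noise j k \<omega>) + Im (noise j k \<omega>))) =
        b k / s * ((\<Sum>j\<in>{1..n}. Re (noise j k \<omega>)) + (\<Sum>j\<in>{1..n}. Im (noise j k \<omega>)))"
        by (simp only: sum_distrib_left[symmetric] sum.distrib)
      ultimately show "(\<Sum>j\<in>{1..n}. b k / s * (Re (noise j k \<omega>) + Im (noise j k \<omega>))) = b k * (Re (\<xi> k \<omega>) + Im (\<xi> k \<omega>))"
        by simp
    qed
    finally show ?thesis by simp
  qed
  have v: "real n * (LBINT x:{0..1}. (\<Sum>k\<in>K. Re (a k * fourier_char k x))\<^sup>2) = (\<Sum>k\<in>K. (b k)\<^sup>2)"
  proof -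
    have "(LBINT x:{0..1}. (\<Sum>k\<in>K. Re (a k * fourier_char k x))\<^sup>2) = (\<Sum>k\<in>K. (b k / s)\<^sup>2)"
      unfolding Re_a by (rule integral_hartley_square[OF K])
    also have "\<dots> = (\<Sum>k\<in>K. (b k)\<^sup>2) / real n" by (simp add: power_divide s sum_divide_distrib)
    finally show ?thesis using n by simp
  qed
  have char: "char (distr M borel X) u = of_real (exp (- (u\<^sup>2 * (\<Sum>k\<in>K. (b k)\<^sup>2) / 2)))" for u
    using char_noise[OF K, of a "\<lambda>k. k" u] unfolding X v .
  have m: "X \<in> borel_measurable M" using noise_sum_meas[of a "\<lambda>k. k" K] unfolding X .
  have nn: "0 \<le> (\<Sum>k\<in>K. (b k)\<^sup>2)" by (simp add: sum_nonneg)
  note G = gaussian_of_char[OF m nn char]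
  show "(\<integral>\<^sup>+ \<omega>. ennreal (exp (X \<omega>)) \<partial>M) = ennreal (exp ((\<Sum>k\<in>K. (b k)\<^sup>2) / 2))"
    "integrable M (\<lambda>\<omega>. (X \<omega>)\<^sup>2)" "expectation (\<lambda>\<omega>. (X \<omega>)\<^sup>2) = (\<Sum>k\<in>K. (b k)\<^sup>2)"
    using G by auto
qed

text \<open>Versions of Wiener integrals are determined only up to null sets, so the symmetry cannot
  be read off pointwise. The real and imaginary parts of
  \<open>\<xi> (- k) \<omega> - cnj (\<xi> k \<omega>)\<close> are linear forms with vanishing
  integrand, hence Gaussian with variance 0.\<close>

lemma \<xi>_sym: "AE \<omega> in M. \<forall>k. \<xi> (- k) \<omega> = cnj (\<xi> k \<omega>)"
  unfolding AE_all_countable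
proof
  fix k :: int
  define q where "q = (\<lambda>b. if b then k else - k)"
  have null: "AE \<omega> in M. (\<Sum>j\<in>{1..n}. \<Sum>b\<in>UNIV. Re (a b * noise j (q b) \<omega>)) = 0"
    if a: "\<And>x. (\<Sum>b\<in>UNIV. Re (a b * fourier_char (q b) x)) = 0" for a :: "bool \<Rightarrow> complex"
  proof (rule gaussian_of_char(4)[OF noise_sum_meas, of 0])
    fix u
    show "char (distr M borel (\<lambda>\<omega>. \<Sum>j\<in>{1..n}. \<Sum>b\<in>UNIV. Re (a b * noise j (q b) \<omega>))) u = of_real (exp (- (u\<^sup>2 * 0 / 2)))"
      using char_noise[of UNIV a q u] unfolding a by simp
  qed auto
  have "AE \<omega> in M. (\<Sum>j\<in>{1..n}. \<Sum>b\<in>UNIV. Re ((if b then - 1 else 1) * noise j (q b) \<omega>)) = 0"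
    by (rule null) (simp add: UNIV_bool q_def fourier_char_uminus)
  moreover have "AE \<omega> in M. (\<Sum>j\<in>{1..n}. \<Sum>b\<in>UNIV. Re (- \<i> * noise j (q b) \<omega>)) = 0"
    by (rule null) (simp add: UNIV_bool q_def fourier_char_uminus)
  ultimately show "AE \<omega> in M. \<xi> (- k) \<omega> = cnj (\<xi> k \<omega>)"
  proof eventually_elim
    case (elim \<omega>)
    have "(\<Sum>j\<in>{1..n}. Re (noise j (- k) \<omega>)) = (\<Sum>j\<in>{1..n}. Re (noise j k \<omega>))"
      using elim(1) by (simp add: UNIV_bool q_def sum_subtractf)
    moreover have "(\<Sum>j\<in>{1..n}. Im (noise j (- k) \<omega>)) = - (\<Sum>j\<in>{1..n}. Im (noise j k \<omega>))"
      using elim(2) by (simp add: UNIV_bool q_def sum.distrib)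
    ultimately show ?case by (simp add: \<xi>_def complex_eq_iff sum_negf)
  qed
qed

lemma gauss: "gaussian_sequence M (\<lambda>k \<omega>. Re (\<xi> k \<omega>) + Im (\<xi> k \<omega>))"
proof
  show "(\<lambda>\<omega>. Re (\<xi> k \<omega>) + Im (\<xi> k \<omega>)) \<in> borel_measurable M" for k
    using \<xi>_meas[of k] by measurable
qed (simp add: hartley_noise(1))

lemma x2:
  "integrable M (\<lambda>\<omega>. (Re (\<xi> k \<omega>) + Im (\<xi> k \<omega>))\<^sup>2)"
  "expectation (\<lambda>\<omega>. (Re (\<xi> k \<omega>) + Im (\<xi> k \<omega>))\<^sup>2) = 1"
  using hartley_noise(2,3)[of "{k}" "\<lambda>_. 1"] by auto

section \<open>Orthogonality of shift errors and noise\<close>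

lemma \<delta>_bound: "cmod (\<delta> k \<omega>) \<le> 2 / cmod (\<Gamma> k)"
  by (rule power2_le_imp_le) (use \<delta>_le[of k \<omega>] in \<open>auto simp: power_divide\<close>)

lemma \<delta>_increment:
  assumes j: "j \<in> {1..n}" and ab: "0 \<le> a" "a \<le> b" "b \<le> 1"
  shows "integrable M (\<lambda>\<omega>. \<delta> k \<omega> * of_real (Wn j b \<omega> - Wn j a \<omega>))"
    "expectation (\<lambda>\<omega>. \<delta> k \<omega> * of_real (Wn j b \<omega> - Wn j a \<omega>)) = 0"
proof -
  have "integrable M (\<lambda>\<omega>. \<delta> k \<omega> * of_real (Wn j b \<omega> - Wn j a \<omega>)) \<and>
    expectation (\<lambda>\<omega>. \<delta> k \<omega> * of_real (Wn j b \<omega> - Wn j a \<omega>)) = 0"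
  \<comment> \<open>\<open>brownian_motion01\<close> gives a distribution only to increments over
    nondegenerate intervals.\<close>
  proof (cases "a = b")
    case False
    hence less: "a < b" using ab by simp
    have D: "distributed M lborel (\<lambda>\<omega>. Wn j b \<omega> - Wn j a \<omega>) (normal_density 0 (sqrt (b - a)))"
      using brownian[OF j] less ab unfolding brownian_motion01_def by blast
    have m: "(\<lambda>\<omega>. Wn j b \<omega> - Wn j a \<omega>) \<in> borel_measurable M" using D by (simp add: distributed_def)
    have "char (distr M borel (\<lambda>\<omega>. Wn j b \<omega> - Wn j a \<omega>)) u = of_real (exp (- (u\<^sup>2 * (b - a) / 2)))" for u
      using char_normal_scaled[OF D, of 1 u] less by simp
    from gaussian_of_char(2)[OF m _ this] have "integrable M (\<lambda>\<omega>. (Wn j b \<omega> - Wn j a \<omega>)\<^sup>2)" using less by simp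
    hence int: "integrable M (\<lambda>\<omega>. Wn j b \<omega> - Wn j a \<omega>)" by (rule square_integrable_imp_integrable[OF m])
    have E0: "expectation (\<lambda>\<omega>. Wn j b \<omega> - Wn j a \<omega>) = 0"
      by (rule normal_distributed_expectation[OF _ D]) (use less in simp)
    define fn where "fn p = (1 / of_nat n) * (\<Sum>i\<in>{1..n}. fourier_char k (p i)) / \<Gamma> k - 1" for p :: "nat \<Rightarrow> real"
    have fm: "fn \<in> borel_measurable (Pi\<^sub>M {1..n} (\<lambda>_. borel))"
    proof -
      have "(\<lambda>p. fourier_char k (p i)) \<in> borel_measurable (Pi\<^sub>M {1..n} (\<lambda>_. borel))" if "i \<in> {1..n}" for i
        by (rule measurable_compose[OF measurable_component_singleton[OF that] fourier_char_measurable])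
      thus ?thesis unfolding fn_def
        by (intro borel_measurable_diff borel_measurable_divide borel_measurable_times borel_measurable_sum) auto
    qed
    define gn where "gn p = complex_of_real (p (j, b) - p (j, a))" for p :: "nat \<times> real \<Rightarrow> real"
    have gm: "gn \<in> borel_measurable (Pi\<^sub>M ({1..n} \<times> {0..1}) (\<lambda>_. borel))"
    proof -
      have "(\<lambda>p. p (j, b) - p (j, a)) \<in> borel_measurable (Pi\<^sub>M ({1..n} \<times> {0..1}) (\<lambda>_. borel :: real measure))"
        using j ab less by (intro borel_measurable_diff measurable_component_singleton) auto
      thus ?thesis unfolding gn_def by measurable
    qed
    define X where "X = (\<lambda>\<omega>. \<lambda>i\<in>{1..n}. \<tau> i \<omega>)"
    define Y where "Y = (\<lambda>\<omega>. \<lambda>(i, t)\<in>{1..n} \<times> {0..1}. Wn i t \<omega>)"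
    have ind: "indep_set (sets (vimage_algebra (space M) X (Pi\<^sub>M {1..n} (\<lambda>_. borel))))
       (sets (vimage_algebra (space M) Y (Pi\<^sub>M ({1..n} \<times> {0..1}) (\<lambda>_. borel))))"
      using model unfolding shifted_curves_model_def X_def Y_def by blast
    have "indep_var borel (\<lambda>\<omega>. fn (X \<omega>)) borel (\<lambda>\<omega>. gn (Y \<omega>))"
      by (rule indep_var_vimage_algebra[OF ind _ _ fm gm]) (auto simp: X_def Y_def space_PiM PiE_def extensional_def)
    moreover have "(\<lambda>\<omega>. fn (X \<omega>)) = \<delta> k" by (auto simp: fn_def X_def \<delta>_def fun_eq_iff intro!: sum.cong)
    moreover have "(\<lambda>\<omega>. gn (Y \<omega>)) = (\<lambda>\<omega>. of_real (Wn j b \<omega> - Wn j a \<omega>))"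
      using j ab less by (auto simp: gn_def Y_def fun_eq_iff)
    ultimately have iv: "indep_var borel (\<delta> k) borel (\<lambda>\<omega>. complex_of_real (Wn j b \<omega> - Wn j a \<omega>))" by simp
    have i1: "integrable M (\<delta> k)"
      by (rule integrable_const_bound[where B = "2 / cmod (\<Gamma> k)"]) (auto simp: \<delta>_bound \<delta>_meas)
    have i2: "integrable M (\<lambda>\<omega>. complex_of_real (Wn j b \<omega> - Wn j a \<omega>))" using int by (rule integrable_of_real)
    have E2: "expectation (\<lambda>\<omega>. complex_of_real (Wn j b \<omega> - Wn j a \<omega>)) = 0"
      using E0 by (subst integral_complex_of_real) simp
    show ?thesis
      using indep_var_lebesgue_integral[OF iv i1 i2] indep_var_integrable[OF iv i1 i2] E2 by simp
  qed simp
  thus "integrable M (\<lambda>\<omega>. \<delta> k \<omega> * of_real (Wn j b \<omega> - Wn j a \<omega>))"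
    "expectation (\<lambda>\<omega>. \<delta> k \<omega> * of_real (Wn j b \<omega> - Wn j a \<omega>)) = 0" by auto
qed

lemma \<delta>_step_integral:
  assumes j: "j \<in> {1..n}" and s: "steps01 s"
  shows "integrable M (\<lambda>\<omega>. \<delta> k \<omega> * cnj (step_integral s (\<lambda>t. Wn j t \<omega>)))"
    "expectation (\<lambda>\<omega>. \<delta> k \<omega> * cnj (step_integral s (\<lambda>t. Wn j t \<omega>))) = 0"
proof -
  have "integrable M (\<lambda>\<omega>. \<delta> k \<omega> * cnj (step_integral s (\<lambda>t. Wn j t \<omega>))) \<and>
    expectation (\<lambda>\<omega>. \<delta> k \<omega> * cnj (step_integral s (\<lambda>t. Wn j t \<omega>))) = 0"
    using s
  proof (induction s)
    case (Cons p s)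
    obtain c a b where p: "p = (c, a, b)" by (metis prod_cases3)
    have ab: "0 \<le> a" "a \<le> b" "b \<le> 1" and s: "steps01 s" using Cons.prems by (auto simp: steps01_def p)
    have eq: "\<delta> k \<omega> * cnj (step_integral (p # s) (\<lambda>t. Wn j t \<omega>)) =
      cnj c * (\<delta> k \<omega> * of_real (Wn j b \<omega> - Wn j a \<omega>)) + \<delta> k \<omega> * cnj (step_integral s (\<lambda>t. Wn j t \<omega>))" for \<omega>
      by (simp add: step_integral_def p distrib_left)
    have i: "integrable M (\<lambda>\<omega>. cnj c * (\<delta> k \<omega> * of_real (Wn j b \<omega> - Wn j a \<omega>)))"
      by (intro integrable_mult_right \<delta>_increment(1)[OF j ab])
    have E: "expectation (\<lambda>\<omega>. cnj c * (\<delta> k \<omega> * of_real (Wn j b \<omega> - Wn j a \<omega>))) = 0"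
      by (subst integral_mult_right_zero) (simp only: \<delta>_increment(2)[OF j ab] mult_zero_right)
    show ?case unfolding eq using Cons.IH[OF s] i E
      by (auto simp only: Bochner_Integration.integral_add Bochner_Integration.integrable_add add_0_left)
  qed (simp add: step_integral_def)
  thus "integrable M (\<lambda>\<omega>. \<delta> k \<omega> * cnj (step_integral s (\<lambda>t. Wn j t \<omega>)))"
    "expectation (\<lambda>\<omega>. \<delta> k \<omega> * cnj (step_integral s (\<lambda>t. Wn j t \<omega>))) = 0" by auto
qed

text \<open>The Wiener integral is not given as a functional of the path, so independence is applied
  to increments. Orthogonality then extends to step integrals by linearity, and to their L1 limit
  because \<open>\<delta> k\<close> is bounded.\<close>

lemma \<delta>_noise:
  assumes j: "j \<in> {1..n}"
  shows "integrable M (\<lambda>\<omega>. \<delta> k \<omega> * cnj (noise j k \<omega>))" "expectation (\<lambda>\<omega>. \<delta> k \<omega> * cnj (noise j k \<omega>)) = 0"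
proof -
  obtain s where s: "\<And>m. steps01 (s m)"
    and lim: "(\<lambda>m. \<integral>\<^sup>+ \<omega>. ennreal ((cmod (step_integral (s m) (\<lambda>t. Wn j t \<omega>) - noise j k \<omega>))\<^sup>2) \<partial>M) \<longlonglongrightarrow> 0"
    using noise(1)[OF j, of k] unfolding has_wiener_integral_def by (elim conjE exE) (rule that, auto)
  define D where "D m \<omega> = step_integral (s m) (\<lambda>t. Wn j t \<omega>) - noise j k \<omega>" for m \<omega>
  have Wm: "\<And>t. t \<in> {0..1} \<Longrightarrow> Wn j t \<in> borel_measurable M"
    using brownian[OF j] unfolding brownian_motion01_def by blast
  have sm: "(\<lambda>\<omega>. step_integral (s m) (\<lambda>t. Wn j t \<omega>)) \<in> borel_measurable M" for m
    by (rule step_integral_measurable[OF s Wm])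
  have Dm: "D m \<in> borel_measurable M" for m
    unfolding D_def by (intro borel_measurable_diff sm noise_meas j)
  have Dn: "(\<lambda>\<omega>. cmod (D m \<omega>)) \<in> borel_measurable M" for m using Dm by measurable
  have limD: "(\<lambda>m. \<integral>\<^sup>+ \<omega>. ennreal ((cmod (D m \<omega>))\<^sup>2) \<partial>M) \<longlonglongrightarrow> 0" using lim by (simp add: D_def)
  have ev: "eventually (\<lambda>m. integrable M (\<lambda>\<omega>. cmod (D m \<omega>))) sequentially"
    and L1: "(\<lambda>m. expectation (\<lambda>\<omega>. cmod (D m \<omega>))) \<longlonglongrightarrow> 0"
    using L2_imp_L1_tendsto_0[of "\<lambda>m \<omega>. cmod (D m \<omega>)", OF Dn limD] by auto
  define c where "c = 2 / cmod (\<Gamma> k)"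
  have c: "0 \<le> c" "\<And>\<omega>. cmod (\<delta> k \<omega>) \<le> c" by (auto simp: c_def \<delta>_bound)
  have cnjm: "cnj \<in> borel_measurable borel" by (intro borel_measurable_continuous_onI continuous_intros)
  have \<delta>D: "integrable M (\<lambda>\<omega>. \<delta> k \<omega> * cnj (D m \<omega>))" if "integrable M (\<lambda>\<omega>. cmod (D m \<omega>))" for m
  proof (rule Bochner_Integration.integrable_bound)
    show "integrable M (\<lambda>\<omega>. c * cmod (D m \<omega>))" using that by simp
    show "(\<lambda>\<omega>. \<delta> k \<omega> * cnj (D m \<omega>)) \<in> borel_measurable M"
      by (intro borel_measurable_times \<delta>_meas measurable_compose[OF Dm cnjm])
    show "AE \<omega> in M. norm (\<delta> k \<omega> * cnj (D m \<omega>)) \<le> norm (c * cmod (D m \<omega>))"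
      using c by (auto simp: norm_mult intro!: mult_right_mono)
  qed
  have split: "\<delta> k \<omega> * cnj (noise j k \<omega>) = \<delta> k \<omega> * cnj (step_integral (s m) (\<lambda>t. Wn j t \<omega>)) - \<delta> k \<omega> * cnj (D m \<omega>)" for m \<omega>
    by (simp add: D_def algebra_simps)
  obtain m0 where "integrable M (\<lambda>\<omega>. cmod (D m0 \<omega>))"
    using ev unfolding eventually_sequentially by blast
  from \<delta>D[OF this] show "integrable M (\<lambda>\<omega>. \<delta> k \<omega> * cnj (noise j k \<omega>))"
    unfolding split[of _ m0] using \<delta>_step_integral(1)[OF j s] by (intro Bochner_Integration.integrable_diff)
  have "eventually (\<lambda>m. cmod (expectation (\<lambda>\<omega>. \<delta> k \<omega> * cnj (noise j k \<omega>))) \<le> c * expectation (\<lambda>\<omega>. cmod (D m \<omega>))) sequentially"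
    using ev
  proof eventually_elim
    case (elim m)
    have "expectation (\<lambda>\<omega>. \<delta> k \<omega> * cnj (noise j k \<omega>)) = - expectation (\<lambda>\<omega>. \<delta> k \<omega> * cnj (D m \<omega>))"
      unfolding split[of _ m] using \<delta>_step_integral[OF j s, of k m] \<delta>D[OF elim]
      by (subst Bochner_Integration.integral_diff) auto
    hence "cmod (expectation (\<lambda>\<omega>. \<delta> k \<omega> * cnj (noise j k \<omega>))) = cmod (expectation (\<lambda>\<omega>. \<delta> k \<omega> * cnj (D m \<omega>)))" by simp
    also have "\<dots> \<le> expectation (\<lambda>\<omega>. cmod (\<delta> k \<omega> * cnj (D m \<omega>)))" by (rule integral_norm_bound)
    also have "\<dots> \<le> expectation (\<lambda>\<omega>. c * cmod (D m \<omega>))"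
      using elim c by (intro integral_mono[OF integrable_norm[OF \<delta>D[OF elim]]]) (auto simp: norm_mult intro!: mult_right_mono)
    finally show ?case by simp
  qed
  from tendsto_lowerbound[OF tendsto_mult_right_zero[OF L1, of c] this]
  have "cmod (expectation (\<lambda>\<omega>. \<delta> k \<omega> * cnj (noise j k \<omega>))) \<le> 0" by simp
  thus "expectation (\<lambda>\<omega>. \<delta> k \<omega> * cnj (noise j k \<omega>)) = 0" by simp
qed

lemma cross: "expectation (\<lambda>\<omega>. \<delta> k \<omega> * cnj (\<xi> k \<omega>)) = 0"
proof -
  have "\<delta> k \<omega> * cnj (\<xi> k \<omega>) = (\<Sum>j\<in>{1..n}. \<delta> k \<omega> * cnj (noise j k \<omega>)) / of_real (sqrt (real n))" for \<omega>
    by (simp add: \<xi>_def sum_distrib_left)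
  hence "expectation (\<lambda>\<omega>. \<delta> k \<omega> * cnj (\<xi> k \<omega>)) = expectation (\<lambda>\<omega>. \<Sum>j\<in>{1..n}. \<delta> k \<omega> * cnj (noise j k \<omega>)) / of_real (sqrt (real n))"
    by (simp only: integral_divide_zero)
  also have "expectation (\<lambda>\<omega>. \<Sum>j\<in>{1..n}. \<delta> k \<omega> * cnj (noise j k \<omega>)) = 0"
  proof -
    have "expectation (\<lambda>\<omega>. \<Sum>j\<in>{1..n}. \<delta> k \<omega> * cnj (noise j k \<omega>)) = (\<Sum>j\<in>{1..n}. expectation (\<lambda>\<omega>. \<delta> k \<omega> * cnj (noise j k \<omega>)))"
      by (rule Bochner_Integration.integral_sum) (rule \<delta>_noise(1))
    also have "\<dots> = 0" using \<delta>_noise(2) by (intro sum.neutral ballI)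
    finally show ?thesis .
  qed
  finally show ?thesis by simp
qed

lemma noisy: "noisy_cutoff \<theta> \<Gamma> \<sigma> M \<delta> \<xi> n"
proof (intro noisy_cutoff.intro cutoff_setup.intro noisy_cutoff_axioms.intro)
  show "(\<lambda>k. (cmod (\<theta> k))\<^sup>2) summable_on UNIV" by (rule fourier_coeff_square_summable[OF f])
  show "cmod (\<Gamma> (- k)) = cmod (\<Gamma> k)" for k by (simp add: shift_coeff_uminus)
qed (fact prob_space_axioms \<Gamma>_nz \<sigma>_pos \<delta>_meas \<xi>_meas gauss x2 \<xi>_sym \<delta>_le \<delta>_var cross)+

end

section \<open>Explicit rates\<close>

context noisy_cutoff
begin

lemma card_I: "real (card (I m)) = 2 * real m + 1"
  by (simp add: I_def)

lemma prob_compl_\<Omega>: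
  assumes dev: "\<And>k u. 0 < u \<Longrightarrow> prob {\<omega>\<in>space M. u < cmod (\<delta> k \<omega>)} \<le> 4 * exp (- (real n * u\<^sup>2 * (cmod (\<Gamma> k))\<^sup>2 / 8))"
    and cut: "\<And>k. k \<in> I m \<Longrightarrow> (ln (real n))\<^sup>2 / real n \<le> (cmod (\<Gamma> k))\<^sup>2" and n: "0 < n" and u: "0 < u"
  shows "prob (space M - \<Omega> m u) \<le> (2 * real m + 1) * (4 * exp (- (u\<^sup>2 * (ln (real n))\<^sup>2 / 8)))"
proof -
  have ev: "{\<omega>\<in>space M. u < cmod (\<delta> k \<omega>)} \<in> events" for k by measurable
  have "prob (space M - \<Omega> m u) \<le> prob (\<Union>k\<in>I m. {\<omega>\<in>space M. u < cmod (\<delta> k \<omega>)})"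
    using ev by (intro finite_measure_mono sets.finite_UN) (auto simp: \<Omega>_def)
  also have "\<dots> \<le> (\<Sum>k\<in>I m. prob {\<omega>\<in>space M. u < cmod (\<delta> k \<omega>)})"
    using ev by (intro finite_measure_subadditive_finite) auto
  also have "\<dots> \<le> (\<Sum>k\<in>I m. 4 * exp (- (u\<^sup>2 * (ln (real n))\<^sup>2 / 8)))"
  proof (rule sum_mono)
    fix k assume k: "k \<in> I m"
    have "real n * u\<^sup>2 * ((ln (real n))\<^sup>2 / real n) \<le> real n * u\<^sup>2 * (cmod (\<Gamma> k))\<^sup>2"
      by (intro mult_left_mono cut k) auto
    hence "u\<^sup>2 * (ln (real n))\<^sup>2 \<le> real n * u\<^sup>2 * (cmod (\<Gamma> k))\<^sup>2" using n by simp
    hence "exp (- (real n * u\<^sup>2 * (cmod (\<Gamma> k))\<^sup>2 / 8)) \<le> exp (- (u\<^sup>2 * (ln (real n))\<^sup>2 / 8))" by simp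
    thus "prob {\<omega>\<in>space M. u < cmod (\<delta> k \<omega>)} \<le> 4 * exp (- (u\<^sup>2 * (ln (real n))\<^sup>2 / 8))"
      using dev[OF u, of k] by linarith
  qed
  also have "\<dots> = (2 * real m + 1) * (4 * exp (- (u\<^sup>2 * (ln (real n))\<^sup>2 / 8)))"
    by (simp add: card_I)
  finally show ?thesis .
qed

lemma Q_le_R:
  assumes "\<And>k. cmod (\<Gamma> k) \<le> 1" shows "Q N \<le> R N"
proof -
  have "1 \<le> w k" for k
  proof -
    have "(cmod (\<Gamma> k))\<^sup>2 \<le> 1\<^sup>2" using assms by (intro power_mono) auto
    thus ?thesis using \<Gamma>_nz[of k] by (simp add: w_def)
  qed
  hence "0 \<le> S (\<lambda>k. (cmod (\<theta> k))\<^sup>2 * (w k - 1)) N" unfolding S_def by (intro sum_nonneg mult_nonneg_nonneg) auto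
  thus ?thesis by (simp add: R_def Q_def)
qed

text \<open>A multiple of \<open>n ^ d\<close> bounds the number of frequencies, the largest weight
  and the total variance up to \<open>m\<close>. The choice of \<open>\<kappa>\<close> makes the
  exceptional probability at most a multiple of \<open>1 / n ^ (2 * d + 1)\<close> once
  \<open>n ^ d > 1 / \<gamma>\<close>, and the condition on \<open>\<gamma>\<close> says that
  \<open>\<eta>\<^sup>2 = \<kappa> / ln (1 / \<gamma>)\<close> is below \<open>1 / 144\<close>. In
  \<open>s = 2 * q + 5\<close> one power of \<open>1 / \<eta>\<close> is the prefactor of the excess
  bounds; the other \<open>2 * (q + 2)\<close> come from trading the exponential for the power
  \<open>q + 2\<close> of \<open>N + 1\<close>.\<close>

lemma oracle_rate:
  fixes v :: "nat \<Rightarrow> real" and V c A :: real and q d :: nat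
  defines "K\<^sub>0 \<equiv> 8 * V * fact (q + 2) * (16 / c) ^ (q + 2)" and "s \<equiv> 2 * q + 5"
    and "\<kappa> \<equiv> 8 * (3 * real d + 1) * real d"
  assumes Nt: "Nt \<in> measurable M (count_space UNIV)" "\<And>\<omega>. \<omega> \<in> space M \<Longrightarrow> Nt \<omega> \<le> m"
      "\<And>\<omega> N'. \<omega> \<in> space M \<Longrightarrow> N' \<le> m \<Longrightarrow> U (\<lambda>k. \<delta> k \<omega>) (\<lambda>k. \<xi> k \<omega>) (Nt \<omega>) \<le> U (\<lambda>k. \<delta> k \<omega>) (\<lambda>k. \<xi> k \<omega>) N'"
    and dev: "\<And>k x. 0 < x \<Longrightarrow> prob {\<omega>\<in>space M. x < cmod (\<delta> k \<omega>)} \<le> 4 * exp (- (real n * x\<^sup>2 * (cmod (\<Gamma> k))\<^sup>2 / 8))"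
    and cut: "\<And>k. k \<in> I m \<Longrightarrow> (ln (real n))\<^sup>2 / real n \<le> (cmod (\<Gamma> k))\<^sup>2" and n: "2 \<le> n"
    and \<Gamma>_le: "\<And>k. cmod (\<Gamma> k) \<le> 1"
    and v: "\<And>N k. k \<in> I N \<Longrightarrow> w k \<le> v N" "\<And>N. 0 < v N" "\<And>N. v N \<le> V * (real N + 1) ^ q"
      "\<And>N. c * (real N + 1) * v N \<le> W N" "0 < c" "0 < V"
    and A: "1 \<le> A" "2 * real m + 1 \<le> A * real n ^ d" "v m \<le> A * real n ^ d" "W m \<le> A * real n ^ d" "1 \<le> d"
    and \<gamma>: "0 < \<gamma>" "\<gamma> < exp (- (144 * \<kappa>))" and N': "N' \<le> m"
  shows "expectation (\<lambda>\<omega>. LossM (Nt \<omega>) \<omega>) \<le> (1 + 32 * sqrt (\<kappa> / ln (1 / \<gamma>))) * R N'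
    + (26 * A + (24 * K\<^sub>0 + 300 * A\<^sup>2) * fact s) * \<sigma>\<^sup>2 / \<gamma> + (36 * A\<^sup>2 * T * exp (32 * (2 * real d + 1)\<^sup>2)) / real n"
proof -
  define L where "L = ln (real n)"
  define y where "y = real n ^ d"
  have L: "0 < L" using n by (simp add: L_def)
  have y1: "1 \<le> y" using n by (simp add: y_def)
  have y_exp: "y ^ i = exp (real (i * d) * L)" for i
  proof -
    have "y ^ i = real n ^ (i * d)" unfolding y_def by (simp add: power_mult[symmetric] mult.commute)
    also have "real n = exp L" using n by (simp add: L_def)
    finally show ?thesis by (simp only: exp_of_nat_mult)
  qed
  have \<kappa>32: "32 \<le> \<kappa>"
  proof -
    have "8 * (3 * 1 + 1) * 1 \<le> 8 * (3 * real d + 1) * real d" using A(5) by (intro mult_mono) auto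
    thus ?thesis by (simp add: \<kappa>_def)
  qed
  define Lg where "Lg = ln (1 / \<gamma>)"
  have Lg: "144 * \<kappa> < Lg"
  proof -
    have "ln \<gamma> < - (144 * \<kappa>)" using \<gamma> by (metis exp_gt_zero ln_exp ln_less_cancel_iff)
    thus ?thesis using \<gamma> by (simp add: Lg_def ln_div)
  qed
  have Lg_exp: "exp Lg = 1 / \<gamma>" using \<gamma> by (simp add: Lg_def)
  define \<eta> where "\<eta> = sqrt (\<kappa> / Lg)"
  have \<eta>2: "\<eta>\<^sup>2 = \<kappa> / Lg" using \<kappa>32 Lg by (simp add: \<eta>_def)
  have \<eta>0: "0 < \<eta>" using \<kappa>32 Lg by (simp add: \<eta>_def)
  have \<eta>12: "\<eta> \<le> 1 / 12"
  proof (rule power2_le_imp_le)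
    show "\<eta>\<^sup>2 \<le> (1 / 12)\<^sup>2" using \<kappa>32 Lg unfolding \<eta>2 by (simp add: field_simps power2_eq_square)
  qed simp
  have K0: "0 \<le> K\<^sub>0" using v by (simp add: K\<^sub>0_def)
  have R0: "0 \<le> R N'" using Q_nonneg[of N'] Q_le_R[OF \<Gamma>_le, of N'] by linarith
  have T0: "0 \<le> T" by (rule T_nonneg)
  have A2: "A \<le> A\<^sup>2" using A(1) by (simp add: power2_eq_square)
  have vm: "1 + 8 * v m \<le> 9 * (A * y)"
  proof -
    have "1 * 1 \<le> A * y" using A(1) y1 by (intro mult_mono) auto
    thus ?thesis using A(3) by (simp add: y_def)
  qed
  have v0: "0 \<le> 1 + 8 * v m" using v(2)[of m] by simp
  have \<rho>: "prob (space M - \<Omega> m u) \<le> 4 * (A * y) * exp (- (u\<^sup>2 * L\<^sup>2 / 8))" if "0 < u" for u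
  proof -
    have "prob (space M - \<Omega> m u) \<le> (2 * real m + 1) * (4 * exp (- (u\<^sup>2 * L\<^sup>2 / 8)))"
      unfolding L_def by (rule prob_compl_\<Omega>[OF dev cut _ that]) (use n in auto)
    also have "\<dots> \<le> (A * y) * (4 * exp (- (u\<^sup>2 * L\<^sup>2 / 8)))"
      using A(2) by (intro mult_right_mono) (auto simp: y_def)
    finally show ?thesis by (simp add: mult_ac)
  qed
  define Z where "Z = 36 * A\<^sup>2 * T * exp (32 * (2 * real d + 1)\<^sup>2)"
  have bad: "(1 + 8 * v m) * T * prob (space M - \<Omega> m u) \<le> 36 * A\<^sup>2 * T * (y\<^sup>2 * exp (- (u\<^sup>2 * L\<^sup>2 / 8)))" if "0 < u" for u
  proof -
    have "(1 + 8 * v m) * T * prob (space M - \<Omega> m u) \<le> (9 * (A * y)) * T * (4 * (A * y) * exp (- (u\<^sup>2 * L\<^sup>2 / 8)))"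
      using vm v0 T0 \<rho>[OF that] A(1) y1 by (intro mult_mono) auto
    also have "\<dots> = 36 * A\<^sup>2 * T * (y\<^sup>2 * exp (- (u\<^sup>2 * L\<^sup>2 / 8)))" by (simp add: power2_eq_square mult_ac)
    finally show ?thesis .
  qed
  have ninv: "exp (- L) = 1 / real n" using n by (simp add: L_def exp_minus inverse_eq_divide)
  show ?thesis
  proof (cases "y \<le> 1 / \<gamma>")
    case True
    \<comment> \<open>\<open>n\<close> is polynomial in \<open>1 / \<gamma>\<close>: the variance of all admissible estimators is absorbed by \<open>\<sigma>\<^sup>2 / \<gamma>\<close>.\<close>
    have "expectation (\<lambda>\<omega>. LossM (Nt \<omega>) \<omega>) \<le> R N' + 26 * \<sigma>\<^sup>2 * W m + (1 + 8 * v m) * T * prob (space M - \<Omega> m (1 / 4))"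
      by (rule oracle_crude[OF Nt v(1) less_imp_le[OF v(2)] N'])
    also have "26 * \<sigma>\<^sup>2 * W m \<le> 26 * A * \<sigma>\<^sup>2 / \<gamma>"
    proof -
      have "W m \<le> A * (1 / \<gamma>)" using A(4) True A(1) mult_left_mono[of y "1 / \<gamma>" A] by (simp add: y_def)
      hence "26 * \<sigma>\<^sup>2 * W m \<le> 26 * \<sigma>\<^sup>2 * (A * (1 / \<gamma>))" by (intro mult_left_mono) auto
      thus ?thesis by (simp add: mult_ac)
    qed
    also have "(1 + 8 * v m) * T * prob (space M - \<Omega> m (1 / 4)) \<le> Z / real n"
    proof -
      \<comment> \<open>Completing the square in \<open>L = ln n\<close>: the fixed threshold
        \<open>1 / 4\<close> beats the power \<open>2 * d + 1\<close> of \<open>n\<close> at the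
        price of a constant that depends only on \<open>d\<close>.\<close>
      have "2 * real d * L - L\<^sup>2 / 128 \<le> 32 * (2 * real d + 1)\<^sup>2 - L"
      proof -
        have "e * L \<le> L\<^sup>2 / 128 + 32 * e\<^sup>2" for e :: real
        proof -
          have "0 \<le> (L / 16 - 4 * e)\<^sup>2" by simp
          also have "\<dots> = L\<^sup>2 / 256 + 16 * e\<^sup>2 - e * L / 2"
            by (simp add: power2_diff power_mult_distrib power_divide)
          finally show ?thesis by simp
        qed
        from this[of "2 * real d + 1"] show ?thesis by (simp add: distrib_right)
      qed
      moreover have "y\<^sup>2 * exp (- ((1 / 4)\<^sup>2 * L\<^sup>2 / 8)) = exp (2 * real d * L - L\<^sup>2 / 128)"
        unfolding y_exp exp_add[symmetric] by (simp add: power2_eq_square)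
      ultimately have "y\<^sup>2 * exp (- ((1 / 4)\<^sup>2 * L\<^sup>2 / 8)) \<le> exp (32 * (2 * real d + 1)\<^sup>2 - L)"
        by simp
      also have "\<dots> = exp (32 * (2 * real d + 1)\<^sup>2) * exp (- L)" by (simp flip: exp_add)
      finally have e: "y\<^sup>2 * exp (- ((1 / 4)\<^sup>2 * L\<^sup>2 / 8)) \<le> exp (32 * (2 * real d + 1)\<^sup>2) * exp (- L)" .
      have "36 * A\<^sup>2 * T * (y\<^sup>2 * exp (- ((1 / 4)\<^sup>2 * L\<^sup>2 / 8))) \<le> 36 * A\<^sup>2 * T * (exp (32 * (2 * real d + 1)\<^sup>2) * exp (- L))"
        using T0 by (intro mult_left_mono e) auto
      also have "\<dots> = Z / real n" by (simp add: Z_def ninv)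
      finally show ?thesis using bad[of "1 / 4"] by linarith
    qed
    finally have 1: "expectation (\<lambda>\<omega>. LossM (Nt \<omega>) \<omega>) \<le> R N' + 26 * A * \<sigma>\<^sup>2 / \<gamma> + Z / real n" by simp
    have 2: "0 \<le> 32 * \<eta> * R N'" using \<eta>0 R0 by simp
    have 3: "0 \<le> (24 * K\<^sub>0 + 300 * A\<^sup>2) * fact s * \<sigma>\<^sup>2 / \<gamma>" using K0 \<gamma> by simp
    have "(1 + 32 * \<eta>) * R N' + (26 * A + (24 * K\<^sub>0 + 300 * A\<^sup>2) * fact s) * \<sigma>\<^sup>2 / \<gamma> =
      R N' + 32 * \<eta> * R N' + 26 * A * \<sigma>\<^sup>2 / \<gamma> + (24 * K\<^sub>0 + 300 * A\<^sup>2) * fact s * \<sigma>\<^sup>2 / \<gamma>"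
      by (simp add: distrib_right add_divide_distrib)
    thus ?thesis using 1 2 3 unfolding \<eta>_def Lg_def Z_def by linarith
  next
    case False
    \<comment> \<open>\<open>ln n\<close> exceeds a multiple of \<open>ln (1 / \<gamma>)\<close>, so that \<open>\<delta>\<close> exceeds \<open>\<eta>\<close> with probability \<open>n\<close> to a large negative power.\<close>
    have dL: "Lg < real d * L"
    proof -
      have "exp Lg < exp (real d * L)" using False y_exp[of 1] by (simp add: Lg_exp)
      thus ?thesis by simp
    qed
    \<comment> \<open>Of the gained factor \<open>y ^ 3 * n\<close>, one \<open>y\<close> is spent
      on the union bound, one on the largest weight or the total variance, and one on the balance
      \<open>l = y\<close>; the \<open>1 / n\<close> remains.\<close>
    define r where "r = 3 * real d + 1"
    have \<eta>L: "r * L \<le> \<eta>\<^sup>2 * L\<^sup>2 / 8"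
    proof -
      have "\<kappa> = 8 * r * real d" by (simp add: \<kappa>_def r_def)
      have Lg0: "0 < Lg" using Lg \<kappa>32 by linarith
      have "8 * r * Lg \<le> 8 * r * (real d * L)" using dL by (intro mult_left_mono) (auto simp: r_def)
      hence "8 * r \<le> \<kappa> * L / Lg" using Lg0 \<open>\<kappa> = 8 * r * real d\<close> by (simp add: pos_le_divide_eq mult_ac)
      hence "8 * r * L \<le> (\<kappa> * L / Lg) * L" using L by (intro mult_right_mono) auto
      hence "r * L \<le> ((\<kappa> * L / Lg) * L) / 8"
        using mult.commute[of "r * L" 8] by (simp only: pos_le_divide_eq zero_less_numeral mult.assoc)
      moreover have "\<eta>\<^sup>2 * L\<^sup>2 / 8 = ((\<kappa> * L / Lg) * L) / 8" unfolding \<eta>2 by (simp add: power2_eq_square)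
      ultimately show ?thesis by (simp only:)
    qed
    have ex: "exp (- (\<eta>\<^sup>2 * L\<^sup>2 / 8)) \<le> 1 / (y ^ 3 * real n)"
    proof -
      have "exp (- (\<eta>\<^sup>2 * L\<^sup>2 / 8)) \<le> exp (- (r * L))" using \<eta>L by simp
      also have "- (r * L) = - (real (3 * d) * L) + - L" by (simp add: r_def algebra_simps)
      also have "exp (- (real (3 * d) * L) + - L) = 1 / (y ^ 3 * real n)"
        unfolding exp_add ninv y_exp by (simp add: exp_minus inverse_eq_divide)
      finally show ?thesis .
    qed
    define \<rho>' where "\<rho>' = prob (space M - \<Omega> m \<eta>)"
    have \<rho>'0: "0 \<le> \<rho>'" by (simp add: \<rho>'_def)
    have \<rho>'_le: "\<rho>' \<le> 4 * A / (y\<^sup>2 * real n)"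
    proof -
      have "\<rho>' \<le> 4 * (A * y) * (1 / (y ^ 3 * real n))"
        unfolding \<rho>'_def using ex A(1) y1 by (intro order_trans[OF \<rho>[OF \<eta>0]] mult_left_mono) auto
      also have "\<dots> = 4 * A / (y\<^sup>2 * real n)" using y1 by (simp add: power2_eq_square power3_eq_cube)
      finally show ?thesis .
    qed
    have F: "8 * v N / \<eta> * exp (- (\<eta>\<^sup>2 * W N / (16 * v N))) \<le> (K\<^sub>0 / \<eta> ^ s) / (real N + 1)\<^sup>2" for N
    proof -
      \<comment> \<open>A lower bound for the exponent, linear in \<open>N + 1\<close>. Its power
        \<open>q + 2\<close> cancels the growth \<open>(real N + 1) ^ q\<close> of the weights and
        leaves a square for the summation.\<close>
      define z where "z = \<eta>\<^sup>2 * (c / 16 * (real N + 1))"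
      have z: "0 < z" using \<eta>0 v(5) by (simp add: z_def)
      have "c * (real N + 1) \<le> W N / v N" using v(4)[of N] v(2)[of N] by (simp add: pos_le_divide_eq)
      hence "\<eta>\<^sup>2 / 16 * (c * (real N + 1)) \<le> \<eta>\<^sup>2 / 16 * (W N / v N)" by (intro mult_left_mono) auto
      hence "z \<le> \<eta>\<^sup>2 * W N / (16 * v N)" by (simp add: z_def mult_ac)
      hence "exp (- (\<eta>\<^sup>2 * W N / (16 * v N))) \<le> exp (- z)" by simp
      also have "\<dots> \<le> fact (q + 2) / z ^ (q + 2)"
        using power_le_fact_exp[of z "q + 2"] z by (simp add: exp_minus field_simps)
      finally have e: "exp (- (\<eta>\<^sup>2 * W N / (16 * v N))) \<le> fact (q + 2) / z ^ (q + 2)" .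
      have "8 * v N / \<eta> * exp (- (\<eta>\<^sup>2 * W N / (16 * v N))) \<le> (8 * (V * (real N + 1) ^ q) / \<eta>) * (fact (q + 2) / z ^ (q + 2))"
        using v(3)[of N] less_imp_le[OF v(2)[of N]] v(6) \<eta>0 e z by (intro mult_mono divide_right_mono) auto
      also have "z ^ (q + 2) = \<eta> ^ (2 * q + 4) * ((c / 16) ^ (q + 2) * ((real N + 1) ^ q * (real N + 1)\<^sup>2))"
      proof -
        have "2 * (q + 2) = 2 * q + 4" by simp
        thus ?thesis
          by (simp only: z_def power_mult_distrib power_mult[symmetric] power_add[of "real N + 1"])
      qed
      also have "(8 * (V * (real N + 1) ^ q) / \<eta>) * (fact (q + 2) / (\<eta> ^ (2 * q + 4) * ((c / 16) ^ (q + 2) * ((real N + 1) ^ q * (real N + 1)\<^sup>2)))) =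
        (8 * V * fact (q + 2) / (c / 16) ^ (q + 2)) / (\<eta> * \<eta> ^ (2 * q + 4)) / (real N + 1)\<^sup>2"
      proof -
        have "(real N + 1) ^ q \<noteq> 0" by simp
        moreover have "(8 * (V * u) / \<eta>) * (g / (h * (k * (u * l)))) = (8 * V * g / k) / (\<eta> * h) / l"
          if "u \<noteq> 0" for u g h k l :: real using that by (simp, simp add: mult_ac)
        ultimately show ?thesis by blast
      qed
      also have "\<eta> * \<eta> ^ (2 * q + 4) = \<eta> ^ s"
      proof -
        have "Suc (2 * q + 4) = 2 * q + 5" by simp
        thus ?thesis by (simp only: s_def power_Suc[symmetric])
      qed
      also have "8 * V * fact (q + 2) / (c / 16) ^ (q + 2) = K\<^sub>0"
        unfolding K\<^sub>0_def by (simp add: power_divide)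
      finally show ?thesis .
    qed
    \<comment> \<open>Applied with \<open>l = y\<close>: then \<open>W m * (96 / y)\<close> is
      bounded, and the exceptional probability is small enough to bear the factor
      \<open>y\<close>.\<close>
    have "expectation (\<lambda>\<omega>. LossM (Nt \<omega>) \<omega>) \<le> R N' + 32 * \<eta> * Q N' + 24 * \<sigma>\<^sup>2 * (K\<^sub>0 / \<eta> ^ s)
      + (1 + 8 * v m) * T * \<rho>' + 3 * \<sigma>\<^sup>2 * W m * (y * \<rho>' + 96 / y)"
      unfolding \<rho>'_def
      by (rule oracle_fine[OF Nt v(1,2) N' \<eta>0 \<eta>12 _ F]) (use y1 K0 \<eta>0 in auto)
    moreover have "32 * \<eta> * Q N' \<le> 32 * \<eta> * R N'" using \<eta>0 Q_le_R[OF \<Gamma>_le, of N'] by (intro mult_left_mono) auto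
    moreover have "(1 + 8 * v m) * T * \<rho>' \<le> Z / real n"
    proof -
      have "(1 + 8 * v m) * T * \<rho>' \<le> 36 * A\<^sup>2 * T * (y\<^sup>2 * exp (- (\<eta>\<^sup>2 * L\<^sup>2 / 8)))"
        unfolding \<rho>'_def by (rule bad[OF \<eta>0])
      also have "\<dots> \<le> 36 * A\<^sup>2 * T * (exp (32 * (2 * real d + 1)\<^sup>2) * (1 / real n))"
      proof (rule mult_left_mono)
        have "y\<^sup>2 * exp (- (\<eta>\<^sup>2 * L\<^sup>2 / 8)) \<le> y\<^sup>2 * (1 / (y ^ 3 * real n))" by (intro mult_left_mono ex) auto
        also have "\<dots> = (1 / y) * (1 / real n)" using y1 by (simp add: power2_eq_square power3_eq_cube)
        also have "\<dots> \<le> exp (32 * (2 * real d + 1)\<^sup>2) * (1 / real n)"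
        proof (rule mult_right_mono)
          have "1 / y \<le> 1" using y1 by simp
          also have "1 \<le> exp (32 * (2 * real d + 1)\<^sup>2)" by simp
          finally show "1 / y \<le> exp (32 * (2 * real d + 1)\<^sup>2)" .
        qed simp
        finally show "y\<^sup>2 * exp (- (\<eta>\<^sup>2 * L\<^sup>2 / 8)) \<le> exp (32 * (2 * real d + 1)\<^sup>2) * (1 / real n)" .
      qed (use T0 in simp)
      also have "\<dots> = Z / real n" by (simp add: Z_def)
      finally show ?thesis .
    qed
    moreover have "3 * \<sigma>\<^sup>2 * W m * (y * \<rho>' + 96 / y) \<le> 300 * A\<^sup>2 * \<sigma>\<^sup>2"
    proof -
      have "y * \<rho>' + 96 / y \<le> 4 * A / y + 96 / y"
      proof -
        have "y * \<rho>' \<le> y * (4 * A / (y\<^sup>2 * real n))" using y1 by (intro mult_left_mono \<rho>'_le) auto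
        also have "\<dots> = 4 * A / (y * real n)" using y1 by (simp add: power2_eq_square)
        also have "\<dots> \<le> 4 * A / (y * 1)" using y1 A(1) n by (intro divide_left_mono mult_left_mono mult_pos_pos) auto
        finally show ?thesis by simp
      qed
      also have "\<dots> \<le> 100 * A / y" using A(1) y1 by (simp add: field_simps)
      finally have "W m * (y * \<rho>' + 96 / y) \<le> (A * y) * (100 * A / y)"
        using A(4) W_pos[of m] y1 \<rho>'0 A(1) by (intro mult_mono) (auto simp: y_def)
      also have "\<dots> = 100 * A\<^sup>2" using y1 by (simp add: power2_eq_square)
      finally have "3 * \<sigma>\<^sup>2 * (W m * (y * \<rho>' + 96 / y)) \<le> 3 * \<sigma>\<^sup>2 * (100 * A\<^sup>2)" by (intro mult_left_mono) auto
      thus ?thesis by (simp add: mult_ac)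
    qed
    moreover have "24 * \<sigma>\<^sup>2 * (K\<^sub>0 / \<eta> ^ s) + 300 * A\<^sup>2 * \<sigma>\<^sup>2 \<le> (24 * K\<^sub>0 + 300 * A\<^sup>2) * fact s * \<sigma>\<^sup>2 / \<gamma>"
    proof -
      have i\<eta>: "1 \<le> 1 / \<eta>" using \<eta>0 \<eta>12 by (simp add: field_simps)
      \<comment> \<open>\<open>1 / \<eta>\<^sup>2\<close> is at most
        \<open>ln (1 / \<gamma>)\<close>, and every power of a logarithm is dominated by a constant
        times \<open>1 / \<gamma>\<close>.\<close>
      have i: "(1 / \<eta>) ^ s \<le> fact s / \<gamma>"
      proof -
        have "1 / \<eta> \<le> (1 / \<eta>) * (1 / \<eta>)" using mult_left_mono[OF i\<eta>, of "1 / \<eta>"] \<eta>0 by simp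
        also have "\<dots> = Lg / \<kappa>" using \<eta>2 by (simp add: power2_eq_square[symmetric] power_divide)
        also have "\<dots> \<le> Lg / 1" using Lg \<kappa>32 by (intro divide_left_mono) auto
        finally have "(1 / \<eta>) ^ s \<le> Lg ^ s" using \<eta>0 by (intro power_mono) auto
        also have "\<dots> \<le> fact s * exp Lg" using Lg \<kappa>32 by (intro power_le_fact_exp) auto
        finally show ?thesis by (simp add: Lg_exp)
      qed
      have one: "1 \<le> fact s / \<gamma>" using one_le_power[OF i\<eta>, of s] i by linarith
      have "24 * \<sigma>\<^sup>2 * (K\<^sub>0 / \<eta> ^ s) + 300 * A\<^sup>2 * \<sigma>\<^sup>2 = 24 * \<sigma>\<^sup>2 * K\<^sub>0 * (1 / \<eta>) ^ s + 300 * A\<^sup>2 * \<sigma>\<^sup>2 * 1"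
        by (simp add: power_divide)
      also have "\<dots> \<le> 24 * \<sigma>\<^sup>2 * K\<^sub>0 * (fact s / \<gamma>) + 300 * A\<^sup>2 * \<sigma>\<^sup>2 * (fact s / \<gamma>)"
        using K0 i one by (intro add_mono mult_left_mono) auto
      also have "\<dots> = (24 * K\<^sub>0 + 300 * A\<^sup>2) * fact s * \<sigma>\<^sup>2 / \<gamma>" using \<gamma> by (simp add: field_simps)
      finally show ?thesis .
    qed
    moreover have "0 \<le> 26 * A * \<sigma>\<^sup>2 / \<gamma>" using A(1) \<gamma> by simp
    moreover have "(1 + 32 * \<eta>) * R N' + (26 * A + (24 * K\<^sub>0 + 300 * A\<^sup>2) * fact s) * \<sigma>\<^sup>2 / \<gamma> =
      R N' + 32 * \<eta> * R N' + 26 * A * \<sigma>\<^sup>2 / \<gamma> + (24 * K\<^sub>0 + 300 * A\<^sup>2) * fact s * \<sigma>\<^sup>2 / \<gamma>"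
      by (simp add: distrib_right add_divide_distrib)
    ultimately show ?thesis unfolding \<eta>_def[symmetric] Lg_def[symmetric] Z_def[symmetric] by linarith
  qed
qed

end

section \<open>Consequences of polynomial decay\<close>

text \<open>Keeps frequency 0, where the eigenvalue is 1, out of the set that defines the largest
  admissible cut-off.\<close>

lemma ln_square_less:
  assumes "2 \<le> n"
  shows "(ln (real n))\<^sup>2 / real n < 1"
proof -
  have "ln (real n) \<le> 2 * (sqrt (real n) / exp 1)" 
  proof -
    \<comment> \<open>The inequality \<open>ln u \<le> u - 1\<close> is used at u = sqrt(n) / e,
      which yields the factor 2 / e, strictly below 1.\<close>
    have "ln (sqrt (real n) / exp 1) \<le> sqrt (real n) / exp 1 - 1"
      using assms by (intro ln_le_minus_one) auto
    thus ?thesis using assms by (simp add: ln_div ln_sqrt mult.commute)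
  qed
  also have "\<dots> < sqrt (real n)"
  proof -
    have "2 < exp (1 :: real)" using exp_lower_Taylor_quadratic[of "1::real"] by simp
    thus ?thesis using assms by (simp add: divide_less_eq)
  qed
  finally have "(ln (real n))\<^sup>2 < (sqrt (real n))\<^sup>2" using assms by (intro power_strict_mono) auto
  thus ?thesis using assms by simp
qed

lemma cutoff_max_gt:
  assumes "\<gamma> 0 = 1" "2 \<le> n" "k \<le> cutoff_max \<gamma> n"
  shows "(ln (real n))\<^sup>2 / real n < (cmod (\<gamma> (int k)))\<^sup>2"
proof (cases "k = 0")
  case True
  then show ?thesis using ln_square_less[OF assms(2)] assms(1) by simp
next
  case False
  define A where "A = {k::nat. (cmod (\<gamma> (int k)))\<^sup>2 \<le> (ln (real n))\<^sup>2 / real n}"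
  \<comment> \<open>As \<open>k\<close> is positive, \<open>k \<le> Inf A - 1\<close> excludes
    truncation. The argument covers an empty \<open>A\<close> as well.\<close>
  have "k < Inf A" using assms(3) False by (simp add: cutoff_max_def A_def)
  hence "k \<notin> A" unfolding Inf_nat_def by (rule not_less_Least)
  thus ?thesis by (simp add: A_def)
qed

locale polynomial_decay =
  fixes \<Gamma> :: "int \<Rightarrow> complex" and \<beta> C_min C_max :: real
  assumes \<Gamma>_0: "\<Gamma> 0 = 1" and \<Gamma>_le: "cmod (\<Gamma> k) \<le> 1" and beta: "0 \<le> \<beta>" and C: "0 < C_min" "C_min \<le> C_max"
    and decay: "k \<noteq> 0 \<Longrightarrow> C_min * \<bar>real_of_int k\<bar> powr (- \<beta>) \<le> cmod (\<Gamma> k) \<and>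
      cmod (\<Gamma> k) \<le> C_max * \<bar>real_of_int k\<bar> powr (- \<beta>)"
begin

lemma inverse_square_bounds:
  assumes k: "k \<noteq> 0"
  shows "1 / (cmod (\<Gamma> k))\<^sup>2 \<le> \<bar>real_of_int k\<bar> powr (2 * \<beta>) / C_min\<^sup>2"
    and "\<bar>real_of_int k\<bar> powr (2 * \<beta>) / C_max\<^sup>2 \<le> 1 / (cmod (\<Gamma> k))\<^sup>2"
proof -
  define p where "p = \<bar>real_of_int k\<bar> powr (- \<beta>)"
  have p: "0 < p" using k by (simp add: p_def)
  have p2: "1 / p\<^sup>2 = \<bar>real_of_int k\<bar> powr (2 * \<beta>)"
  proof -
    have "p\<^sup>2 = \<bar>real_of_int k\<bar> powr (- (2 * \<beta>))" by (simp add: p_def power2_eq_square flip: powr_add)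
    thus ?thesis by (simp add: powr_minus divide_inverse)
  qed
  have d: "C_min * p \<le> cmod (\<Gamma> k)" "cmod (\<Gamma> k) \<le> C_max * p" using decay[OF k] by (auto simp: p_def)
  have pos: "0 < C_min * p" using C p by simp
  have G: "0 < cmod (\<Gamma> k)" using d(1) pos by linarith
  have "1 / (cmod (\<Gamma> k))\<^sup>2 \<le> 1 / (C_min * p)\<^sup>2"
    using d(1) pos G C p by (intro divide_left_mono power_mono mult_pos_pos zero_less_power) auto
  also have "\<dots> = (1 / p\<^sup>2) / C_min\<^sup>2" by (simp add: power_mult_distrib)
  finally show "1 / (cmod (\<Gamma> k))\<^sup>2 \<le> \<bar>real_of_int k\<bar> powr (2 * \<beta>) / C_min\<^sup>2" unfolding p2 .
  have "(1 / p\<^sup>2) / C_max\<^sup>2 = 1 / (C_max * p)\<^sup>2" by (simp add: power_mult_distrib)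
  also have "\<dots> \<le> 1 / (cmod (\<Gamma> k))\<^sup>2"
    using d(2) pos G C p by (intro divide_left_mono power_mono mult_pos_pos zero_less_power) auto
  finally show "\<bar>real_of_int k\<bar> powr (2 * \<beta>) / C_max\<^sup>2 \<le> 1 / (cmod (\<Gamma> k))\<^sup>2" unfolding p2 .
qed

text \<open>For positive \<open>\<beta>\<close>, the upper decay bound at the cut-off itself
  combines with \<open>cutoff_max_gt\<close> to bound its power \<open>2 * \<beta>\<close> by a
  multiple of \<open>n\<close>.\<close>

lemma cutoff_max_polynomial:
  obtains A :: real and p :: nat where "1 \<le> A" "\<And>n. 2 \<le> n \<Longrightarrow> real (cutoff_max \<Gamma> n) \<le> A * real n ^ p"
proof (cases "\<beta> = 0")
  case True
  \<comment> \<open>For large \<open>n\<close> the set defining \<open>cutoff_max\<close> is empty, and its infimum an unspecified number that does not depend on \<open>n\<close>.\<close>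
  have lim: "(\<lambda>n. (ln (real n))\<^sup>2 / real n) \<longlonglongrightarrow> 0" by real_asymp
  have "eventually (\<lambda>n. (ln (real n))\<^sup>2 / real n < (min 1 C_min)\<^sup>2) sequentially"
    using order_tendstoD(2)[OF lim] C by simp
  then obtain n1 where n1: "\<And>n. n1 \<le> n \<Longrightarrow> (ln (real n))\<^sup>2 / real n < (min 1 C_min)\<^sup>2"
    by (auto simp: eventually_sequentially)
  define c where "c = Inf ({} :: nat set) - 1"
  have ge: "min 1 C_min \<le> cmod (\<Gamma> k)" for k
    using decay[of k] True \<Gamma>_0 by (cases "k = 0") auto
  have big: "cutoff_max \<Gamma> n = c" if "n1 \<le> n" for n
  proof -
    have "(ln (real n))\<^sup>2 / real n < (cmod (\<Gamma> (int k)))\<^sup>2" for k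
    proof -
      have "(min 1 C_min)\<^sup>2 \<le> (cmod (\<Gamma> (int k)))\<^sup>2" using C by (intro power_mono ge) auto
      thus ?thesis using n1[OF that] by linarith
    qed
    hence "{k::nat. (cmod (\<Gamma> (int k)))\<^sup>2 \<le> (ln (real n))\<^sup>2 / real n} = {}" by (auto simp: not_le)
    thus ?thesis by (simp only: cutoff_max_def c_def)
  qed
  define b where "b = Max (insert c (cutoff_max \<Gamma> ` {..n1}))"
  have "cutoff_max \<Gamma> n \<le> b" for n
  proof -
    have "cutoff_max \<Gamma> n \<in> insert c (cutoff_max \<Gamma> ` {..n1})" using big[of n] by (cases "n1 \<le> n") auto
    thus ?thesis unfolding b_def by (intro Max_ge) auto
  qed
  show ?thesis
  proof (rule that[of "real b + 1" 0])
    show "real (cutoff_max \<Gamma> n) \<le> (real b + 1) * real n ^ 0" for n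
      using \<open>cutoff_max \<Gamma> n \<le> b\<close> by simp
  qed simp
next
  case False
  hence b: "0 < \<beta>" using beta by simp
  define p where "p = nat \<lceil>1 / (2 * \<beta>)\<rceil>"
  have p: "1 / (2 * \<beta>) \<le> real p" by (simp add: p_def real_nat_ceiling_ge)
  \<comment> \<open>The constant from replacing \<open>ln n\<close> by its least value
    \<open>ln 2\<close>; the maximum with 1 secures \<open>1 \<le> A\<close>.\<close>
  define D where "D = max 1 (C_max\<^sup>2 / (ln 2)\<^sup>2)"
  have D: "1 \<le> D" by (simp add: D_def)
  have "real (cutoff_max \<Gamma> n) \<le> D powr (1 / (2 * \<beta>)) * real n ^ p" if n: "2 \<le> n" for n
  proof (cases "cutoff_max \<Gamma> n = 0")
    case True
    then show ?thesis by simp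
  next
    case False
    define m where "m = cutoff_max \<Gamma> n"
    have m: "0 < m" using False by (simp add: m_def)
    have l2: "(ln 2)\<^sup>2 \<le> (ln (real n))\<^sup>2" using n by (intro power_mono) auto
    have l2p: "0 < (ln 2 :: real)\<^sup>2" by simp
    have cut: "(ln (real n))\<^sup>2 / real n < (cmod (\<Gamma> (int m)))\<^sup>2"
      by (rule cutoff_max_gt[of \<Gamma>, OF \<Gamma>_0 n]) (simp add: m_def)
    have "real m powr (2 * \<beta>) / C_max\<^sup>2 \<le> 1 / (cmod (\<Gamma> (int m)))\<^sup>2"
      using inverse_square_bounds(2)[of "int m"] m by simp
    also have "\<dots> \<le> 1 / ((ln (real n))\<^sup>2 / real n)"
    proof (rule divide_left_mono)
      have "0 < (ln (real n))\<^sup>2 / real n" using n by simp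
      thus "0 < (cmod (\<Gamma> (int m)))\<^sup>2 * ((ln (real n))\<^sup>2 / real n)" using cut by (intro mult_pos_pos) linarith+
    qed (use cut in auto)
    also have "\<dots> \<le> real n / (ln 2)\<^sup>2"
      using l2 l2p n by (simp add: frac_le)
    finally have "real m powr (2 * \<beta>) \<le> C_max\<^sup>2 * (real n / (ln 2)\<^sup>2)"
      using C by (simp add: divide_le_eq mult.commute)
    also have "\<dots> = C_max\<^sup>2 / (ln 2)\<^sup>2 * real n" by simp
    also have "\<dots> \<le> D * real n" by (intro mult_right_mono) (auto simp: D_def)
    finally have "(real m powr (2 * \<beta>)) powr (1 / (2 * \<beta>)) \<le> (D * real n) powr (1 / (2 * \<beta>))"
      using b by (intro powr_mono2) auto
    hence "real m \<le> D powr (1 / (2 * \<beta>)) * real n powr (1 / (2 * \<beta>))"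
      using b m D by (simp add: powr_powr powr_mult)
    also have "\<dots> \<le> D powr (1 / (2 * \<beta>)) * real n powr real p"
      using n p by (intro mult_left_mono powr_mono) auto
    also have "real n powr real p = real n ^ p" using n by (simp add: powr_realpow)
    finally show ?thesis by (simp add: m_def)
  qed
  moreover have "1 \<le> D powr (1 / (2 * \<beta>))" using D b by (intro ge_one_powr_ge_zero) auto
  ultimately show ?thesis using that by blast
qed

section \<open>Polynomial bounds on the weights\<close>

definition V :: real where "V = max 1 (1 / C_min\<^sup>2)"
definition v :: "nat \<Rightarrow> real" where "v N = V * (real N + 1) powr (2 * \<beta>)"
text \<open>The first entry is what \<open>N = 0\<close> requires; the second comes from the upper
  half of the frequencies in \<open>weight_sum_ge\<close>.\<close>

definition c :: real where "c = min (1 / V) (1 / (2 * (4 powr (2 * \<beta>)) * C_max\<^sup>2 * V))"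

lemma V_ge: "1 \<le> V" "1 / C_min\<^sup>2 \<le> V" by (auto simp: V_def)

lemma v_pos: "0 < v N" using V_ge by (simp add: v_def)

lemma c_pos: "0 < c" using V_ge C by (simp add: c_def)

lemma weight_le_v:
  assumes "\<bar>k\<bar> \<le> int N"
  shows "1 / (cmod (\<Gamma> k))\<^sup>2 \<le> v N"
proof (cases "k = 0")
  case True
  have "1 * 1 \<le> V * (real N + 1) powr (2 * \<beta>)"
    using V_ge beta by (intro mult_mono ge_one_powr_ge_zero) auto
  then show ?thesis using True \<Gamma>_0 by (simp add: v_def)
next
  case False
  have "1 / (cmod (\<Gamma> k))\<^sup>2 \<le> (1 / C_min\<^sup>2) * \<bar>real_of_int k\<bar> powr (2 * \<beta>)"
    using inverse_square_bounds(1)[OF False] by simp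
  also have "\<dots> \<le> V * (real N + 1) powr (2 * \<beta>)"
    using V_ge beta assms by (intro mult_mono powr_mono2) auto
  finally show ?thesis by (simp add: v_def)
qed

lemma v_polynomial: "v N \<le> V * (real N + 1) ^ nat \<lceil>2 * \<beta>\<rceil>"
proof -
  have "(real N + 1) powr (2 * \<beta>) \<le> (real N + 1) powr real (nat \<lceil>2 * \<beta>\<rceil>)"
    by (intro powr_mono real_nat_ceiling_ge) auto
  thus ?thesis unfolding v_def using V_ge by (intro mult_left_mono) (auto simp: powr_realpow)
qed

text \<open>Polynomial weights are comparable over the upper half of the frequencies, so their sum
  is at least a fixed multiple of the number of terms times the bound \<open>v N\<close> on the
  largest one.\<close>

lemma weight_sum_ge: "c * (real N + 1) * v N \<le> (\<Sum>k\<in>{- int N..int N}. 1 / (cmod (\<Gamma> k))\<^sup>2)"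
proof (cases "N = 0")
  case True
  have "c * V \<le> 1 / V * V" using V_ge by (intro mult_right_mono) (auto simp: c_def)
  then show ?thesis using True V_ge \<Gamma>_0 by (simp add: v_def)
next
  case False
  define J where "J = int ` {(N + 1) div 2..N}"
  have cJ: "real N + 1 \<le> 2 * real (card J)"
    by (simp add: J_def card_image)
  have sub: "J \<subseteq> {- int N..int N}" by (auto simp: J_def)
  have lower: "((real N + 1) / 4) powr (2 * \<beta>) / C_max\<^sup>2 \<le> 1 / (cmod (\<Gamma> k))\<^sup>2" if kJ: "k \<in> J" for k
  proof -
    obtain i where i: "k = int i" "(N + 1) div 2 \<le> i" "i \<le> N" using kJ unfolding J_def by (elim imageE) auto
    have "0 < i" using i(2) False by linarith
    \<comment> \<open>The factor 4 rather than 2 absorbs the rounding in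
      \<open>(N + 1) div 2\<close>.\<close>
    have "N + 1 \<le> 4 * i" using i(2) False by linarith
    hence "real (N + 1) \<le> real (4 * i)" by (simp only: of_nat_le_iff)
    hence "(real N + 1) / 4 \<le> real i" by simp
    hence "((real N + 1) / 4) powr (2 * \<beta>) \<le> real i powr (2 * \<beta>)" using beta by (intro powr_mono2) auto
    hence "((real N + 1) / 4) powr (2 * \<beta>) / C_max\<^sup>2 \<le> real i powr (2 * \<beta>) / C_max\<^sup>2" by (intro divide_right_mono) auto
    also have "\<dots> \<le> 1 / (cmod (\<Gamma> k))\<^sup>2" using inverse_square_bounds(2)[of k] i \<open>0 < i\<close> by simp
    finally show ?thesis .
  qed
  have "c * (real N + 1) * v N \<le> (1 / (2 * (4 powr (2 * \<beta>)) * C_max\<^sup>2 * V)) * (real N + 1) * v N"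
    using v_pos[of N] by (intro mult_right_mono) (auto simp: c_def)
  also have "\<dots> = (real N + 1) / 2 * (((real N + 1) / 4) powr (2 * \<beta>) / C_max\<^sup>2)"
    using V_ge C by (simp add: v_def powr_divide)
  also have "\<dots> \<le> real (card J) * (((real N + 1) / 4) powr (2 * \<beta>) / C_max\<^sup>2)"
    using cJ by (intro mult_right_mono) auto
  also have "\<dots> = (\<Sum>k\<in>J. ((real N + 1) / 4) powr (2 * \<beta>) / C_max\<^sup>2)" by simp
  also have "\<dots> \<le> (\<Sum>k\<in>J. 1 / (cmod (\<Gamma> k))\<^sup>2)" by (intro sum_mono lower)
  also have "\<dots> \<le> (\<Sum>k\<in>{- int N..int N}. 1 / (cmod (\<Gamma> k))\<^sup>2)" by (intro sum_mono2 sub) auto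
  finally show ?thesis .
qed

lemma sizes_polynomial:
  obtains A :: real and d :: nat where "1 \<le> A" "1 \<le> d"
    "\<And>n. 2 \<le> n \<Longrightarrow> 2 * real (cutoff_max \<Gamma> n) + 1 \<le> A * real n ^ d"
    "\<And>n. 2 \<le> n \<Longrightarrow> v (cutoff_max \<Gamma> n) \<le> A * real n ^ d"
    "\<And>n. 2 \<le> n \<Longrightarrow> (\<Sum>k\<in>{- int (cutoff_max \<Gamma> n)..int (cutoff_max \<Gamma> n)}. 1 / (cmod (\<Gamma> k))\<^sup>2) \<le> A * real n ^ d"
proof -
  obtain A\<^sub>0 p where A0: "1 \<le> A\<^sub>0" and m: "\<And>n. 2 \<le> n \<Longrightarrow> real (cutoff_max \<Gamma> n) \<le> A\<^sub>0 * real n ^ p"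
    using cutoff_max_polynomial by metis
  define q where "q = nat \<lceil>2 * \<beta>\<rceil>"
  \<comment> \<open>\<open>V * y ^ (q + 1) * n\<close> with \<open>y = 3 * A\<^sub>0 * n ^ p\<close>
    dominates all three sizes. \<open>A\<close> and \<open>d\<close> are its constant and its
    exponent; the extra factor \<open>n\<close> makes the exponent positive.\<close>
  define A where "A = V * (3 * A\<^sub>0) ^ (q + 1)"
  define d where "d = p * (q + 1) + 1"
  have "1 \<le> (3 * A\<^sub>0) ^ (q + 1)" using A0 by (intro one_le_power) auto
  hence A1: "1 \<le> A" using V_ge mult_mono[of 1 V 1 "(3 * A\<^sub>0) ^ (q + 1)"] by (simp add: A_def)
  have main: "2 * real (cutoff_max \<Gamma> n) + 1 \<le> A * real n ^ d" "v (cutoff_max \<Gamma> n) \<le> A * real n ^ d"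
    "(\<Sum>k\<in>{- int (cutoff_max \<Gamma> n)..int (cutoff_max \<Gamma> n)}. 1 / (cmod (\<Gamma> k))\<^sup>2) \<le> A * real n ^ d" if n: "2 \<le> n" for n
  proof -
    define m' where "m' = cutoff_max \<Gamma> n"
    define y where "y = 3 * A\<^sub>0 * real n ^ p"
    have np: "1 \<le> real n ^ p" using n by (intro one_le_power) auto
    have "1 * 1 \<le> A\<^sub>0 * real n ^ p" using A0 np by (intro mult_mono) auto
    hence y: "2 * real m' + 1 \<le> y" "real m' + 1 \<le> y" "1 \<le> y"
      using m[OF n] by (auto simp: y_def m'_def)
    have yn: "V * y ^ (q + 1) * real n = A * real n ^ d"
      unfolding y_def A_def d_def by (simp only: power_mult_distrib power_mult power_add power_one_right mult_ac)
    have V1n: "1 \<le> V * real n" using V_ge n mult_mono[of 1 V 1 "real n"] by simp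
    have vle: "v m' \<le> V * y ^ q"
      using y V_ge by (intro order_trans[OF v_polynomial] mult_left_mono) (auto simp: q_def intro!: power_mono)
    show "2 * real m' + 1 \<le> A * real n ^ d"
    proof -
      have "y ^ 1 \<le> y ^ (q + 1)" using y by (intro power_increasing) auto
      hence "1 * y \<le> (V * real n) * y ^ (q + 1)" using V1n y by (intro mult_mono) auto
      also have "(V * real n) * y ^ (q + 1) = A * real n ^ d" unfolding yn[symmetric] by (simp only: mult_ac)
      finally show ?thesis using y by linarith
    qed
    show "v m' \<le> A * real n ^ d"
    proof -
      have "y ^ q \<le> y ^ (q + 1)" using y by (intro power_increasing) auto
      hence "V * y ^ q * 1 \<le> V * y ^ (q + 1) * real n" using V_ge n y by (intro mult_mono) auto
      thus ?thesis using vle yn by simp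
    qed
    show "(\<Sum>k\<in>{- int m'..int m'}. 1 / (cmod (\<Gamma> k))\<^sup>2) \<le> A * real n ^ d"
    proof -
      have "(\<Sum>k\<in>{- int m'..int m'}. 1 / (cmod (\<Gamma> k))\<^sup>2) \<le> (\<Sum>k\<in>{- int m'..int m'}. V * y ^ q)"
        using vle by (intro sum_mono order_trans[OF weight_le_v vle]) auto
      also have "\<dots> = (2 * real m' + 1) * (V * y ^ q)" by simp
      also have "\<dots> \<le> y * (V * y ^ q)" using y V_ge by (intro mult_right_mono) auto
      also have "\<dots> = V * y ^ (q + 1) * 1" by simp
      also have "\<dots> \<le> V * y ^ (q + 1) * real n" using V_ge n y by (intro mult_left_mono) auto
      finally show ?thesis using yn by simp
    qed
  qed
  show ?thesis by (rule that[of A d]) (use A1 main in \<open>auto simp: d_def\<close>)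
qed

end

section \<open>Transfer to the estimator and its loss\<close>

context curves_model
begin

sublocale nc: noisy_cutoff "fourier_coeff f" "shift_coeff g" \<sigma> M \<delta> \<xi> n
  by (rule noisy)

lemma X_eq:
  assumes "\<omega> \<in> space M"
  shows "nc.X (\<lambda>k. \<delta> k \<omega>) (\<lambda>k. \<xi> k \<omega>) k = mean_coeff n Z \<omega> k / \<Gamma> k"
  using mean_coeff_eq[OF assms] by (simp add: nc.X_def)

lemma U_crit_eq:
  assumes \<omega>: "\<omega> \<in> space M"
  shows "U_crit \<Gamma> \<epsilon> n (mean_coeff n Z \<omega>) N = nc.U (\<lambda>k. \<delta> k \<omega>) (\<lambda>k. \<xi> k \<omega>) N"
proof -
  have "(cmod (nc.X (\<lambda>k. \<delta> k \<omega>) (\<lambda>k. \<xi> k \<omega>) k))\<^sup>2 = 1 / (cmod (\<Gamma> k))\<^sup>2 * (cmod (mean_coeff n Z \<omega> k))\<^sup>2" for k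
    unfolding X_eq[OF \<omega>] by (simp add: norm_divide power_divide)
  thus ?thesis
    unfolding U_crit_def nc.U_def nc.S_def nc.I_def nc.w_def \<sigma>2
    by (simp add: sum_subtractf sum_distrib_left right_diff_distrib mult_ac flip: sum_divide_distrib)
qed

lemma loss_eq:
  assumes \<omega>: "\<omega> \<in> space M"
  shows "(l2_norm (\<lambda>k. cutoff_estimator \<Gamma> (mean_coeff n Z \<omega>) N k - \<theta> k))\<^sup>2 = nc.LossM N \<omega>"
proof -
  define h where "h k = (cmod (cutoff_estimator \<Gamma> (mean_coeff n Z \<omega>) N k - \<theta> k))\<^sup>2" for k
  have out: "h k = (cmod (\<theta> k))\<^sup>2" if "k \<in> {k. \<bar>k\<bar> > int N}" for k
    using that by (simp add: h_def cutoff_estimator_def)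
  have inn: "h k = (cmod (nc.X (\<lambda>k. \<delta> k \<omega>) (\<lambda>k. \<xi> k \<omega>) k - \<theta> k))\<^sup>2" if "k \<in> nc.I N" for k
  proof -
    have "\<bar>k\<bar> \<le> int N" using that by (auto simp: nc.I_def)
    thus ?thesis unfolding X_eq[OF \<omega>] by (simp add: h_def cutoff_estimator_def)
  qed
  have so: "h summable_on {k. \<bar>k\<bar> > int N}"
    using nc.\<theta>_summable_on by (subst summable_on_cong[OF out])
  have "(l2_norm (\<lambda>k. cutoff_estimator \<Gamma> (mean_coeff n Z \<omega>) N k - \<theta> k))\<^sup>2 = infsum h UNIV"
    unfolding l2_norm_def by (simp add: infsum_nonneg h_def[abs_def])
  also have "UNIV = {k. \<bar>k\<bar> > int N} \<union> nc.I N" by (auto simp: nc.I_def)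
  also have "infsum h ({k. \<bar>k\<bar> > int N} \<union> nc.I N) = infsum h {k. \<bar>k\<bar> > int N} + infsum h (nc.I N)"
    by (rule infsum_Un_disjoint[OF so]) (auto simp: nc.I_def)
  also have "infsum h {k. \<bar>k\<bar> > int N} = nc.B N" unfolding nc.B_def by (rule infsum_cong[OF out])
  also have "infsum h (nc.I N) = nc.S (\<lambda>k. (cmod (nc.X (\<lambda>k. \<delta> k \<omega>) (\<lambda>k. \<xi> k \<omega>) k - \<theta> k))\<^sup>2) N"
    unfolding nc.S_def by (simp add: inn)
  finally show ?thesis by (simp add: nc.Loss_def)
qed

lemma cutoff_risk_eq: "cutoff_risk \<Gamma> \<theta> \<epsilon> n N = nc.R N"
  by (simp add: cutoff_risk_def nc.R_def nc.B_def nc.W_def nc.S_def nc.I_def nc.w_def \<sigma>2)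

end

theorem theorem2p2:
  fixes f g :: "real \<Rightarrow> real" and \<beta> C_min C_max :: real
  defines "\<theta> \<equiv> fourier_coeff f" and "\<Gamma> \<equiv> shift_coeff g"
  assumes f: "periodic_L2 f"
    and g: "prob_density g"
    and nonzero: "\<And>k. \<Gamma> k \<noteq> 0"
    and beta: "0 \<le> \<beta>" and C: "0 < C_min" "C_min \<le> C_max"
    and decay: "\<And>k. k \<noteq> 0 \<Longrightarrow>
      C_min * \<bar>real_of_int k\<bar> powr (- \<beta>) \<le> cmod (\<Gamma> k) \<and>
      cmod (\<Gamma> k) \<le> C_max * \<bar>real_of_int k\<bar> powr (- \<beta>)"
  shows "\<exists>(\<gamma>\<^sub>2::real) (h\<^sub>2 :: real \<Rightarrow> real) (C\<^sub>2::real).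
    0 < \<gamma>\<^sub>2 \<and> \<gamma>\<^sub>2 < 1 \<and> (h\<^sub>2 \<longlongrightarrow> 0) (at_right 0) \<and> 0 < C\<^sub>2 \<and>
    (\<forall>\<epsilon>>0. \<forall>n\<ge>2. \<forall>\<gamma>. 0 < \<gamma> \<and> \<gamma> < \<gamma>\<^sub>2 \<longrightarrow>
      (\<forall>(M::'a measure) \<tau> W Z (Nt :: 'a \<Rightarrow> nat).
        shifted_curves_model M f g \<epsilon> n \<tau> W Z \<and>
        Nt \<in> measurable M (count_space UNIV) \<and>
        (\<forall>\<omega>\<in>space M. is_adaptive_cutoff \<Gamma> \<epsilon> n (mean_coeff n Z \<omega>) (Nt \<omega>)) \<longrightarrow>
        (let loss = (\<lambda>\<omega>. (l2_norm (\<lambda>k. cutoff_estimator \<Gamma> (mean_coeff n Z \<omega>) (Nt \<omega>) k - \<theta> k))\<^sup>2)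
         in integrable M loss \<and>
            (\<integral>\<omega>. loss \<omega> \<partial>M) \<le>
              (1 + h\<^sub>2 \<gamma>) * (INF N\<in>{..cutoff_max \<Gamma> n}. cutoff_risk \<Gamma> \<theta> \<epsilon> n N)
              + C\<^sub>2 * \<epsilon>\<^sup>2 / real n * ((l2_norm \<theta>)\<^sup>2 * (ln (real n))\<^sup>2 / \<gamma>\<^sup>2) powr (2 * \<beta>)
              + C\<^sub>2 * \<epsilon>\<^sup>2 / real n * (1 / \<gamma> powr (4 * \<beta> + 1))
              + C\<^sub>2 / real n)))"
proof -
  have \<Gamma>_le: "cmod (\<Gamma> k) \<le> 1" for k unfolding \<Gamma>_def by (rule shift_coeff_norm_le[OF g])
  have \<Gamma>_sym: "cmod (\<Gamma> (- k)) = cmod (\<Gamma> k)" for k by (simp add: \<Gamma>_def shift_coeff_uminus)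
  interpret P: polynomial_decay \<Gamma> \<beta> C_min C_max
    using shift_coeff_0[OF g] \<Gamma>_le beta C decay by unfold_locales (auto simp: \<Gamma>_def)
  obtain A d where A: "1 \<le> A" "1 \<le> d"
    "\<And>n. 2 \<le> n \<Longrightarrow> 2 * real (cutoff_max \<Gamma> n) + 1 \<le> A * real n ^ d"
    "\<And>n. 2 \<le> n \<Longrightarrow> P.v (cutoff_max \<Gamma> n) \<le> A * real n ^ d"
    "\<And>n. 2 \<le> n \<Longrightarrow> (\<Sum>k\<in>{- int (cutoff_max \<Gamma> n)..int (cutoff_max \<Gamma> n)}. 1 / (cmod (\<Gamma> k))\<^sup>2) \<le> A * real n ^ d"
    using P.sizes_polynomial by metis
  define q where "q = nat \<lceil>2 * \<beta>\<rceil>"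
  define \<kappa> where "\<kappa> = 8 * (3 * real d + 1) * real d"
  define K\<^sub>0 where "K\<^sub>0 = 8 * P.V * fact (q + 2) * (16 / P.c) ^ (q + 2)"
  define s where "s = 2 * q + 5"
  define T where "T = (\<Sum>\<^sub>\<infinity>k. (cmod (\<theta> k))\<^sup>2)"
  \<comment> \<open>\<open>C1\<close> collects the terms of order
    \<open>\<sigma>\<^sup>2 / \<gamma>\<close>, and \<open>C3\<close> those of order
    \<open>1 / n\<close>, which involve the norm of \<open>\<theta>\<close>. Their sum is the
    witness for \<open>C\<^sub>2\<close>.\<close>
  define C1 where "C1 = 26 * A + (24 * K\<^sub>0 + 300 * A\<^sup>2) * fact s"
  define C3 where "C3 = 36 * A\<^sup>2 * T * exp (32 * (2 * real d + 1)\<^sup>2)"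
  have \<kappa>: "0 < \<kappa>" using A(2) by (simp add: \<kappa>_def)
  have K0: "0 \<le> K\<^sub>0" using P.V_ge P.c_pos by (simp add: K\<^sub>0_def)
  have T0: "0 \<le> T" unfolding T_def by (rule infsum_nonneg) simp
  have C1: "0 < C1" using A(1) K0 by (simp add: C1_def add_pos_nonneg)
  have C3: "0 \<le> C3" using T0 by (simp add: C3_def)
  define h where "h \<gamma> = 32 * sqrt (\<kappa> / ln (1 / \<gamma>))" for \<gamma> :: real
  have h_lim: "(h \<longlongrightarrow> 0) (at_right 0)"
    unfolding h_def using \<kappa> by real_asymp
  have main: "integrable M (\<lambda>\<omega>. (l2_norm (\<lambda>k. cutoff_estimator \<Gamma> (mean_coeff n Z \<omega>) (Nt \<omega>) k - \<theta> k))\<^sup>2) \<and>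
      (\<integral>\<omega>. (l2_norm (\<lambda>k. cutoff_estimator \<Gamma> (mean_coeff n Z \<omega>) (Nt \<omega>) k - \<theta> k))\<^sup>2 \<partial>M) \<le>
              (1 + h \<gamma>) * (INF N\<in>{..cutoff_max \<Gamma> n}. cutoff_risk \<Gamma> \<theta> \<epsilon> n N)
              + (C1 + C3) * \<epsilon>\<^sup>2 / real n * ((l2_norm \<theta>)\<^sup>2 * (ln (real n))\<^sup>2 / \<gamma>\<^sup>2) powr (2 * \<beta>)
              + (C1 + C3) * \<epsilon>\<^sup>2 / real n * (1 / \<gamma> powr (4 * \<beta> + 1))
              + (C1 + C3) / real n"
    if \<epsilon>: "0 < \<epsilon>" and n: "2 \<le> n" and \<gamma>: "0 < \<gamma>" "\<gamma> < exp (- (144 * \<kappa>))"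
      and model: "shifted_curves_model M f g \<epsilon> n \<tau> W Z" and Nt: "Nt \<in> measurable M (count_space UNIV)"
      and ad: "\<forall>\<omega>\<in>space M. is_adaptive_cutoff \<Gamma> \<epsilon> n (mean_coeff n Z \<omega>) (Nt \<omega>)"
    for \<epsilon> \<gamma> :: real and n and M :: "'a measure" and \<tau> W Z Nt
  proof -
    interpret cm: curves_model M f g \<epsilon> n \<tau> W Z
      using model f g nonzero \<epsilon> n by unfold_locales (auto simp: \<Gamma>_def)
    define m where "m = cutoff_max \<Gamma> n"
    have Nt_le: "Nt \<omega> \<le> m" if "\<omega> \<in> space M" for \<omega>
      using ad that by (simp add: is_adaptive_cutoff_def m_def)
    have Nt_min: "cm.nc.U (\<lambda>k. cm.\<delta> k \<omega>) (\<lambda>k. cm.\<xi> k \<omega>) (Nt \<omega>) \<le> cm.nc.U (\<lambda>k. cm.\<delta> k \<omega>) (\<lambda>k. cm.\<xi> k \<omega>) N'"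
      if "\<omega> \<in> space M" "N' \<le> m" for \<omega> N'
      using ad that unfolding is_adaptive_cutoff_def m_def \<Gamma>_def cm.U_crit_eq[OF that(1), symmetric] by blast
    have loss: "(l2_norm (\<lambda>k. cutoff_estimator \<Gamma> (mean_coeff n Z \<omega>) (Nt \<omega>) k - \<theta> k))\<^sup>2 = cm.nc.LossM (Nt \<omega>) \<omega>"
      if "\<omega> \<in> space M" for \<omega> unfolding \<Gamma>_def \<theta>_def by (rule cm.loss_eq[OF that])
    have int: "integrable M (\<lambda>\<omega>. cm.nc.LossM (Nt \<omega>) \<omega>)"
      by (rule cm.nc.Loss_Nt_integrable[OF Nt Nt_le Nt_min])
    let ?r = "INF N\<in>{..m}. cutoff_risk \<Gamma> \<theta> \<epsilon> n N"
    \<comment> \<open>Over finitely many cut-offs the infimum is attained, so a comparison with one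
      fixed \<open>N'\<close> suffices.\<close>
    have "?r \<in> (\<lambda>N. cutoff_risk \<Gamma> \<theta> \<epsilon> n N) ` {..m}"
      by (subst cInf_eq_Min) (auto intro!: Min_in)
    then obtain N' where N': "N' \<le> m" "?r = cutoff_risk \<Gamma> \<theta> \<epsilon> n N'" by auto
    have r: "?r = cm.nc.R N'" using N'(2) cm.cutoff_risk_eq[of N'] unfolding \<Gamma>_def \<theta>_def by (rule trans)
    have cut: "(ln (real n))\<^sup>2 / real n \<le> (cmod (\<Gamma> k))\<^sup>2" if "k \<in> cm.nc.I m" for k
    proof -
      have k: "\<bar>k\<bar> \<le> int m" using that by (auto simp: cm.nc.I_def)
      have "(ln (real n))\<^sup>2 / real n < (cmod (\<Gamma> (int (nat \<bar>k\<bar>))))\<^sup>2"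
        by (rule cutoff_max_gt[of \<Gamma>, OF P.\<Gamma>_0 n]) (use k in \<open>simp add: m_def\<close>)
      also have "cmod (\<Gamma> (int (nat \<bar>k\<bar>))) = cmod (\<Gamma> k)" using \<Gamma>_sym by (simp add: abs_if)
      finally show ?thesis by simp
    qed
    have wv: "cm.nc.w k \<le> P.v N" if "k \<in> cm.nc.I N" for k N
      using P.weight_le_v[of k N] that by (auto simp: cm.nc.w_def cm.nc.I_def \<Gamma>_def)
    have Wv: "P.c * (real N + 1) * P.v N \<le> cm.nc.W N" for N
      using P.weight_sum_ge[of N] by (simp add: cm.nc.W_def cm.nc.S_def cm.nc.w_def[abs_def] cm.nc.I_def \<Gamma>_def)
    have Wm: "cm.nc.W m \<le> A * real n ^ d"
      using A(5)[OF n] by (simp add: cm.nc.W_def cm.nc.S_def cm.nc.w_def[abs_def] cm.nc.I_def \<Gamma>_def m_def)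
    have V0: "0 < P.V" using P.V_ge by linarith
    have "cm.expectation (\<lambda>\<omega>. cm.nc.LossM (Nt \<omega>) \<omega>) \<le> (1 + h \<gamma>) * cm.nc.R N' + C1 * cm.\<sigma>\<^sup>2 / \<gamma> + C3 / real n"
      unfolding h_def C1_def C3_def T_def \<theta>_def cm.nc.T_def[symmetric] K\<^sub>0_def s_def \<kappa>_def
    proof (rule cm.nc.oracle_rate[OF Nt Nt_le Nt_min])
      show "P.v N \<le> P.V * (real N + 1) ^ q" for N unfolding q_def by (rule P.v_polynomial)
      show "cm.prob {\<omega> \<in> space M. x < cmod (cm.\<delta> k \<omega>)} \<le> 4 * exp (- (real n * x\<^sup>2 * (cmod (shift_coeff g k))\<^sup>2 / 8))"
        if "0 < x" for k x by (rule cm.\<delta>_deviation[OF that])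
      show "(ln (real n))\<^sup>2 / real n \<le> (cmod (shift_coeff g k))\<^sup>2" if "k \<in> cm.nc.I m" for k
        using cut[OF that] by (simp add: \<Gamma>_def)
      show "cmod (shift_coeff g k) \<le> 1" for k by (rule shift_coeff_norm_le[OF g])
      show "2 * real m + 1 \<le> A * real n ^ d" "P.v m \<le> A * real n ^ d" using A(3,4)[OF n] by (simp_all add: m_def)
      show "\<gamma> < exp (- (144 * (8 * (3 * real d + 1) * real d)))" using \<gamma>(2) by (simp add: \<kappa>_def)
    qed (use n wv Wv Wm V0 P.v_pos P.c_pos A(1,2) \<gamma>(1) N'(1) in auto)
    also have "C1 * cm.\<sigma>\<^sup>2 / \<gamma> \<le> (C1 + C3) * \<epsilon>\<^sup>2 / real n * (1 / \<gamma> powr (4 * \<beta> + 1))"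
    proof -
      have g1: "\<gamma> < 1" using \<gamma>(2) \<kappa> by (smt (verit) exp_le_one_iff)
      \<comment> \<open>Since \<open>\<gamma> < 1\<close> and \<open>\<beta> \<ge> 0\<close>, the
        rate \<open>1 / \<gamma>\<close> is dominated by the one in the statement.\<close>
      have "\<gamma> powr (4 * \<beta> + 1) \<le> \<gamma> powr 1" using \<gamma>(1) g1 beta by (intro powr_mono') auto
      hence "1 / \<gamma> \<le> 1 / \<gamma> powr (4 * \<beta> + 1)" using \<gamma>(1) by (intro divide_left_mono) auto
      moreover have "C1 * cm.\<sigma>\<^sup>2 \<le> (C1 + C3) * \<epsilon>\<^sup>2 / real n"
        unfolding cm.\<sigma>2 times_divide_eq_right using C3 by (intro divide_right_mono mult_right_mono) auto
      ultimately have "C1 * cm.\<sigma>\<^sup>2 * (1 / \<gamma>) \<le> (C1 + C3) * \<epsilon>\<^sup>2 / real n * (1 / \<gamma> powr (4 * \<beta> + 1))"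
        using C1 C3 \<gamma>(1) by (intro mult_mono) auto
      thus ?thesis by simp
    qed
    also have "C3 / real n \<le> (C1 + C3) / real n" using C1 by (intro divide_right_mono) auto
    finally have "cm.expectation (\<lambda>\<omega>. cm.nc.LossM (Nt \<omega>) \<omega>) \<le> (1 + h \<gamma>) * ?r
      + (C1 + C3) * \<epsilon>\<^sup>2 / real n * (1 / \<gamma> powr (4 * \<beta> + 1)) + (C1 + C3) / real n"
      unfolding r by simp
    moreover have "0 \<le> (C1 + C3) * \<epsilon>\<^sup>2 / real n * ((l2_norm \<theta>)\<^sup>2 * (ln (real n))\<^sup>2 / \<gamma>\<^sup>2) powr (2 * \<beta>)"
      using C1 C3 by simp
    moreover have "cm.expectation (\<lambda>\<omega>. (l2_norm (\<lambda>k. cutoff_estimator \<Gamma> (mean_coeff n Z \<omega>) (Nt \<omega>) k - \<theta> k))\<^sup>2) =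
      cm.expectation (\<lambda>\<omega>. cm.nc.LossM (Nt \<omega>) \<omega>)"
      by (rule Bochner_Integration.integral_cong[OF refl loss])
    moreover have "integrable M (\<lambda>\<omega>. (l2_norm (\<lambda>k. cutoff_estimator \<Gamma> (mean_coeff n Z \<omega>) (Nt \<omega>) k - \<theta> k))\<^sup>2)"
      using int by (subst Bochner_Integration.integrable_cong[OF refl loss])
    ultimately show ?thesis unfolding m_def by linarith
  qed
  show ?thesis
  proof (intro exI conjI)
    show "0 < exp (- (144 * \<kappa>))" by simp
    show "exp (- (144 * \<kappa>)) < 1" using \<kappa> by simp
    show "(h \<longlongrightarrow> 0) (at_right 0)" by (rule h_lim)
    show "0 < C1 + C3" using C1 C3 by simp
    show "\<forall>\<epsilon>>0. \<forall>n\<ge>2. \<forall>\<gamma>. 0 < \<gamma> \<and> \<gamma> < exp (- (144 * \<kappa>)) \<longrightarrow>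
      (\<forall>(M::'a measure) \<tau> W Z (Nt :: 'a \<Rightarrow> nat).
        shifted_curves_model M f g \<epsilon> n \<tau> W Z \<and>
        Nt \<in> measurable M (count_space UNIV) \<and>
        (\<forall>\<omega>\<in>space M. is_adaptive_cutoff \<Gamma> \<epsilon> n (mean_coeff n Z \<omega>) (Nt \<omega>)) \<longrightarrow>
        (let loss = (\<lambda>\<omega>. (l2_norm (\<lambda>k. cutoff_estimator \<Gamma> (mean_coeff n Z \<omega>) (Nt \<omega>) k - \<theta> k))\<^sup>2)
         in integrable M loss \<and>
            (\<integral>\<omega>. loss \<omega> \<partial>M) \<le>
              (1 + h \<gamma>) * (INF N\<in>{..cutoff_max \<Gamma> n}. cutoff_risk \<Gamma> \<theta> \<epsilon> n N)
              + (C1 + C3) * \<epsilon>\<^sup>2 / real n * ((l2_norm \<theta>)\<^sup>2 * (ln (real n))\<^sup>2 / \<gamma>\<^sup>2) powr (2 * \<beta>)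
              + (C1 + C3) * \<epsilon>\<^sup>2 / real n * (1 / \<gamma> powr (4 * \<beta> + 1))
              + (C1 + C3) / real n))"
      unfolding Let_def using main by blast
  qed
qed

end
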